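(* Let $K=\mathbb{F}_q$ be a finite field of characteristic greater than $3$. Then for all integers $m\geq 8$ except finitely many, there exists a constant $C=C(m)>0$ depending only on $m$ and a sequence of positive integers $(n_k)_{k\in\mathbb{N}}$ such that $$\limsup_{k\to\infty}\frac{q^{n_k}-A(\mathbb{F}_{q^{n_k}},m)}{C\sqrt{q^{n_k}}}\geq 1.$$
   Context: For a prime power $Q$, a $(k,m)$-arc in the projective plane $\mathrm{PG}(2,Q)$ is a set of $k$ points, no $m+1$ of which are collinear, and containing $m$ collinear points; a complete $m$-arc is a $(k,m)$-arc that is maximal with respect to set-theoretic inclusion. $A(\mathbb{F}_Q,m)$ denotes the smallest size of a complete $m$-arc in $\mathrm{PG}(2,Q)$. *)

theory Defs
  imports "HOL-Algebra.Algebra" "HOL-Library.Extended_Real" "HOL-Library.Liminf_Limsup"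
begin

(* The additive order of 1; group.ord is 0 for elements of infinite order. *)
definition ring_char :: "('a, 'b) ring_scheme \<Rightarrow> nat" where
  "ring_char R = group.ord (add_monoid R) \<one>\<^bsub>R\<^esub>"

(* For a prime power Q, fields of order Q exist and are unique up to isomorphism, so an
   arbitrary representative can be picked; being countable, it can be carried by nat. *)
definition GF :: "nat \<Rightarrow> nat ring" where
  "GF Q = (SOME R. field R \<and> order R = Q)"

definition nonzero_triples :: "('a, 'b) ring_scheme \<Rightarrow> ('a \<times> 'a \<times> 'a) set" where
  "nonzero_triples R =
     carrier R \<times> carrier R \<times> carrier R - {(\<zero>\<^bsub>R\<^esub>, \<zero>\<^bsub>R\<^esub>, \<zero>\<^bsub>R\<^esub>)}"

(* (x : y : z), as the set of all its homogeneous coordinate vectors *)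
definition proj_point :: "('a, 'b) ring_scheme \<Rightarrow> 'a \<times> 'a \<times> 'a \<Rightarrow> ('a \<times> 'a \<times> 'a) set" where
  "proj_point R = (\<lambda>(x, y, z).
     {(c \<otimes>\<^bsub>R\<^esub> x, c \<otimes>\<^bsub>R\<^esub> y, c \<otimes>\<^bsub>R\<^esub> z) | c. c \<in> carrier R - {\<zero>\<^bsub>R\<^esub>}})"

definition PG2_points :: "('a, 'b) ring_scheme \<Rightarrow> ('a \<times> 'a \<times> 'a) set set" where
  "PG2_points R = proj_point R ` nonzero_triples R"

(* The line with equation a x + b y + c z = 0 *)
definition proj_line :: "('a, 'b) ring_scheme \<Rightarrow> 'a \<times> 'a \<times> 'a \<Rightarrow> ('a \<times> 'a \<times> 'a) set set" where
  "proj_line R = (\<lambda>(a, b, c). {P \<in> PG2_points R. \<forall>(x, y, z) \<in> P.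
     a \<otimes>\<^bsub>R\<^esub> x \<oplus>\<^bsub>R\<^esub> b \<otimes>\<^bsub>R\<^esub> y \<oplus>\<^bsub>R\<^esub> c \<otimes>\<^bsub>R\<^esub> z = \<zero>\<^bsub>R\<^esub>})"

definition PG2_lines :: "('a, 'b) ring_scheme \<Rightarrow> ('a \<times> 'a \<times> 'a) set set set" where
  "PG2_lines R = proj_line R ` nonzero_triples R"

definition PG2_collinear :: "('a, 'b) ring_scheme \<Rightarrow> ('a \<times> 'a \<times> 'a) set set \<Rightarrow> bool" where
  "PG2_collinear R T \<longleftrightarrow> (\<exists>l \<in> PG2_lines R. T \<subseteq> l)"

definition is_arc ::
    "('a, 'b) ring_scheme \<Rightarrow> nat \<Rightarrow> nat \<Rightarrow> ('a \<times> 'a \<times> 'a) set set \<Rightarrow> bool" where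
  "is_arc R k m S \<longleftrightarrow>
     S \<subseteq> PG2_points R \<and> finite S \<and> card S = k \<and>
     \<not> (\<exists>T \<subseteq> S. card T = m + 1 \<and> PG2_collinear R T) \<and>
     (\<exists>T \<subseteq> S. card T = m \<and> PG2_collinear R T)"

(* Maximality is among all (k',m)-arcs, with m fixed and k' arbitrary. *)
definition is_complete_arc ::
    "('a, 'b) ring_scheme \<Rightarrow> nat \<Rightarrow> ('a \<times> 'a \<times> 'a) set set \<Rightarrow> bool" where
  "is_complete_arc R m S \<longleftrightarrow>
     (\<exists>k. is_arc R k m S) \<and> (\<forall>k' S'. is_arc R k' m S' \<and> S \<subseteq> S' \<longrightarrow> S' = S)"

(* A(F_Q, m). The value is \<infinity> if PG(2,Q) has no complete m-arc (e.g. if m > Q + 1). *)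
definition min_complete_arc :: "nat \<Rightarrow> nat \<Rightarrow> enat" where
  "min_complete_arc Q m = (INF S \<in> {S. is_complete_arc (GF Q) m S}. enat (card S))"

end

theory Submission
  imports Defs "HOL-Computational_Algebra.Computational_Algebra"
    "HOL-Algebra.Algebraic_Closure_Type" "HOL-Library.Cardinality"
begin

text \<open>
Let \<open>M\<close> be the power of the characteristic \<open>p\<close> with \<open>M \<le> (m - 2) / 4 < p M\<close>, and let \<open>Q = M\<^sup>2\<^sup>h\<close> be
a power of \<open>q\<close> with \<open>h\<close> large. Write \<open>Tr\<close> for the trace from \<open>F\<^sub>Q\<close> to the field \<open>F\<close> with
\<open>M\<^sup>2\<close> elements. Take \<open>K \<subseteq> F\<close> to be a union of \<open>j < M\<close> cosets of the field with \<open>M\<close> elements, put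
\<open>d = m - j M\<close>, choose \<open>\<delta> 0, \<dots>, \<delta> (d - 1)\<close> linearly independent over \<open>F\<close>, let
\<open>\<phi> k x = \<Sum>i<d. k\<^sup>i Tr (\<delta> i x)\<close>, and consider the set \<open>S\<close> of all points \<open>(x, x\<^sup>2 + k)\<close> with \<open>k \<in> K\<close>
and \<open>\<phi> k x = - k\<^sup>d\<close>; it has \<open>(j / M) Q\<close> elements.

A line of slope \<open>2 \<tau>\<close> meets the parabola with constant term \<open>k\<close> in points with abscissas \<open>\<tau> \<plusminus> w\<close>. If both
belong to \<open>S\<close>, then \<open>\<phi> k \<tau> = - k\<^sup>d\<close>, so that \<open>k\<close> is a root of a monic polynomial of degree \<open>d\<close>;
hence no line contains more than \<open>card K + d = m\<close> points of \<open>S\<close>. Conversely, through every affine point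
outside \<open>S\<close> there is a line with \<open>m\<close> points of \<open>S\<close>: its slope and the square roots \<open>w\<close> must have prescribed
traces, and such a slope exists by point counts for Artin--Schreier covers of the curves
\<open>w\<^sub>k\<^sup>2 = z\<^sup>2 + e - k\<close>, \<open>k \<in> K\<close>. The upper bound \<open>Q + O(\<surd>Q)\<close> for these counts is obtained by
Bombieri's form of Stepanov's method, and the lower bound by summing over quadratic twists. Consequently a
maximal \<open>m\<close>-arc containing \<open>S\<close> has at most \<open>m\<close> further points, all of them at infinity, so
\<open>Q - A(F\<^sub>Q, m) \<ge> Q / M - m\<close>, which exceeds \<open>\<surd>Q\<close> for large \<open>h\<close>.
\<close>

text \<open>The freedom lies in the choice of which parabolas a line meets twice inside the arc.
  Prescribing the traces of \<open>\<tau>\<close> makes any \<open>d\<close> elements of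
  \<open>F\<close> the roots of the monic polynomial; these parabolas give two points each, the
  others are arranged to give one. The obstacle is a point that lies on a parabola used but not in
  the arc. That parabola must then contribute the other intersection with the line, which holds only
  if a product of differences over the doubly met parabolas has a prescribed nonzero value in
  \<open>F\<close>. The coset structure of \<open>K\<close> makes all these values attainable.
  Working in a field with \<open>M ^ 2\<close> elements leaves room for \<open>K\<close> of size
  \<open>j * M\<close> below \<open>M ^ 2\<close>, so that the arc omits a fixed proportion of
  \<open>Q\<close>. The number of curves and conditions depends on \<open>p\<close> and
  \<open>m\<close> only, hence a large \<open>h\<close> beats all error terms. That \<open>Q\<close>
  is a square is also used in the Stepanov argument. The gap grows like \<open>Q / M\<close>, which
  is why the same constant 1 serves for every \<open>m\<close>.\<close>

hide_const (open) Divisibility.prime Divisibility.irreducible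

section \<open>A point-counting bound for rings of power series\<close>

definition lin_span :: "('x \<Rightarrow> 'a::field fps) \<Rightarrow> 'x set \<Rightarrow> 'a fps set" where
  "lin_span e E = range (\<lambda>c. \<Sum>x\<in>E. fps_const (c x) * e x)"

definition lin_indep :: "('x \<Rightarrow> 'a::field fps) \<Rightarrow> 'x set \<Rightarrow> bool" where
  "lin_indep e E \<longleftrightarrow> (\<forall>c. (\<Sum>x\<in>E. fps_const (c x) * e x) = 0 \<longrightarrow> (\<forall>x\<in>E. c x = 0))"

lemma lin_spanI: "f = (\<Sum>x\<in>E. fps_const (c x) * e x) \<Longrightarrow> f \<in> lin_span e E"
  unfolding lin_span_def by blast

lemma lin_span_add: "f \<in> lin_span e E \<Longrightarrow> g \<in> lin_span e E \<Longrightarrow> f + g \<in> lin_span e E"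
proof -
  assume "f \<in> lin_span e E" "g \<in> lin_span e E"
  then obtain c d where "f = (\<Sum>x\<in>E. fps_const (c x) * e x)" "g = (\<Sum>x\<in>E. fps_const (d x) * e x)"
    unfolding lin_span_def by auto
  then have "f + g = (\<Sum>x\<in>E. fps_const (c x + d x) * e x)"
    by (simp add: sum.distrib[symmetric] ring_distribs fps_const_add[symmetric] del: fps_const_add)
  then show ?thesis by (rule lin_spanI)
qed

lemma lin_span_smult: "f \<in> lin_span e E \<Longrightarrow> fps_const a * f \<in> lin_span e E"
proof -
  assume "f \<in> lin_span e E"
  then obtain c where "f = (\<Sum>x\<in>E. fps_const (c x) * e x)"
    unfolding lin_span_def by auto
  then have "fps_const a * f = (\<Sum>x\<in>E. fps_const (a * c x) * e x)"
    by (simp add: sum_distrib_left mult.assoc[symmetric])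
  then show ?thesis by (rule lin_spanI)
qed

lemma lin_span_0: "0 \<in> lin_span e E"
  by (rule lin_spanI[where c = "\<lambda>_. 0"]) simp

lemma lin_span_diff: "f \<in> lin_span e E \<Longrightarrow> g \<in> lin_span e E \<Longrightarrow> f - g \<in> lin_span e E"
  using lin_span_add[of f e E "fps_const (-1) * g"] lin_span_smult[of g e E "-1"]
  by (simp add: fps_const_neg[symmetric] del: fps_const_neg)

lemma lin_span_sum: "(\<And>i. i \<in> I \<Longrightarrow> f i \<in> lin_span e E) \<Longrightarrow> sum f I \<in> lin_span e E"
  by (induction I rule: infinite_finite_induct) (auto intro: lin_span_0 lin_span_add)

lemma lin_span_base:
  assumes "finite E" "x \<in> E" shows "e x \<in> lin_span e E"
proof (rule lin_spanI[where c = "\<lambda>y. if y = x then 1 else 0"])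
  have "(\<Sum>y\<in>E. fps_const (if y = x then 1 else 0) * e y) = (\<Sum>y\<in>E. if y = x then e y else 0)"
    by (rule sum.cong) auto
  also have "\<dots> = e x" using assms by simp
  finally show "e x = (\<Sum>y\<in>E. fps_const (if y = x then 1 else 0) * e y)" by simp
qed

lemma lin_span_subset:
  assumes "finite E'" "E \<subseteq> E'" shows "lin_span e E \<subseteq> lin_span e E'"
proof
  fix f assume "f \<in> lin_span e E"
  then obtain c where c: "f = (\<Sum>x\<in>E. fps_const (c x) * e x)" unfolding lin_span_def by auto
  show "f \<in> lin_span e E'" unfolding c
    by (intro lin_span_sum lin_span_smult lin_span_base) (use assms in auto)
qed

text \<open>Extensional coefficient functions are determined by their values on \<open>E\<close>, so
  they can be counted.\<close>

lemma lin_span_PiE: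
  "lin_span e E = (\<lambda>c. \<Sum>x\<in>E. fps_const (c x) * e x) ` (E \<rightarrow>\<^sub>E UNIV)"
proof -
  have "\<exists>d\<in>E \<rightarrow>\<^sub>E UNIV. (\<Sum>x\<in>E. fps_const (c x) * e x) = (\<Sum>x\<in>E. fps_const (d x) * e x)" for c
    by (rule bexI[of _ "restrict c E"]) auto
  then show ?thesis unfolding lin_span_def by auto
qed

text \<open>With a finite coefficient field, numbers of elements replace dimensions: dimension
  arguments below become comparisons of cardinalities of spans.\<close>

lemma card_lin_span:
  fixes e :: "'x \<Rightarrow> 'a::finite_field fps"
  assumes "finite E" "lin_indep e E"
  shows "card (lin_span e E) = CARD('a) ^ card E" and "finite (lin_span e E)"
proof -
  have "inj_on (\<lambda>c. \<Sum>x\<in>E. fps_const (c x) * e x) (E \<rightarrow>\<^sub>E UNIV)"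
  proof (rule inj_onI)
    fix c d assume cd: "c \<in> E \<rightarrow>\<^sub>E UNIV" "d \<in> E \<rightarrow>\<^sub>E UNIV"
      and eq: "(\<Sum>x\<in>E. fps_const (c x) * e x) = (\<Sum>x\<in>E. fps_const (d x) * e x)"
    have "(\<Sum>x\<in>E. fps_const (c x - d x) * e x) = 0"
      using eq by (simp add: fps_const_sub[symmetric] ring_distribs sum_subtractf del: fps_const_sub)
    then have "\<forall>x\<in>E. c x - d x = 0" using assms(2)[unfolded lin_indep_def, rule_format, of "\<lambda>x. c x - d x"] by blast
    then show "c = d" using cd by (intro PiE_ext[OF cd]) auto
  qed
  then have "card (lin_span e E) = card (E \<rightarrow>\<^sub>E (UNIV :: 'a set))"
    unfolding lin_span_PiE by (rule card_image)
  then show "card (lin_span e E) = CARD('a) ^ card E" using assms(1) by (simp add: card_PiE)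
  show "finite (lin_span e E)" unfolding lin_span_PiE using assms(1) by (intro finite_imageI finite_PiE) auto
qed

text \<open>Gaussian elimination by order of vanishing: one element for each order that occurs in
  \<open>V\<close> suffices, and the bound \<open>M\<close> makes the elimination stop.\<close>

lemma echelon_basis:
  fixes V :: "'a::field fps set"
  assumes zero: "0 \<in> V" and cl: "\<And>f g a. f \<in> V \<Longrightarrow> g \<in> V \<Longrightarrow> f - fps_const a * g \<in> V"
    and bd: "\<And>f. f \<in> V \<Longrightarrow> f \<noteq> 0 \<Longrightarrow> subdegree f < M"
  obtains N e where "finite N" "N \<subseteq> {..<M}" "\<And>n. n \<in> N \<Longrightarrow> e n \<noteq> 0 \<and> subdegree (e n) = n"
    "\<And>f. f \<in> V \<Longrightarrow> \<exists>c. f = (\<Sum>n\<in>N. fps_const (c n) * e n)"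
proof -
  define N where "N = subdegree ` (V - {0})"
  have sub: "N \<subseteq> {..<M}" using bd unfolding N_def by auto
  then have fin: "finite N" by (rule finite_subset) simp
  have "\<forall>n\<in>N. \<exists>f. f \<in> V - {0} \<and> subdegree f = n" unfolding N_def by auto
  then obtain e where e: "\<And>n. n \<in> N \<Longrightarrow> e n \<in> V - {0} \<and> subdegree (e n) = n" by metis
  have "\<exists>c. f = (\<Sum>n\<in>N. fps_const (c n) * e n)" if "f \<in> V" for f
    using that
  proof (induction "M - subdegree f" arbitrary: f rule: less_induct)
    case less
    show ?case
    proof (cases "f = 0")
      case True then show ?thesis by (intro exI[of _ "\<lambda>_. 0"]) simp
    next
      case False
      define n where "n = subdegree f"
      have nN: "n \<in> N" unfolding n_def N_def using False less.prems by auto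
      define a where "a = f $ n / e n $ n"
      define g where "g = f - fps_const a * e n"
      have nz: "e n \<noteq> 0" and sn: "subdegree (e n) = n" using e[OF nN] by auto
      have en: "e n $ n \<noteq> 0" using nth_subdegree_nonzero[OF nz] unfolding sn .
      have gV: "g \<in> V" unfolding g_def using cl less.prems e[OF nN] by auto
      have gz: "g $ i = 0" if "i \<le> n" for i
      proof (cases "i = n")
        case True then show ?thesis unfolding g_def a_def using en by simp
      next
        case False
        then have "i < subdegree f" "i < subdegree (e n)" using that sn n_def by auto
        then have "f $ i = 0" "e n $ i = 0" by (auto dest: nth_less_subdegree_zero)
        then show ?thesis unfolding g_def by simp
      qed
      have "\<exists>c. g = (\<Sum>n\<in>N. fps_const (c n) * e n)"
      proof (cases "g = 0")
        case True then show ?thesis by (intro exI[of _ "\<lambda>_. 0"]) simp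
      next
        case False
        have "subdegree g > n" by (rule subdegree_greaterI) (use gz False in auto)
        moreover have "subdegree f < M" using bd less.prems \<open>f \<noteq> 0\<close> by auto
        ultimately have "M - subdegree g < M - subdegree f" unfolding n_def by auto
        then show ?thesis using less.hyps gV by blast
      qed
      then obtain c where c: "g = (\<Sum>n\<in>N. fps_const (c n) * e n)" by blast
      have "f = g + fps_const a * e n" unfolding g_def by simp
      also have "fps_const a * e n = (\<Sum>k\<in>N. fps_const (if k = n then a else 0) * e k)"
      proof -
        have "(\<Sum>k\<in>N. fps_const (if k = n then a else 0) * e k) = (\<Sum>k\<in>N. if k = n then fps_const a * e k else 0)"
          by (rule sum.cong) auto
        then show ?thesis using fin nN by simp
      qed
      also have "g + \<dots> = (\<Sum>k\<in>N. fps_const (c k + (if k = n then a else 0)) * e k)"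
        unfolding c by (simp add: sum.distrib[symmetric] ring_distribs fps_const_add[symmetric] del: fps_const_add)
      finally show ?thesis by (rule exI[of _ "\<lambda>k. c k + (if k = n then a else 0)"])
    qed
  qed
  then show ?thesis using that[OF fin sub, of e] e by auto
qed

lemma frobenius_surj:
  assumes "r = CHAR('a::finite_field) ^ \<mu>"
  shows "\<exists>y::'a. y ^ r = x"
proof -
  have p: "prime CHAR('a)" by simp
  have r0: "r > 0" using assms by simp
  have "inj (\<lambda>y::'a. y ^ r)"
  proof (rule injI)
    fix x y :: 'a assume "x ^ r = y ^ r"
    moreover have "(y + (x - y)) ^ r = y ^ r + (x - y) ^ r" by (rule freshmans_dream'[OF p assms])
    ultimately have "(x - y) ^ r = 0" by simp
    then show "x = y" using r0 by simp
  qed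
  then have "surj (\<lambda>y::'a. y ^ r)" by (rule finite_UNIV_inj_surj[OF finite])
  then show ?thesis by (metis surjD)
qed

text \<open>The summand of smallest order contributes the lowest coefficient, and nothing can cancel
  it.\<close>

lemma subdegree_sum_distinct_nonzero:
  fixes f :: "'i \<Rightarrow> 'a::idom fps"
  assumes "finite I" "I \<noteq> {}" "\<And>i. i \<in> I \<Longrightarrow> f i \<noteq> 0" "inj_on (\<lambda>i. subdegree (f i)) I"
  shows "sum f I \<noteq> 0"
proof -
  define i where "i = arg_min_on (\<lambda>i. subdegree (f i)) I"
  have i: "i \<in> I" "\<forall>j\<in>I. subdegree (f i) \<le> subdegree (f j)"
    using arg_min_if_finite[OF assms(1,2), of "\<lambda>i. subdegree (f i)"] unfolding i_def by (auto simp: not_less)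
  have "sum f I $ subdegree (f i) = (\<Sum>j\<in>I. if j = i then f i $ subdegree (f i) else 0)"
    unfolding fps_sum_nth
  proof (rule sum.cong)
    fix j assume j: "j \<in> I"
    show "f j $ subdegree (f i) = (if j = i then f i $ subdegree (f i) else 0)"
    proof (cases "j = i")
      case False
      then have "subdegree (f i) < subdegree (f j)" using i j assms(4) by (metis inj_onD le_neq_implies_less)
      then show ?thesis using False by (simp add: nth_less_subdegree_zero)
    qed simp
  qed simp
  also have "\<dots> \<noteq> 0" using i(1) assms by simp
  finally show ?thesis by auto
qed

text \<open>In an echelon basis of \<open>V\<close> the sum becomes a combination of the
  \<open>e n\<close> with coefficients \<open>U n ^ r\<close>. As all orders \<open>n\<close> are
  below \<open>r\<close>, the orders of its nonzero terms differ modulo \<open>r\<close>, so all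
  \<open>U n\<close> vanish; then independence of \<open>b\<close> applies.\<close>

lemma frobenius_twist_injective:
  fixes V :: "'a::finite_field fps set" and b :: "'x \<Rightarrow> 'a fps"
  assumes r: "r = CHAR('a) ^ \<mu>"
    and zero: "0 \<in> V" and cl: "\<And>f g a. f \<in> V \<Longrightarrow> g \<in> V \<Longrightarrow> f - fps_const a * g \<in> V"
    and bd: "\<And>f. f \<in> V \<Longrightarrow> f \<noteq> 0 \<Longrightarrow> subdegree f < r"
    and B: "finite B" "lin_indep b B"
    and s: "\<And>x. x \<in> B \<Longrightarrow> s x \<in> V" and eq: "(\<Sum>x\<in>B. s x * b x ^ r) = 0"
    and x: "x \<in> B"
  shows "s x = 0"
proof -
  obtain N e where N: "finite N" "N \<subseteq> {..<r}" and e: "\<And>n. n \<in> N \<Longrightarrow> e n \<noteq> 0 \<and> subdegree (e n) = n"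
    and rep: "\<And>f. f \<in> V \<Longrightarrow> \<exists>c. f = (\<Sum>n\<in>N. fps_const (c n) * e n)"
    using echelon_basis[of V r, OF zero cl bd] by blast
  have "\<forall>x\<in>B. \<exists>c. s x = (\<Sum>n\<in>N. fps_const (c n ^ r) * e n)"
  proof
    fix x assume "x \<in> B"
    then obtain c where c: "s x = (\<Sum>n\<in>N. fps_const (c n) * e n)" using rep s by blast
    \<comment> \<open>Coefficients are written as \<open>r\<close>-th powers so that they can be
      moved inside \<open>U n ^ r\<close>.\<close>
    have "\<forall>n. \<exists>d. d ^ r = c n" using frobenius_surj[OF r] by blast
    then obtain d where "\<forall>n. d n ^ r = c n" by (rule choice[THEN exE])
    then show "\<exists>c. s x = (\<Sum>n\<in>N. fps_const (c n ^ r) * e n)" using c by (intro exI[of _ d]) simp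
  qed
  then obtain c where c: "\<And>x. x \<in> B \<Longrightarrow> s x = (\<Sum>n\<in>N. fps_const (c x n ^ r) * e n)"
    by (auto dest: bchoice)
  define U where "U n = (\<Sum>x\<in>B. fps_const (c x n) * b x)" for n
  have pc: "prime CHAR('a fps)" by simp
  have U: "U n ^ r = (\<Sum>x\<in>B. fps_const (c x n ^ r) * b x ^ r)" for n
    unfolding U_def using freshmans_dream_sum'[OF pc, of r \<mu> "\<lambda>x. fps_const (c x n) * b x" B] r
    by (simp add: power_mult_distrib)
  have "(\<Sum>n\<in>N. e n * U n ^ r) = (\<Sum>x\<in>B. s x * b x ^ r)"
  proof -
    have "(\<Sum>x\<in>B. s x * b x ^ r) = (\<Sum>x\<in>B. \<Sum>n\<in>N. e n * (fps_const (c x n ^ r) * b x ^ r))"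
      by (intro sum.cong) (auto simp: c sum_distrib_left sum_distrib_right mult_ac)
    also have "\<dots> = (\<Sum>n\<in>N. \<Sum>x\<in>B. e n * (fps_const (c x n ^ r) * b x ^ r))" by (rule sum.swap)
    finally show ?thesis by (simp add: U sum_distrib_left)
  qed
  then have z: "(\<Sum>n\<in>N. e n * U n ^ r) = 0" using eq by simp
  define N' where "N' = {n\<in>N. U n \<noteq> 0}"
  have "N' = {}"
  proof (rule ccontr)
    assume ne: "N' \<noteq> {}"
    have r0: "r > 0" using r by simp
    have "(\<Sum>n\<in>N. e n * U n ^ r) = (\<Sum>n\<in>N'. e n * U n ^ r)"
      unfolding N'_def by (rule sum.mono_neutral_right) (use N r0 in auto)
    moreover have "(\<Sum>n\<in>N'. e n * U n ^ r) \<noteq> 0"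
    proof (rule subdegree_sum_distinct_nonzero)
      show "finite N'" using N unfolding N'_def by auto
      show "N' \<noteq> {}" by fact
      show "e n * U n ^ r \<noteq> 0" if "n \<in> N'" for n using that e unfolding N'_def by auto
      have sd: "subdegree (e n * U n ^ r) = n + r * subdegree (U n)" if "n \<in> N'" for n
        using that e unfolding N'_def by (simp add: mult.commute)
      show "inj_on (\<lambda>n. subdegree (e n * U n ^ r)) N'"
      proof (rule inj_onI)
        fix m n assume mn: "m \<in> N'" "n \<in> N'" "subdegree (e m * U m ^ r) = subdegree (e n * U n ^ r)"
        then have "(m + r * subdegree (U m)) mod r = (n + r * subdegree (U n)) mod r" using sd by metis
        moreover have "m < r" "n < r" using mn N unfolding N'_def by auto
        ultimately show "m = n" by simp
      qed
    qed
    ultimately show False using z by simp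
  qed
  then have U0: "U n = 0" if "n \<in> N" for n using that unfolding N'_def by auto
  have c0: "c x n = 0" if "n \<in> N" for n
    using U0[OF that] B(2)[unfolded lin_indep_def, rule_format, of "\<lambda>x. c x n"] x unfolding U_def by blast
  have r0: "r > 0" using r by simp
  show ?thesis unfolding c[OF x] by (rule sum.neutral) (use c0 r0 in auto)
qed

text \<open>\<open>L n\<close> plays the role of a Riemann--Roch space of functions with poles of order about \<open>D n\<close> at
  infinity, expanded at a rational point. Its multiplicative defect \<open>c\<close> absorbs the genus.\<close>

locale curve_ring =
  fixes e :: "'x \<Rightarrow> 'a::finite_field fps" and E :: "nat \<Rightarrow> 'x set" and D c :: nat
    and Pts :: "'p set" and ev :: "'p \<Rightarrow> 'a fps \<Rightarrow> 'a"
  assumes finE: "finite (E n)" and monoE: "k \<le> n \<Longrightarrow> E k \<subseteq> E n" and cardE: "card (E n) = D * n"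
    and indep: "lin_indep e (E n)"
    and mult: "f \<in> lin_span e (E k) \<Longrightarrow> g \<in> lin_span e (E n) \<Longrightarrow> f * g \<in> lin_span e (E (k + n + c))"
    and X_power: "fps_X ^ i \<in> lin_span e (E (Suc i))"
    and ev_add: "P \<in> Pts \<Longrightarrow> f \<in> lin_span e (E k) \<Longrightarrow> g \<in> lin_span e (E n) \<Longrightarrow> ev P (f + g) = ev P f + ev P g"
    and ev_mult: "P \<in> Pts \<Longrightarrow> f \<in> lin_span e (E k) \<Longrightarrow> g \<in> lin_span e (E n) \<Longrightarrow> ev P (f * g) = ev P f * ev P g"
    and ev_const: "P \<in> Pts \<Longrightarrow> ev P (fps_const a) = a"
    and separating: "P \<in> Pts \<Longrightarrow> \<exists>k. \<exists>f \<in> lin_span e (E k). ev P f = 1 \<and> (\<forall>P'\<in>Pts. P' \<noteq> P \<longrightarrow> ev P' f = 0)"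
    and finite_Pts: "finite Pts"
begin

abbreviation "L n \<equiv> lin_span e (E n)"

lemma card_L: "card (L n) = CARD('a) ^ (D * n)" and finite_L: "finite (L n)"
  using card_lin_span[OF finE indep] cardE by auto

lemma L_mono: "k \<le> n \<Longrightarrow> f \<in> L k \<Longrightarrow> f \<in> L n"
  using lin_span_subset[OF finE monoE] by blast

lemma one_in_L: "1 \<in> L 1"
  using X_power[of 0] by simp

lemma const_in_L: "fps_const a \<in> L 1"
  using lin_span_smult[OF one_in_L, of a] by simp

lemma L_power: "f \<in> L k \<Longrightarrow> f ^ Suc n \<in> L (Suc n * k + n * c)"
proof (induction n)
  case (Suc n)
  have "f * f ^ Suc n \<in> L (k + (Suc n * k + n * c) + c)" by (rule mult) (use Suc in auto)
  then show ?case by (simp add: algebra_simps)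
qed simp

lemma L_power': "f \<in> L k \<Longrightarrow> n > 0 \<Longrightarrow> f ^ n \<in> L (n * (k + c))"
  using L_power[of f k "n - 1"] L_mono[of "n * k + (n - 1) * c" "n * (k + c)" "f ^ n"]
  by (auto simp: algebra_simps)

lemma card_field_gt_1: "CARD('a) > 1"
  using card_mono[of UNIV "{0, 1::'a}"] by simp

text \<open>Polynomials in \<open>fps_X\<close> of degree below \<open>B = subdegree f\<close> and
  multiples of \<open>f\<close> meet only in 0. Hence \<open>W\<close> and \<open>f * L B\<close>
  fit side by side into \<open>L (B + m + c)\<close>, and counting gives
  \<open>B + D * B \<le> D * (B + m + c)\<close>.\<close>

lemma subdegree_L:
  assumes "f \<in> L m" "f \<noteq> 0" shows "subdegree f \<le> D * (m + c)"
proof -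
  define B where "B = subdegree f"
  define W where "W = lin_span (\<lambda>i. fps_X ^ i :: 'a fps) {..<B}"
  have coef: "(\<Sum>i<B. fps_const (d i) * fps_X ^ i :: 'a fps) $ n = (if n < B then d n else 0)" for d n
    by (simp add: fps_sum_nth fps_X_power_nth if_distrib[of "\<lambda>x. _ * x"] cong: if_cong)
  have W_ind: "lin_indep (\<lambda>i. fps_X ^ i :: 'a fps) {..<B}"
    unfolding lin_indep_def
  proof (intro allI impI ballI)
    fix d i assume "(\<Sum>i<B. fps_const (d i) * fps_X ^ i :: 'a fps) = 0" "i \<in> {..<B}"
    then show "d i = 0" using coef[of d i] by simp
  qed
  have W_card: "card W = CARD('a) ^ B" "finite W"
    unfolding W_def using card_lin_span[OF _ W_ind] by auto
  have W_L: "W \<subseteq> L (B + m + c)"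
  proof
    fix g assume "g \<in> W"
    then obtain d where d: "g = (\<Sum>i<B. fps_const (d i) * fps_X ^ i)" unfolding W_def lin_span_def by auto
    show "g \<in> L (B + m + c)" unfolding d
      by (intro lin_span_sum lin_span_smult) (rule L_mono[OF _ X_power], simp)
  qed
  define h where "h = (\<lambda>(g, u). g + f * u)"
  have inj: "inj_on h (W \<times> L B)"
  proof (rule inj_onI, clarsimp simp: h_def)
    fix g u g' u' assume g: "g \<in> W" "g' \<in> W" and eq: "g + f * u = g' + f * u'"
    have gd: "g - g' \<in> W" using g unfolding W_def by (rule lin_span_diff)
    have e1: "g - g' = f * (u' - u)" using eq by (simp add: algebra_simps)
    have "u' - u = 0"
    proof (rule ccontr)
      assume n0: "u' - u \<noteq> 0"
      then have "subdegree (f * (u' - u)) \<ge> B" unfolding B_def subdegree_mult[OF assms(2) n0] by simp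
      then have "subdegree (g - g') \<ge> B" by (simp only: e1)
      then have lo: "(g - g') $ n = 0" if "n < B" for n
        by (intro nth_less_subdegree_zero) (use that in linarith)
      obtain d where d: "g - g' = (\<Sum>i<B. fps_const (d i) * fps_X ^ i)"
        using gd unfolding W_def lin_span_def by auto
      have gn: "(g - g') $ n = (if n < B then d n else 0)" for n unfolding d by (rule coef)
      have "(g - g') $ n = 0 $ n" for n
      proof (cases "n < B")
        case True then show ?thesis using lo[OF True] by (simp only: fps_zero_nth)
      next
        case False then show ?thesis unfolding gn by simp
      qed
      then have "g - g' = 0" by (rule fps_ext)
      then have "f * (u' - u) = 0" using e1 by metis
      then show False using n0 assms(2) by simp
    qed
    then have "u = u'" by simp
    with eq show "g = g' \<and> u = u'" by simp
  qed
  have "h ` (W \<times> L B) \<subseteq> L (B + m + c)"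
  proof clarsimp
    fix g u assume "g \<in> W" "u \<in> L B"
    then show "h (g, u) \<in> L (B + m + c)" unfolding h_def
      using lin_span_add[of g e "E (B + m + c)" "f * u"] W_L mult[OF assms(1), of u B, unfolded add.commute[of m]] by auto
  qed
  then have "card (W \<times> L B) \<le> card (L (B + m + c))"
    using inj card_inj_on_le finite_L by blast
  then have "CARD('a) ^ (B + D * B) \<le> CARD('a) ^ (D * (B + m + c))"
    by (simp add: card_cartesian_product W_card card_L power_add)
  then have "B + D * B \<le> D * (B + m + c)" using card_field_gt_1 power_le_imp_le_exp by blast
  then show ?thesis unfolding B_def by (simp add: algebra_simps)
qed

lemma ev_0: "P \<in> Pts \<Longrightarrow> ev P 0 = 0"
  using ev_const[of P 0] by simp

lemma ev_sum:
  "P \<in> Pts \<Longrightarrow> (\<And>i. i \<in> I \<Longrightarrow> f i \<in> L k) \<Longrightarrow> ev P (sum f I) = (\<Sum>i\<in>I. ev P (f i))"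
proof (induction I rule: infinite_finite_induct)
  case (insert i I)
  then show ?case using ev_add[OF insert.prems(1), of "f i" k "sum f I" k] lin_span_sum[of I f e "E k"] by auto
qed (auto simp: ev_0)

lemma ev_power: "P \<in> Pts \<Longrightarrow> f \<in> L k \<Longrightarrow> ev P (f ^ n) = ev P f ^ n"
proof (induction n)
  case 0 then show ?case using ev_const[of P 1] by simp
next
  case (Suc n)
  show ?case
  proof (cases n)
    case 0 then show ?thesis by simp
  next
    case (Suc n')
    then show ?thesis using ev_mult[OF Suc.prems(1) Suc.prems(2) L_power[OF Suc.prems(2), of n']] Suc.IH Suc.prems
      by simp
  qed
qed

text \<open>The multiples of \<open>h\<close> and the functions interpolating arbitrary values on \<open>Pts\<close> are independent, so
  comparing cardinalities bounds the number of zeros of \<open>h\<close>.\<close>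

lemma zeros_L:
  assumes h: "h \<in> L k" "h \<noteq> 0" and z: "\<And>P. P \<in> Pts \<Longrightarrow> ev P h = 0"
  shows "card Pts \<le> D * (k + c)"
proof -
  have "\<forall>P\<in>Pts. \<exists>f k. f \<in> L k \<and> ev P f = 1 \<and> (\<forall>P'\<in>Pts. P' \<noteq> P \<longrightarrow> ev P' f = 0)"
    using separating by blast
  then obtain f \<kappa> where f: "\<And>P. P \<in> Pts \<Longrightarrow> f P \<in> L (\<kappa> P)" "\<And>P. P \<in> Pts \<Longrightarrow> ev P (f P) = 1"
    "\<And>P P'. P \<in> Pts \<Longrightarrow> P' \<in> Pts \<Longrightarrow> P' \<noteq> P \<Longrightarrow> ev P' (f P) = 0" by metis
  define \<rho> where "\<rho> = Suc (\<Sum>P\<in>Pts. \<kappa> P)"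
  have f\<rho>: "f P \<in> L \<rho>" if "P \<in> Pts" for P
    by (rule L_mono[OF _ f(1)[OF that]]) (use member_le_sum[of P Pts \<kappa>] that finite_Pts in \<open>auto simp: \<rho>_def\<close>)
  define I where "I = (\<lambda>a. \<Sum>P\<in>Pts. fps_const (a P) * f P)"
  have IL: "I a \<in> L \<rho>" for a unfolding I_def by (intro lin_span_sum lin_span_smult f\<rho>)
  have evI: "ev P (I a) = a P" if P: "P \<in> Pts" for P a
  proof -
    have "ev P (I a) = (\<Sum>P'\<in>Pts. ev P (fps_const (a P') * f P'))"
      unfolding I_def by (rule ev_sum[OF P, of _ _ \<rho>]) (intro lin_span_smult f\<rho>)
    also have "\<dots> = (\<Sum>P'\<in>Pts. if P' = P then a P else 0)"
      by (rule sum.cong) (use P in \<open>auto simp: ev_mult[OF P const_in_L f\<rho>] ev_const f\<close>)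
    finally show ?thesis using P finite_Pts by simp
  qed
  define G where "G = (\<lambda>(a, u). I a + h * u)"
  have GL: "G (a, u) \<in> L (\<rho> + k + c)" if "u \<in> L \<rho>" for a u
    unfolding G_def using lin_span_add[OF L_mono[OF _ IL, of "\<rho> + k + c" a] mult[OF h(1) that, unfolded add.commute[of k]]] by simp
  have inj: "inj_on G ((Pts \<rightarrow>\<^sub>E UNIV) \<times> L \<rho>)"
  proof (rule inj_onI, clarify)
    fix a u a' u' assume a: "a \<in> Pts \<rightarrow>\<^sub>E UNIV" "a' \<in> Pts \<rightarrow>\<^sub>E UNIV" and u: "u \<in> L \<rho>" "u' \<in> L \<rho>"
      and eq: "G (a, u) = G (a', u')"
    have evG: "ev P (G (a, u)) = a P" if "P \<in> Pts" "u \<in> L \<rho>" for P a u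
      unfolding G_def using that by (simp add: ev_add[OF that(1) IL mult[OF h(1) that(2)]] evI ev_mult[OF that(1) h(1) that(2)] z)
    have "a = a'" using eq evG u by (intro PiE_ext[OF a]) metis
    moreover from this have "h * u = h * u'" using eq unfolding G_def by simp
    then have "u = u'" using h(2) by simp
    ultimately show "a = a' \<and> u = u'" by simp
  qed
  have "card ((Pts \<rightarrow>\<^sub>E (UNIV::'a set)) \<times> L \<rho>) \<le> card (L (\<rho> + k + c))"
    by (rule card_inj_on_le[OF inj]) (use GL finite_L in auto)
  then have "CARD('a) ^ (card Pts + D * \<rho>) \<le> CARD('a) ^ (D * (\<rho> + k + c))"
    by (simp add: card_cartesian_product card_L power_add card_PiE finite_Pts)
  then have "card Pts + D * \<rho> \<le> D * (\<rho> + k + c)" using card_field_gt_1 power_le_imp_le_exp by blast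
  then show ?thesis by (simp add: algebra_simps)
qed

text \<open>The main step of Bombieri's argument: pigeonhole gives a relation \<open>\<Sum>x. t x\<^sup>r * e x = 0\<close>. As \<open>v \<mapsto> v\<^sup>r\<close> is an involution of the field,
  it shows that \<open>\<Sum>x. t x * e x\<^sup>r\<close> vanishes at all points, whereas it is nonzero because the coefficients
  \<open>t x\<close> have degree below \<open>r\<close>.\<close>

lemma exists_vanishing:
  assumes r: "r = CHAR('a) ^ \<mu>" "CARD('a) = r ^ 2"
    and m: "D * (m + c) < r" and l: "D * m * l > r * (m + c) + l + c" and D: "D > 0"
  shows "\<exists>h\<in>L (m + r * (l + c) + c). h \<noteq> 0 \<and> (\<forall>P\<in>Pts. ev P h = 0)"
proof -
  have r0: "r > 0" using r by simp
  have pc: "prime CHAR('a fps)" by simp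
  define T where "T = (E l \<rightarrow>\<^sub>E L m)"
  define \<delta> where "\<delta> s = (\<Sum>x\<in>E l. s x ^ r * e x)" for s
  have base: "e x \<in> L l" if "x \<in> E l" for x using that finE by (rule lin_span_base[rotated])
  have \<delta>L: "\<delta> s \<in> L (r * (m + c) + l + c)" if "\<And>x. x \<in> E l \<Longrightarrow> s x \<in> L m" for s
    unfolding \<delta>_def by (intro lin_span_sum mult L_power' that r0 base)
  have "\<not> inj_on \<delta> T"
  proof
    assume "inj_on \<delta> T"
    then have "card T \<le> card (L (r * (m + c) + l + c))"
      by (rule card_inj_on_le) (use \<delta>L finite_L in \<open>auto simp: T_def\<close>)
    then have "CARD('a) ^ (D * m * (D * l)) \<le> CARD('a) ^ (D * (r * (m + c) + l + c))"
      unfolding T_def by (simp add: card_PiE finE card_L cardE power_mult)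
    then have "D * m * (D * l) \<le> D * (r * (m + c) + l + c)"
      using card_field_gt_1 power_le_imp_le_exp by blast
    then have "D * (D * m * l) \<le> D * (r * (m + c) + l + c)" by (simp add: mult_ac)
    then show False using l D by auto
  qed
  then obtain s s' where s: "s \<in> T" "s' \<in> T" "s \<noteq> s'" "\<delta> s = \<delta> s'" unfolding inj_on_def by auto
  define t where "t x = s x - s' x" for x
  have tL: "t x \<in> L m" if "x \<in> E l" for x
    unfolding t_def using s that by (auto simp: T_def intro!: lin_span_diff)
  obtain x0 where x0: "x0 \<in> E l" "t x0 \<noteq> 0"
    using s PiE_ext[of s "E l" "\<lambda>_. L m" s'] unfolding t_def T_def by auto
  have frob: "(t x) ^ r = s x ^ r - s' x ^ r" for x
  proof -
    have "(s' x + t x) ^ r = s' x ^ r + t x ^ r" by (rule freshmans_dream'[OF pc]) (use r in simp)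
    then show ?thesis unfolding t_def by (simp add: algebra_simps)
  qed
  have \<delta>t: "(\<Sum>x\<in>E l. t x ^ r * e x) = 0"
    using s(4) unfolding frob \<delta>_def by (simp add: algebra_simps sum_subtractf)
  define h where "h = (\<Sum>x\<in>E l. t x * e x ^ r)"
  have terms: "t x * e x ^ r \<in> L (m + r * (l + c) + c)" if "x \<in> E l" for x
    using mult tL L_power' base that r0 by blast
  have hL: "h \<in> L (m + r * (l + c) + c)" unfolding h_def by (intro lin_span_sum terms)
  moreover have "h \<noteq> 0"
  proof
    assume "h = 0"
    have "t x0 = 0"
    proof (rule frobenius_twist_injective[OF r(1), of "L m" "E l" e t])
      show "0 \<in> L m" by (rule lin_span_0)
      show "f - fps_const a * g \<in> L m" if "f \<in> L m" "g \<in> L m" for f g a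
        using that by (intro lin_span_diff lin_span_smult)
      show "subdegree f < r" if "f \<in> L m" "f \<noteq> 0" for f
        using subdegree_L[OF that] m by simp
    qed (use finE indep tL x0 \<open>h = 0\<close> in \<open>auto simp: h_def\<close>)
    then show False using x0 by simp
  qed
  moreover have "ev P h = 0" if P: "P \<in> Pts" for P
  proof -
    have evp: "ev P h = (\<Sum>x\<in>E l. ev P (t x) * ev P (e x) ^ r)"
      unfolding h_def
      by (subst ev_sum[OF P terms]) (auto intro!: sum.cong simp: ev_mult[OF P tL L_power'[OF base r0]] ev_power[OF P base])
    have "ev P h ^ r = (\<Sum>x\<in>E l. (ev P (t x) * ev P (e x) ^ r) ^ r)"
      unfolding evp by (rule freshmans_dream_sum') (use r in auto)
    also have "\<dots> = (\<Sum>x\<in>E l. ev P (t x) ^ r * ev P (e x))"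
    proof (rule sum.cong)
      fix x
      have "(ev P (e x) ^ r) ^ r = ev P (e x)"
        using finite_field_power_card_eq_same[of "ev P (e x)"] r(2) by (simp add: power2_eq_square power_mult)
      then show "(ev P (t x) * ev P (e x) ^ r) ^ r = ev P (t x) ^ r * ev P (e x)"
        by (simp add: power_mult_distrib)
    qed simp
    also have "\<dots> = ev P (\<Sum>x\<in>E l. t x ^ r * e x)"
    proof -
      have tm: "t x ^ r * e x \<in> L (r * (m + c) + l + c)" if "x \<in> E l" for x
        by (intro mult L_power' that r0 base tL)
      show ?thesis
        by (subst ev_sum[OF P tm]) (auto intro!: sum.cong simp: ev_mult[OF P L_power'[OF tL r0] base] ev_power[OF P tL])
    qed
    also have "\<dots> = 0" unfolding \<delta>t by (rule ev_0[OF P])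
    finally show ?thesis using r0 by simp
  qed
  ultimately show ?thesis by blast
qed

text \<open>The degree \<open>m\<close> is taken maximal with \<open>D * (m + c) < r\<close>, and
  \<open>l\<close> just large enough for the pigeonhole step. Then \<open>D * l\<close> is
  \<open>r\<close> up to a constant, and the bound from \<open>zeros_L\<close> is
  \<open>r ^ 2\<close> up to a multiple of \<open>r\<close>.\<close>

theorem card_points_le:
  assumes r: "r = CHAR('a) ^ \<mu>" "CARD('a) = r ^ 2" and D: "D > 0"
    and A: "A = D * (c + 1) + 1" and big: "r \<ge> 2 * A + 1"
  shows "card Pts \<le> r ^ 2 + 5 * A * r"
proof -
  define t where "t = (r - 1) div D"
  have t: "D * t \<le> r - 1" "r - 1 < D * t + D"
    using mult_div_mod_eq[of D "r - 1"] mod_less_divisor[OF D, of "r - 1"] unfolding t_def by linarith+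
  have tc: "t > c"
  proof (rule ccontr)
    assume "\<not> t > c"
    then have "D * t \<le> D * c" by simp
    then show False using t(2) big unfolding A distrib_left by linarith
  qed
  define m where "m = t - c"
  have mt: "m + c = t" using tc unfolding m_def by simp
  \<comment> \<open>\<open>D * m\<close> is only known to exceed \<open>r - A\<close>. The summand
    \<open>2 * A\<close> compensates for this: \<open>(r - A) * (r + 2 * A)\<close> equals
    \<open>r * r + A * (r - 2 * A)\<close>.\<close>
  define l where "l = (r + 2 * A) div D + 1"
  have l: "D * l \<ge> r + 2 * A" "D * l \<le> r + 2 * A + D"
    using mult_div_mod_eq[of D "r + 2 * A"] mod_less_divisor[OF D, of "r + 2 * A"]
    unfolding l_def distrib_left by linarith+
  have Dm: "D * m + A \<ge> r + 1"
    using t(2) unfolding A mt[symmetric] by (simp add: algebra_simps)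
  have m: "D * (m + c) < r" using t(1) big unfolding mt by linarith
  have l': "D * m * l > r * (m + c) + l + c"
  proof -
    define \<alpha> where "\<alpha> = int A" define R where "R = int r" define d where "d = int D"
    define M where "M = int m" define \<Lambda> where "\<Lambda> = int l" define C where "C = int c"
    have i1: "d > 0" "C \<ge> 0" "\<alpha> > 0" "\<Lambda> \<ge> 0" "R > 0"
    proof -
      have "A > 0" "r > 0" using A big by linarith+
      then show "d > 0" "C \<ge> 0" "\<alpha> > 0" "\<Lambda> \<ge> 0" "R > 0"
        unfolding \<alpha>_def R_def d_def \<Lambda>_def C_def using D by simp_all
    qed
    have "int (r + 2 * A) \<le> int (D * l)" using l(1) by (rule of_nat_mono)
    then have i2: "d * \<Lambda> \<ge> R + 2 * \<alpha>" unfolding \<alpha>_def R_def d_def \<Lambda>_def by simp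
    have "int (r + 1) \<le> int (D * m + A)" using Dm by (rule of_nat_mono)
    then have i3: "d * M \<ge> R - \<alpha> + 1" unfolding \<alpha>_def R_def d_def M_def by simp
    have "int (D * (m + c) + 1) \<le> int r" using m by (intro of_nat_mono) simp
    then have i4: "d * (M + C) \<le> R - 1" unfolding R_def d_def M_def C_def by (simp add: algebra_simps)
    have "int (2 * A + 1) \<le> int r" using big by (rule of_nat_mono)
    then have i5: "R \<ge> 2 * \<alpha> + 1" unfolding R_def \<alpha>_def by simp
    have i6: "\<alpha> = d * (C + 1) + 1" unfolding \<alpha>_def d_def C_def A by (simp add: algebra_simps)
    note i = i1 i2 i3 i4 i5 i6
    have "d * (d * M * \<Lambda> - \<Lambda>) = (d * M - 1) * (d * \<Lambda>)" by (simp add: algebra_simps)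
    moreover have "(R - \<alpha>) * (R + 2 * \<alpha>) \<le> (d * M - 1) * (d * \<Lambda>)"
      by (intro mult_mono) (use i in linarith)+
    ultimately have 1: "d * (d * M * \<Lambda> - \<Lambda>) \<ge> (R - \<alpha>) * (R + 2 * \<alpha>)" by (simp only:)
    have "d * (R * (M + C) + C) = R * (d * (M + C)) + d * C" by (simp add: algebra_simps)
    also have "\<dots> \<le> R * (R - 1) + d * C"
      using mult_left_mono[OF i4, of R] i1(5) by linarith
    also have "\<dots> < R * R + \<alpha> * 1" using i6 i1 unfolding distrib_left right_diff_distrib by linarith
    also have "\<dots> \<le> R * R + \<alpha> * (R - 2 * \<alpha>)"
      by (intro add_left_mono mult_left_mono) (use i in linarith)+
    also have "\<dots> = (R - \<alpha>) * (R + 2 * \<alpha>)" by (simp add: algebra_simps)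
    finally have "d * (R * (M + C) + C) < d * (d * M * \<Lambda> - \<Lambda>)" using 1 by linarith
    then have "R * (M + C) + C < d * M * \<Lambda> - \<Lambda>"
      using mult_less_cancel_left_pos[OF i1(1)] by blast
    then have "int (r * (m + c) + l + c) < int (D * m * l)"
      unfolding R_def M_def C_def d_def \<Lambda>_def by simp
    then show ?thesis by linarith
  qed
  obtain h where h: "h \<in> L (m + r * (l + c) + c)" "h \<noteq> 0" "\<forall>P\<in>Pts. ev P h = 0"
    using exists_vanishing[OF r m l' D] by blast
  have "card Pts \<le> D * (m + r * (l + c) + c + c)" by (rule zeros_L[OF h(1,2)]) (use h(3) in blast)
  also have "\<dots> = D * (m + c) + r * (D * l) + r * (D * c) + D * c" by (simp add: algebra_simps)
  also have "\<dots> \<le> r + r * (r + 2 * A + D) + r * (D * c) + D * c"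
    by (intro add_mono mult_left_mono order_refl) (use m l(2) in simp_all)
  also have "\<dots> = r ^ 2 + r * (2 * A + D * c + D + 1) + D * c" by (simp add: algebra_simps power2_eq_square)
  also have "\<dots> \<le> r ^ 2 + r * (3 * A) + r * A"
  proof -
    have "D * c \<le> 1 * A" by (simp add: A)
    also have "\<dots> \<le> r * A" by (rule mult_right_mono) (use big in linarith)+
    finally have "D * c \<le> r * A" .
    moreover have "r * (2 * A + D * c + D + 1) \<le> r * (3 * A)"
      by (rule mult_left_mono) (simp_all add: A)
    ultimately show ?thesis by linarith
  qed
  finally show ?thesis by (simp add: algebra_simps)
qed

end

section \<open>Power series solutions of Kummer and Artin--Schreier equations\<close>

text \<open>Coefficient \<open>n > 0\<close> of \<open>w ^ 2 = g\<close> contains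
  \<open>w $ n\<close> only in the term \<open>2 * a * w $ n\<close>, so the recursion solves for
  it.\<close>

fun fps_sqrt_coeff :: "'a::field fps \<Rightarrow> 'a \<Rightarrow> nat \<Rightarrow> 'a" where
  "fps_sqrt_coeff g a n =
     (if n = 0 then a
      else (g $ n - (\<Sum>i\<in>{1..<n}. fps_sqrt_coeff g a i * fps_sqrt_coeff g a (n - i))) / (2 * a))"

declare fps_sqrt_coeff.simps [simp del]

lemma fps_sqrt_exists:
  fixes g :: "'a::field fps"
  assumes "(2::'a) \<noteq> 0" "a \<noteq> 0" "g $ 0 = a ^ 2"
  shows "\<exists>w. w ^ 2 = g \<and> w $ 0 = a"
proof (intro exI conjI)
  let ?w = "Abs_fps (fps_sqrt_coeff g a)"
  show w0: "?w $ 0 = a" by (simp add: fps_sqrt_coeff.simps)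
  show "?w ^ 2 = g"
  proof (rule fps_ext)
    fix n show "(?w ^ 2) $ n = g $ n"
    proof (cases "n = 0")
      case True then show ?thesis using w0 assms by (simp add: power2_eq_square)
    next
      case False
      let ?S = "\<Sum>i\<in>{1..<n}. fps_sqrt_coeff g a i * fps_sqrt_coeff g a (n - i)"
      have split: "{0..n} = insert 0 (insert n {1..<n})" using False by auto
      have wn: "fps_sqrt_coeff g a n = (g $ n - ?S) / (2 * a)"
        using False by (subst fps_sqrt_coeff.simps) simp
      have wz: "fps_sqrt_coeff g a 0 = a" by (simp add: fps_sqrt_coeff.simps)
      have "(?w ^ 2) $ n = (\<Sum>i\<in>{0..n}. fps_sqrt_coeff g a i * fps_sqrt_coeff g a (n - i))"
        by (simp add: power2_eq_square fps_mult_nth)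
      also have "\<dots> = a * fps_sqrt_coeff g a n + (fps_sqrt_coeff g a n * a + ?S)"
        unfolding split using False by (subst sum.insert, simp, simp, subst sum.insert) (simp_all add: wz)
      also have "\<dots> = 2 * a * ((g $ n - ?S) / (2 * a)) + ?S" unfolding wn by (simp add: algebra_simps)
      also have "\<dots> = g $ n" using assms by simp
      finally show ?thesis .
    qed
  qed
qed

text \<open>The tail of \<open>f\<close> beyond index \<open>n\<close>, raised to the power
  \<open>p\<close>, has order above \<open>n\<close>; the rest is a finite sum, to which additivity
  of Frobenius applies.\<close>

lemma fps_frobenius_nth:
  fixes f :: "'a::finite_field fps"
  assumes p: "p = CHAR('a)"
  shows "(f ^ p) $ n = (if p dvd n then (f $ (n div p)) ^ p else 0)"
proof -
  have p0: "p > 0" using p by simp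
  have pc: "prime CHAR('a fps)" by simp
  define h where "h = fps_shift (Suc n) f"
  have "f = fps_cutoff (Suc n) f + h * fps_X ^ Suc n" unfolding h_def
    by (metis fps_shift_cutoff add.commute)
  also have "fps_cutoff (Suc n) f = (\<Sum>i\<le>n. fps_const (f $ i) * fps_X ^ i)"
    by (rule fps_ext) (simp add: fps_sum_nth fps_X_power_nth if_distrib[of "\<lambda>x. _ * x"] less_Suc_eq_le cong: if_cong)
  finally have "f ^ p = ((\<Sum>i\<le>n. fps_const (f $ i) * fps_X ^ i) + h * fps_X ^ Suc n) ^ p" by (rule arg_cong)
  also have "\<dots> = (\<Sum>i\<le>n. (fps_const (f $ i) * fps_X ^ i) ^ p) + (h * fps_X ^ Suc n) ^ p"
    using freshmans_dream[OF pc, of p] freshmans_dream_sum[OF pc, of p] p by simp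
  also have "\<dots> = (\<Sum>i\<le>n. fps_const ((f $ i) ^ p) * fps_X ^ (i * p)) + h ^ p * fps_X ^ (Suc n * p)"
    by (simp only: power_mult_distrib fps_const_power power_mult[symmetric])
  also have "\<dots> $ n = (\<Sum>i\<le>n. if n = i * p then (f $ i) ^ p else 0)"
  proof -
    have "n < Suc n * p" using p0 by (cases p) auto
    then have "(h ^ p * fps_X ^ (Suc n * p)) $ n = 0" by (simp only: fps_X_power_mult_right_nth if_True)
    then show ?thesis
      by (simp add: fps_sum_nth fps_X_power_nth if_distrib[of "\<lambda>x. _ * x"] cong: if_cong)
  qed
  also have "\<dots> = (if p dvd n then (f $ (n div p)) ^ p else 0)"
  proof (cases "p dvd n")
    case True
    then obtain k where k: "n = k * p" by (metis dvd_def mult.commute)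
    have "(\<Sum>i\<le>n. if n = i * p then (f $ i) ^ p else 0) = (\<Sum>i\<le>n. if i = k then (f $ k) ^ p else 0)"
      by (rule sum.cong) (use k p0 in auto)
    also have "\<dots> = (f $ k) ^ p" using k p0 by simp
    finally show ?thesis using k p0 True by simp
  next
    case False
    then have "\<And>i. n \<noteq> i * p" by auto
    then show ?thesis using False by simp
  qed
  finally show ?thesis .
qed

text \<open>Coefficient \<open>n\<close> of \<open>y ^ p = y + F\<close> expresses
  \<open>y $ n\<close> by \<open>F $ n\<close> and the coefficient of \<open>y ^ p\<close>, which is
  known from index \<open>n div p\<close>. The test \<open>p > 1\<close> ensures
  termination.\<close>

fun artin_schreier_coeff :: "nat \<Rightarrow> 'a::field fps \<Rightarrow> 'a \<Rightarrow> nat \<Rightarrow> 'a" where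
  "artin_schreier_coeff p F a n =
     (if n = 0 then a
      else (if p dvd n \<and> p > 1 then artin_schreier_coeff p F a (n div p) ^ p else 0) - F $ n)"

declare artin_schreier_coeff.simps [simp del]

lemma fps_artin_schreier_exists:
  fixes F :: "'a::finite_field fps"
  assumes p: "p = CHAR('a)" and a: "a ^ p = a + F $ 0"
  shows "\<exists>y. y ^ p = y + F \<and> y $ 0 = a"
proof (intro exI conjI)
  let ?y = "Abs_fps (artin_schreier_coeff p F a)"
  have p1: "p > 1" using p prime_gt_1_nat[OF CHAR_prime[where 'a='a]] by simp
  show y0: "?y $ 0 = a" by (simp add: artin_schreier_coeff.simps)
  show "?y ^ p = ?y + F"
  proof (rule fps_ext)
    fix n show "(?y ^ p) $ n = (?y + F) $ n"
    proof (cases "n = 0")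
      case True then show ?thesis using y0 a by (simp add: fps_nth_power_0)
    next
      case False
      have "artin_schreier_coeff p F a n =
        (if p dvd n then artin_schreier_coeff p F a (n div p) ^ p else 0) - F $ n"
        using False p1 by (subst artin_schreier_coeff.simps) simp
      then show ?thesis unfolding fps_frobenius_nth[OF p] by simp
    qed
  qed
qed

section \<open>Products of quadratic polynomials are not squares\<close>

text \<open>This says that \<open>h\<close> is not a square in the field of rational functions, with
  denominators cleared.\<close>

definition nonsquare_poly :: "'a::field poly \<Rightarrow> bool" where
  "nonsquare_poly h \<longleftrightarrow> (\<forall>A B. A ^ 2 = B ^ 2 * h \<longrightarrow> B = 0)"

text \<open>The polynomial \<open>x ^ 2 + d\<close> need not be irreducible, but it is squarefree,
  and this suffices. If \<open>r = \<alpha> + \<beta> * x\<close> is the remainder of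
  \<open>A\<close>, then \<open>r ^ 2\<close> reduces to \<open>\<rho>\<close>, and
  \<open>\<rho> = 0\<close> forces both coefficients to vanish.\<close>

lemma quadratic_dvd_square:
  fixes A :: "'a::field poly"
  assumes "(2::'a) \<noteq> 0" "d \<noteq> 0" "[:d, 0, 1:] dvd A ^ 2"
  shows "[:d, 0, 1:] dvd A"
proof -
  let ?\<pi> = "[:d, 0, 1:] :: 'a poly"
  define q where "q = A div ?\<pi>"
  define r where "r = A mod ?\<pi>"
  have A: "A = q * ?\<pi> + r" unfolding q_def r_def by (rule div_mult_mod_eq[symmetric])
  have "r = 0 \<or> degree r < 2" unfolding r_def using degree_mod_less[of ?\<pi> A] by auto
  then have "degree r \<le> 1" by auto
  then have "coeff r n = coeff [:coeff r 0, coeff r 1:] n" for n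
    by (auto simp: coeff_pCons coeff_eq_0 split: nat.splits)
  then obtain \<alpha> \<beta> where r: "r = [:\<alpha>, \<beta>:]" using poly_eqI by blast
  define \<rho> where "\<rho> = [:\<alpha>^2 - d * \<beta>^2, 2 * \<alpha> * \<beta>:]"
  have r2: "r ^ 2 = [:\<beta>^2:] * ?\<pi> + \<rho>"
    unfolding \<rho>_def r by (simp add: power2_eq_square algebra_simps)
  have sq: "(x * y + z) ^ 2 = (x ^ 2 * y + 2 * x * z) * y + z ^ 2" for x y z :: "'a poly"
    by (simp add: power2_eq_square algebra_simps)
  have "A ^ 2 = (q ^ 2 * ?\<pi> + 2 * q * r + [:\<beta>^2:]) * ?\<pi> + \<rho>"
    by (subst A, subst sq, subst r2) (simp only: distrib_right add.assoc)
  then have "?\<pi> dvd \<rho>" using assms(3) by (metis dvd_add_right_iff dvd_triv_right)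
  moreover have "degree \<rho> < degree ?\<pi>" unfolding \<rho>_def by simp
  ultimately have "\<rho> = 0" using dvd_imp_degree_le by (metis not_less)
  then have 1: "\<alpha>^2 = d * \<beta>^2" "\<alpha> * \<beta> = 0" unfolding \<rho>_def using assms(1) by auto
  have "\<beta> = 0" using 1 assms(2) by (metis mult_eq_0_iff power2_eq_square)
  then have "\<alpha> = 0" using 1 by simp
  then have "r = 0" using r \<open>\<beta> = 0\<close> by simp
  then show ?thesis using A by (metis add.right_neutral dvd_triv_right)
qed

text \<open>Modulo \<open>x ^ 2 + d0\<close> every factor reduces to the constant
  \<open>d i - d0\<close>, so the product is invertible there.\<close>

lemma prod_quadratics_mod:
  fixes d :: "'i \<Rightarrow> 'a::field"
  assumes "finite S" "\<And>i. i \<in> S \<Longrightarrow> d i \<noteq> d0"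
  shows "\<exists>q k. k \<noteq> 0 \<and> (\<Prod>i\<in>S. [:d i, 0, 1:]) = [:d0, 0, 1:] * q + [:k:]"
  using assms
proof (induction S)
  case empty then show ?case by (intro exI[of _ 0] exI[of _ 1]) (simp add: one_pCons)
next
  case (insert j S)
  then obtain q k where qk: "k \<noteq> 0" "(\<Prod>i\<in>S. [:d i, 0, 1:]) = [:d0, 0, 1:] * q + [:k:]" by auto
  have dj: "[:d j, 0, 1:] = [:d0, 0, 1:] + [:d j - d0:]" by simp
  have "(\<Prod>i\<in>insert j S. [:d i, 0, 1:]) = ([:d0, 0, 1:] + [:d j - d0:]) * ([:d0, 0, 1:] * q + [:k:])"
    by (simp only: prod.insert[OF insert.hyps(1,2)] qk(2) dj[symmetric])
  also have "\<dots> = [:d0, 0, 1:] * (([:d0, 0, 1:] + [:d j - d0:]) * q + [:k:]) + [:(d j - d0) * k:]"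
    by (simp only: distrib_left distrib_right) (simp add: algebra_simps)
  finally show ?case using qk(1) insert.prems by (intro exI[of _ "([:d0, 0, 1:] + [:d j - d0:]) * q + [:k:]"] exI[of _ "(d j - d0) * k"]) auto
qed

text \<open>Infinite descent: a quadratic factor divides \<open>A\<close>, and then also
  \<open>B\<close>, because the other factors are invertible modulo it. Dividing both by it lowers
  the degree of \<open>B\<close>.\<close>

lemma nonsquare_prod_quadratics:
  fixes d :: "'i \<Rightarrow> 'a::field"
  assumes two: "(2::'a) \<noteq> 0" and S: "finite S" "S \<noteq> {}" and d: "\<And>i. i \<in> S \<Longrightarrow> d i \<noteq> 0" "inj_on d S" and c: "c \<noteq> 0"
  shows "nonsquare_poly (smult c (\<Prod>i\<in>S. [:d i, 0, 1:]))"
  unfolding nonsquare_poly_def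
proof (intro allI impI)
  fix A B :: "'a poly"
  assume "A ^ 2 = B ^ 2 * smult c (\<Prod>i\<in>S. [:d i, 0, 1:])"
  then show "B = 0"
  proof (induction "degree B" arbitrary: A B rule: less_induct)
    case less
    show ?case
    proof (rule ccontr)
      assume B0: "B \<noteq> 0"
      obtain j where j: "j \<in> S" using S by auto
      define \<pi> where "\<pi> = [:d j, 0, 1:]"
      define P where "P = (\<Prod>i\<in>S - {j}. [:d i, 0, 1:])"
      have P: "(\<Prod>i\<in>S. [:d i, 0, 1:]) = \<pi> * P" unfolding P_def \<pi>_def by (rule prod.remove[OF S(1) j])
      have eq: "A ^ 2 = \<pi> * (smult c (B ^ 2 * P))" using less.prems unfolding P by (simp add: mult_ac)
      then have "\<pi> dvd A ^ 2" by (metis dvd_triv_left)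
      then have "\<pi> dvd A" unfolding \<pi>_def by (rule quadratic_dvd_square[OF two d(1)[OF j]])
      then obtain A1 where A1: "A = \<pi> * A1" by (elim dvdE)
      have pi0: "\<pi> \<noteq> 0" unfolding \<pi>_def by simp
      have "\<pi> * (\<pi> * A1 ^ 2) = \<pi> * smult c (B ^ 2 * P)"
        using eq unfolding A1 by (simp only: power2_eq_square mult_ac)
      then have eq2: "\<pi> * A1 ^ 2 = smult c (B ^ 2 * P)" using pi0 mult_left_cancel by blast
      have nd: "d i \<noteq> d j" if "i \<in> S - {j}" for i using that j d(2) by (metis Diff_iff inj_onD insertI1)
      obtain q k where qk: "k \<noteq> 0" "P = \<pi> * q + [:k:]"
        using prod_quadratics_mod[of "S - {j}" d "d j"] nd S(1) unfolding P_def \<pi>_def by (metis finite_Diff)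
      have "smult c (B ^ 2 * P) = \<pi> * smult c (B ^ 2 * q) + smult (c * k) (B ^ 2)"
        unfolding qk(2) by (simp only: distrib_left smult_add_right mult_smult_right mult_ac) (simp add: mult_ac)
      then have "\<pi> dvd smult (c * k) (B ^ 2)" using eq2 by (metis dvd_add_right_iff dvd_triv_left)
      then have "\<pi> dvd B ^ 2" using c qk(1) by (simp add: dvd_smult_iff)
      then have "\<pi> dvd B" unfolding \<pi>_def by (rule quadratic_dvd_square[OF two d(1)[OF j]])
      then obtain B1 where B1: "B = \<pi> * B1" by (elim dvdE)
      have "\<pi> * A1 ^ 2 = \<pi> * (B1 ^ 2 * smult c (\<pi> * P))"
        using eq2 unfolding B1 by (simp only: power2_eq_square mult_smult_right mult_smult_left mult_ac)
      then have "A1 ^ 2 = B1 ^ 2 * smult c (\<pi> * P)" using pi0 mult_left_cancel by blast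
      moreover have B10: "B1 \<noteq> 0" using B0 B1 by auto
      then have "degree B1 < degree B" unfolding B1 using pi0 by (subst degree_mult_eq) (auto simp: \<pi>_def)
      ultimately have "B1 = 0" using less.hyps[of B1 A1] P by simp
      then show False using B10 by simp
    qed
  qed
qed

section \<open>Linear independence in multiquadratic Artin--Schreier extensions\<close>

definition peval :: "'a::field poly \<Rightarrow> 'a fps \<Rightarrow> 'a fps" where
  "peval u z = poly (map_poly fps_const u) z"

lemma peval_0 [simp]: "peval 0 z = 0"
  by (simp add: peval_def)

lemma peval_pCons [simp]: "peval (pCons a u) z = fps_const a + z * peval u z"
  unfolding peval_def by (cases "a = 0 \<and> u = 0") (auto simp: map_poly_pCons)

lemma peval_1 [simp]: "peval 1 z = 1"
  by (simp add: one_pCons)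

lemma peval_add: "peval (u + v) z = peval u z + peval v z"
  by (induction u v rule: poly_induct2) (simp_all add: algebra_simps fps_const_add[symmetric] del: fps_const_add)

lemma peval_smult: "peval (smult a u) z = fps_const a * peval u z"
  by (induction u) (simp_all add: algebra_simps fps_const_mult[symmetric] del: fps_const_mult)

lemma peval_mult: "peval (u * v) z = peval u z * peval v z"
  by (induction u) (simp_all add: algebra_simps peval_add peval_smult)

lemma peval_uminus: "peval (- u) z = - peval u z"
  using peval_smult[of "-1" u z] by (simp add: fps_const_neg[symmetric] del: fps_const_neg)

lemma peval_diff: "peval (u - v) z = peval u z - peval v z"
  using peval_add[of u "- v" z] by (simp add: peval_uminus)

lemma peval_power: "peval (u ^ n) z = peval u z ^ n"
  by (induction n) (simp_all add: peval_mult)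

lemma peval_sum: "peval (sum f A) z = (\<Sum>i\<in>A. peval (f i) z)"
  by (induction A rule: infinite_finite_induct) (simp_all add: peval_add)

lemma peval_prod: "peval (prod f A) z = (\<Prod>i\<in>A. peval (f i) z)"
  by (induction A rule: infinite_finite_induct) (simp_all add: peval_mult)

text \<open>Everything happens inside the ring of power series: as \<open>z\<close> satisfies no
  polynomial equation, the polynomials in \<open>z\<close> form a copy of the polynomial ring, and
  the function field itself is never built.\<close>

locale quadratic_tower =
  fixes s :: nat and d \<nu> :: "nat \<Rightarrow> 'a::finite_field" and z :: "'a fps" and w :: "nat \<Rightarrow> 'a fps"
  assumes two: "(2::'a) \<noteq> 0"
    and d: "\<And>i. i < s \<Longrightarrow> d i \<noteq> 0" "inj_on d {..<s}" and nu: "\<And>i. i < s \<Longrightarrow> \<nu> i \<noteq> 0"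
    and w_square: "\<And>i. i < s \<Longrightarrow> w i ^ 2 = peval (smult (\<nu> i) [:d i, 0, 1:]) z"
    and transcendental: "\<And>u. peval u z = 0 \<Longrightarrow> u = 0"
begin

definition g :: "nat \<Rightarrow> 'a poly" where "g i = smult (\<nu> i) [:d i, 0, 1:]"

abbreviation \<phi> :: "'a poly \<Rightarrow> 'a fps" where "\<phi> u \<equiv> peval u z"

text \<open>The layers are rings without denominators in \<open>z\<close>; divisions are replaced by
  multiplications with conjugates.\<close>

primrec M :: "nat \<Rightarrow> 'a fps set" where
  "M 0 = range \<phi>"
| "M (Suc t) = {A + B * w t |A B. A \<in> M t \<and> B \<in> M t}"

lemma M_SucI: "A \<in> M t \<Longrightarrow> B \<in> M t \<Longrightarrow> A + B * w t \<in> M (Suc t)"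
  by auto

lemma w2: "i < s \<Longrightarrow> w i * w i = \<phi> (g i)"
  using w_square[of i] unfolding g_def by (simp only: power2_eq_square)

lemma M_peval: "\<phi> u \<in> M t"
proof (induction t arbitrary: u)
  case (Suc t) show ?case using M_SucI[OF Suc[of u] Suc[of 0]] by simp
qed simp

lemma M_0: "0 \<in> M t" and M_1: "1 \<in> M t" and M_const: "fps_const a \<in> M t"
  using M_peval[of 0 t] M_peval[of 1 t] M_peval[of "[:a:]" t] by simp_all

lemma M_add: "A \<in> M t \<Longrightarrow> B \<in> M t \<Longrightarrow> A + B \<in> M t"
proof (induction t arbitrary: A B)
  case 0 then show ?case by (auto simp: peval_add[symmetric])
next
  case (Suc t)
  then obtain A0 A1 B0 B1 where A: "A = A0 + A1 * w t" "A0 \<in> M t" "A1 \<in> M t"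
    and B: "B = B0 + B1 * w t" "B0 \<in> M t" "B1 \<in> M t" by auto
  have "A + B = (A0 + B0) + (A1 + B1) * w t" unfolding A B by (simp add: algebra_simps)
  then show ?case using M_SucI Suc.IH A B by metis
qed

lemma M_mult: "t \<le> s \<Longrightarrow> A \<in> M t \<Longrightarrow> B \<in> M t \<Longrightarrow> A * B \<in> M t"
proof (induction t arbitrary: A B)
  case 0 then show ?case by (auto simp: peval_mult[symmetric])
next
  case (Suc t)
  then obtain A0 A1 B0 B1 where A: "A = A0 + A1 * w t" "A0 \<in> M t" "A1 \<in> M t"
    and B: "B = B0 + B1 * w t" "B0 \<in> M t" "B1 \<in> M t" by auto
  have "A * B = (A0 * B0 + A1 * B1 * (w t * w t)) + (A0 * B1 + A1 * B0) * w t"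
    unfolding A B by (simp add: algebra_simps)
  also have "\<dots> = (A0 * B0 + A1 * B1 * \<phi> (g t)) + (A0 * B1 + A1 * B0) * w t"
    using Suc.prems by (simp add: w2)
  finally show ?case using Suc A B by (simp only:) (intro M_SucI M_add Suc.IH M_peval, auto)
qed

lemma M_uminus: "t \<le> s \<Longrightarrow> A \<in> M t \<Longrightarrow> - A \<in> M t"
  using M_mult[of t "fps_const (-1)" A] M_const[of "-1" t] by (simp add: fps_const_neg[symmetric] del: fps_const_neg)

lemma M_diff: "t \<le> s \<Longrightarrow> A \<in> M t \<Longrightarrow> B \<in> M t \<Longrightarrow> A - B \<in> M t"
  using M_add[of A t "- B"] M_uminus[of t B] by simp

lemma M_power: "t \<le> s \<Longrightarrow> A \<in> M t \<Longrightarrow> A ^ n \<in> M t"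
  by (induction n) (auto intro: M_1 M_mult)

lemma M_sum: "(\<And>i. i \<in> I \<Longrightarrow> f i \<in> M t) \<Longrightarrow> sum f I \<in> M t"
  by (induction I rule: infinite_finite_induct) (auto intro: M_0 M_add)

lemma M_Suc: "A \<in> M t \<Longrightarrow> A \<in> M (Suc t)"
  using M_SucI[of A t 0] M_0[of t] by simp

lemma M_w: "i < t \<Longrightarrow> w i \<in> M t"
proof (induction t)
  case (Suc t)
  show ?case
  proof (cases "i = t")
    case True then show ?thesis using M_SucI[of 0 t 1] M_0 M_1 by simp
  next
    case False then show ?thesis using Suc M_Suc by simp
  qed
qed simp

lemma two_fps: "(2::'a fps) \<noteq> 0"
  using two by (metis fps_const_eq_0_iff numeral_fps_const)

lemma nonsquare_g:
  assumes ts: "t < s" and S: "S \<subseteq> {..<t}"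
  shows "nonsquare_poly (g t * (\<Prod>i\<in>S. g i))"
proof -
  have fin: "finite S" "t \<notin> S" using S finite_subset by auto
  have "g t * (\<Prod>i\<in>S. g i) = (\<Prod>i\<in>insert t S. g i)" using fin by simp
  also have "\<dots> = smult (\<Prod>i\<in>insert t S. \<nu> i) (\<Prod>i\<in>insert t S. [:d i, 0, 1:])"
    unfolding g_def by (rule prod_smult)
  finally have e: "g t * (\<Prod>i\<in>S. g i) = \<dots>" .
  show ?thesis unfolding e
  proof (rule nonsquare_prod_quadratics[OF two])
    show "inj_on d (insert t S)" by (rule inj_on_subset[OF d(2)]) (use S ts in auto)
  qed (use S ts d(1) nu fin in auto)
qed

text \<open>A Kummer argument: if \<open>h\<close> becomes a square after adjoining
  \<open>w t\<close>, then \<open>h\<close> or \<open>h * g t\<close> was one before, and the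
  products over \<open>S\<close> record which \<open>g i\<close> have been absorbed. The conjugate
  \<open>Bc\<close> turns \<open>B\<close> into an element \<open>n\<close> of the smaller
  layer.\<close>

lemma no_new_squares:
  assumes "t \<le> s" "\<And>S. S \<subseteq> {..<t} \<Longrightarrow> nonsquare_poly (h * (\<Prod>i\<in>S. g i))"
    "A \<in> M t" "B \<in> M t" "A ^ 2 = B ^ 2 * \<phi> h"
  shows "B = 0"
  using assms
proof (induction t arbitrary: h A B)
  case 0
  then obtain u v where uv: "A = \<phi> u" "B = \<phi> v" by auto
  have "\<phi> (u ^ 2 - v ^ 2 * h) = 0"
    using 0 uv by (simp add: peval_diff peval_power peval_mult)
  then have "u ^ 2 = v ^ 2 * h" using transcendental by (metis eq_iff_diff_eq_0)
  moreover have "nonsquare_poly h" using 0(2)[of "{}"] by simp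
  ultimately have "v = 0" unfolding nonsquare_poly_def by blast
  then show ?case using uv by simp
next
  case (Suc t)
  have ts: "t < s" "t \<le> s" using Suc.prems by auto
  have indep: "U = 0 \<and> V = 0" if "U \<in> M t" "V \<in> M t" "U + V * w t = 0" for U V
  proof -
    have "U = - (V * w t)" using that(3) by (simp add: eq_neg_iff_add_eq_0)
    then have "U ^ 2 = V ^ 2 * (w t * w t)" by (simp only: power2_eq_square minus_mult_minus mult_ac)
    then have UV: "U ^ 2 = V ^ 2 * \<phi> (g t)" using ts by (simp only: w2)
    have "V = 0"
      by (rule Suc.IH[OF ts(2) nonsquare_g[OF ts(1)] that(1,2) UV])
    then show ?thesis using that by simp
  qed
  obtain B0 B1 where B: "B = B0 + B1 * w t" "B0 \<in> M t" "B1 \<in> M t" using Suc.prems by auto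
  define Bc where "Bc = B0 + (- B1) * w t"
  have B1m: "- B1 \<in> M t" using B ts M_uminus by blast
  define n where "n = B0 * B0 - B1 * B1 * \<phi> (g t)"
  have nM: "n \<in> M t" unfolding n_def using B ts by (intro M_diff M_mult M_peval) auto
  have BBc: "B * Bc = n"
  proof -
    have "B * Bc = B0 * B0 - B1 * B1 * (w t * w t)" unfolding B Bc_def by (simp add: algebra_simps)
    then show ?thesis unfolding n_def using ts by (simp only: w2)
  qed
  have "A * Bc \<in> M (Suc t)" using Suc.prems M_mult M_SucI[OF B(2) B1m] unfolding Bc_def by blast
  then obtain C0 C1 where C: "A * Bc = C0 + C1 * w t" "C0 \<in> M t" "C1 \<in> M t" by auto
  have "(C0 + C1 * w t) ^ 2 = n ^ 2 * \<phi> h"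
    using Suc.prems(5) unfolding C(1)[symmetric] BBc[symmetric] by (simp only: power_mult_distrib mult_ac)
  moreover have "(C0 + C1 * w t) ^ 2 = C0 * C0 + C1 * C1 * (w t * w t) + (2 * C0 * C1) * w t"
    by (simp add: power2_eq_square algebra_simps)
  ultimately have "C0 * C0 + C1 * C1 * \<phi> (g t) + (2 * C0 * C1) * w t = n ^ 2 * \<phi> h"
    using w2[OF ts(1)] by metis
  then have "(C0 * C0 + C1 * C1 * \<phi> (g t) - n ^ 2 * \<phi> h) + (2 * C0 * C1) * w t = 0"
    by (simp add: algebra_simps)
  moreover have "2 * C0 * C1 \<in> M t"
  proof -
    have "fps_const 2 * C0 * C1 \<in> M t" using C ts by (intro M_mult M_const) auto
    then show ?thesis by (simp only: fps_numeral_fps_const[symmetric])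
  qed
  moreover have "C0 * C0 + C1 * C1 * \<phi> (g t) - n ^ 2 * \<phi> h \<in> M t"
    using C nM ts by (intro M_diff M_add M_mult M_power M_peval) auto
  ultimately have *: "C0 * C0 + C1 * C1 * \<phi> (g t) - n ^ 2 * \<phi> h = 0" "2 * C0 * C1 = 0"
    using indep by blast+
  \<comment> \<open>As 2 is invertible, \<open>C0\<close> or \<open>C1\<close> vanishes; the two
    cases lead to \<open>h\<close> and to \<open>h * g t\<close>.\<close>
  have "n = 0"
  proof (cases "C1 = 0")
    case True
    have "C0 ^ 2 = n ^ 2 * \<phi> h" using *(1) True by (simp add: power2_eq_square)
    show ?thesis
    proof (rule Suc.IH[OF ts(2) _ C(2) nM \<open>C0 ^ 2 = n ^ 2 * \<phi> h\<close>])
      fix S assume "S \<subseteq> {..<t}"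
      then have "S \<subseteq> {..<Suc t}" by (auto simp: less_Suc_eq)
      then show "nonsquare_poly (h * (\<Prod>i\<in>S. g i))" by (rule Suc.prems(2))
    qed
  next
    case False
    then have C00: "C0 = 0" using *(2) two_fps by auto
    have "(C1 * \<phi> (g t)) ^ 2 = (C1 * C1 * \<phi> (g t)) * \<phi> (g t)" by (simp add: power2_eq_square mult_ac)
    also have "C1 * C1 * \<phi> (g t) = n ^ 2 * \<phi> h" using *(1) C00 by simp
    also have "n ^ 2 * \<phi> h * \<phi> (g t) = n ^ 2 * \<phi> (h * g t)" by (simp add: peval_mult)
    finally have eq: "(C1 * \<phi> (g t)) ^ 2 = n ^ 2 * \<phi> (h * g t)" .
    show ?thesis
    proof (rule Suc.IH[OF ts(2) _ _ nM eq])
      show "C1 * \<phi> (g t) \<in> M t" using C ts by (intro M_mult M_peval) auto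
      fix S assume S: "S \<subseteq> {..<t}"
      then have fin: "finite S" "t \<notin> S" using finite_subset by auto
      have "h * g t * (\<Prod>i\<in>S. g i) = h * (\<Prod>i\<in>insert t S. g i)" using fin by (simp add: mult.assoc)
      moreover have "insert t S \<subseteq> {..<Suc t}" using S by (auto simp: less_Suc_eq)
      ultimately show "nonsquare_poly (h * g t * (\<Prod>i\<in>S. g i))" using Suc.prems(2)[of "insert t S"] by metis
    qed
  qed
  then have "B = 0 \<or> Bc = 0" using BBc by simp
  then show "B = 0"
  proof
    assume "Bc = 0"
    then have "B0 = 0 \<and> - B1 = 0" unfolding Bc_def by (rule indep[OF B(2) B1m])
    then show ?thesis using B(1) by simp
  qed
qed

lemma M_step_indep:
  assumes ts: "t < s" and U: "U \<in> M t" and V: "V \<in> M t" and eq: "U + V * w t = 0"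
  shows "U = 0 \<and> V = 0"
proof -
  have "U = - (V * w t)" using eq by (simp add: eq_neg_iff_add_eq_0)
  then have "U ^ 2 = V ^ 2 * (w t * w t)" by (simp only: power2_eq_square minus_mult_minus mult_ac)
  then have UV: "U ^ 2 = V ^ 2 * \<phi> (g t)" using ts by (simp only: w2)
  have "V = 0"
    by (rule no_new_squares[OF _ nonsquare_g[OF ts] U V UV]) (use ts in simp)
  then show ?thesis using eq by simp
qed

lemma Pow_lessThan_Suc: "Pow {..<Suc t} = Pow {..<t} \<union> insert t ` Pow {..<t}"
  by (simp add: lessThan_Suc Pow_insert)

lemma sum_Pow_Suc:
  "(\<Sum>S\<in>Pow {..<Suc t}. f S) = (\<Sum>S\<in>Pow {..<t}. f S) + (\<Sum>S\<in>Pow {..<t}. f (insert t S) :: 'b::comm_monoid_add)"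
proof -
  have "inj_on (insert t) (Pow {..<t})"
  proof (rule inj_onI)
    fix S T assume "S \<in> Pow {..<t}" "T \<in> Pow {..<t}" "insert t S = insert t T"
    then show "S = T" by (metis Diff_insert_absorb PowD lessThan_iff less_irrefl subsetD)
  qed
  moreover have "Pow {..<t} \<inter> insert t ` Pow {..<t} = {}" by auto
  ultimately show ?thesis unfolding Pow_lessThan_Suc
    by (subst sum.union_disjoint) (auto simp: sum.reindex)
qed

lemma w_prod_insert: "S \<in> Pow {..<t} \<Longrightarrow> (\<Prod>i\<in>insert t S. w i) = (\<Prod>i\<in>S. w i) * w t"
proof -
  assume "S \<in> Pow {..<t}"
  then have "finite S" "t \<notin> S" using finite_subset by auto
  then show ?thesis by (simp add: mult.commute)
qed

lemma M_expansion:
  "A \<in> M t \<Longrightarrow> \<exists>u. A = (\<Sum>S\<in>Pow {..<t}. \<phi> (u S) * (\<Prod>i\<in>S. w i))"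
proof (induction t arbitrary: A)
  case 0 then show ?case by auto
next
  case (Suc t)
  then obtain A0 A1 where A: "A = A0 + A1 * w t" "A0 \<in> M t" "A1 \<in> M t" by auto
  obtain u v where uv: "A0 = (\<Sum>S\<in>Pow {..<t}. \<phi> (u S) * (\<Prod>i\<in>S. w i))"
    "A1 = (\<Sum>S\<in>Pow {..<t}. \<phi> (v S) * (\<Prod>i\<in>S. w i))"
    using Suc.IH[OF A(2)] Suc.IH[OF A(3)] by blast
  define x where "x S = (if t \<in> S then v (S - {t}) else u S)" for S
  have nt: "t \<notin> S" "insert t S - {t} = S" if "S \<in> Pow {..<t}" for S using that by auto
  have "(\<Sum>S\<in>Pow {..<Suc t}. \<phi> (x S) * (\<Prod>i\<in>S. w i)) = A"
    unfolding sum_Pow_Suc A uv sum_distrib_right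
    by (intro arg_cong2[where f = plus] sum.cong refl)
       (simp_all add: x_def nt w_prod_insert mult.assoc)
  then show ?case by metis
qed

lemma M_combination: "t \<le> s \<Longrightarrow> (\<Sum>S\<in>Pow {..<t}. \<phi> (u S) * (\<Prod>i\<in>S. w i)) \<in> M t"
proof (intro M_sum M_mult M_peval)
  fix S assume ts: "t \<le> s" and "S \<in> Pow {..<t}"
  then have "finite S" "S \<subseteq> {..<t}" using finite_subset by auto
  then show "(\<Prod>i\<in>S. w i) \<in> M t"
    by (induction S) (use ts in \<open>auto intro!: M_1 M_mult M_w\<close>)
qed

text \<open>Each \<open>w t\<close> is independent of the layer below it, so all squarefree products
  of the \<open>w i\<close> are independent over the polynomials in \<open>z\<close>.\<close>

lemma kummer_indep:
  "t \<le> s \<Longrightarrow> (\<Sum>S\<in>Pow {..<t}. \<phi> (u S) * (\<Prod>i\<in>S. w i)) = 0 \<Longrightarrow> S \<subseteq> {..<t} \<Longrightarrow> u S = 0"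
proof (induction t arbitrary: u S)
  case 0 then show ?case using transcendental by auto
next
  case (Suc t)
  let ?A = "\<Sum>S\<in>Pow {..<t}. \<phi> (u S) * (\<Prod>i\<in>S. w i)"
  let ?B = "\<Sum>S\<in>Pow {..<t}. \<phi> (u (insert t S)) * (\<Prod>i\<in>S. w i)"
  have "?B * w t = (\<Sum>S\<in>Pow {..<t}. \<phi> (u (insert t S)) * (\<Prod>i\<in>insert t S. w i))"
    unfolding sum_distrib_right by (rule sum.cong) (simp_all only: w_prod_insert mult.assoc)
  then have "?A + ?B * w t = 0" using Suc.prems(2) unfolding sum_Pow_Suc by simp
  then have AB: "?A = 0" "?B = 0" using M_step_indep[of t ?A ?B] M_combination Suc.prems(1) by auto
  show ?case
  proof (cases "t \<in> S")
    case False
    then have "S \<subseteq> {..<t}" using Suc.prems(3) by (auto simp: less_Suc_eq)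
    then show ?thesis using Suc.IH[of u S] AB Suc.prems by auto
  next
    case True
    then have "S - {t} \<subseteq> {..<t}" "insert t (S - {t}) = S" using Suc.prems(3) by (auto simp: less_Suc_eq)
    then show ?thesis using Suc.IH[of "\<lambda>S. u (insert t S)" "S - {t}"] AB Suc.prems by auto
  qed
qed

text \<open>Multiplying by conjugates layer by layer gives a norm, which is a polynomial in
  \<open>z\<close>. This takes the place of inverses.\<close>

lemma M_conjugate:
  "t \<le> s \<Longrightarrow> A \<in> M t \<Longrightarrow> A \<noteq> 0 \<Longrightarrow> \<exists>C\<in>M t. \<exists>n. C \<noteq> 0 \<and> n \<noteq> 0 \<and> A * C = \<phi> n"
proof (induction t arbitrary: A)
  case 0
  then obtain u where "A = \<phi> u" by auto
  then show ?case using 0 M_1[of 0] by (intro bexI[of _ 1] exI[of _ u]) auto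
next
  case (Suc t)
  then obtain A0 A1 where A: "A = A0 + A1 * w t" "A0 \<in> M t" "A1 \<in> M t" by auto
  have ts: "t < s" "t \<le> s" using Suc.prems by auto
  define Ac where "Ac = A0 + (- A1) * w t"
  have m: "- A1 \<in> M t" using A ts M_uminus by blast
  have AcM: "Ac \<in> M (Suc t)" unfolding Ac_def using M_SucI A m by blast
  have "Ac \<noteq> 0" using M_step_indep[OF ts(1) A(2) m] Suc.prems(3) A(1) unfolding Ac_def by auto
  define n0 where "n0 = A0 * A0 - A1 * A1 * \<phi> (g t)"
  have "A * Ac = A0 * A0 - A1 * A1 * (w t * w t)" unfolding A Ac_def by (simp add: algebra_simps)
  then have AAc: "A * Ac = n0" unfolding n0_def using ts by (simp only: w2)
  then have "n0 \<noteq> 0" using \<open>Ac \<noteq> 0\<close> Suc.prems(3) by auto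
  moreover have "n0 \<in> M t" unfolding n0_def using A ts by (intro M_diff M_mult M_peval) auto
  ultimately obtain C n where C: "C \<in> M t" "C \<noteq> 0" "n \<noteq> 0" "n0 * C = \<phi> n" using Suc.IH ts by blast
  have "A * (Ac * C) = \<phi> n" using AAc C by (simp add: mult.assoc[symmetric])
  moreover have "Ac * C \<in> M (Suc t)" using AcM C M_Suc Suc.prems M_mult by blast
  ultimately show ?case using C \<open>Ac \<noteq> 0\<close> by (metis mult_eq_0_iff)
qed

end

section \<open>The Artin-Schreier layer\<close>

lemma coeff_pcompose_shift:
  fixes P :: "'b::comm_ring_1 poly"
  shows "n \<ge> degree P \<Longrightarrow> coeff (pcompose P [:f, 1:]) n = coeff P n \<and>
    (n \<ge> 1 \<longrightarrow> coeff (pcompose P [:f, 1:]) (n - 1) = coeff P (n - 1) + of_nat n * coeff P n * f)"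
\<comment> \<open>Allowing \<open>n\<close> above the degree makes the induction hypothesis
  available at both \<open>k\<close> and \<open>Suc k\<close>.\<close>
proof (induction P arbitrary: n)
  case 0 then show ?case by simp
next
  case (pCons a P)
  have exp: "coeff (pcompose (pCons a P) [:f, 1:]) k =
      (if k = 0 then a else 0) + f * coeff (pcompose P [:f, 1:]) k
      + (if k = 0 then 0 else coeff (pcompose P [:f, 1:]) (k - 1))" for k
    by (cases k) (simp_all add: pcompose_pCons coeff_pCons)
  show ?case
  proof (cases "P = 0")
    case True then show ?thesis using pCons.prems by (cases n) (auto simp: coeff_pCons split: nat.splits)
  next
    case False
    then obtain k where k: "n = Suc k" "k \<ge> degree P" using pCons.prems by (cases n) auto
    note ih = pCons.IH[OF k(2)] and ih' = pCons.IH[of "Suc k"]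
    have 1: "coeff (pcompose P [:f, 1:]) (Suc k) = 0" using ih' k(2) by (simp add: coeff_eq_0)
    show ?thesis
    proof (cases k)
      case 0 then show ?thesis using exp 1 ih k by (simp add: mult.commute)
    next
      case (Suc l)
      then show ?thesis using exp 1 ih k by (simp add: algebra_simps)
    qed
  qed
qed

lemma coeff_pcompose_in:
  fixes P :: "'b::comm_ring_1 poly"
  assumes "\<And>x y. x \<in> R \<Longrightarrow> y \<in> R \<Longrightarrow> x + y \<in> R" "\<And>x y. x \<in> R \<Longrightarrow> y \<in> R \<Longrightarrow> x * y \<in> R" "0 \<in> R" "f \<in> R"
  shows "(\<And>k. coeff P k \<in> R) \<Longrightarrow> coeff (pcompose P [:f, 1:]) k \<in> R"
proof (induction P arbitrary: k)
  case 0 then show ?case using assms by simp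
next
  case (pCons a P)
  have "coeff P k \<in> R" for k using pCons.prems[of "Suc k"] by simp
  then have ih: "coeff (pcompose P [:f, 1:]) k \<in> R" for k using pCons.IH by blast
  have a: "a \<in> R" using pCons.prems[of 0] by simp
  have "coeff (pcompose (pCons a P) [:f, 1:]) k =
      (if k = 0 then a else 0) + f * coeff (pcompose P [:f, 1:]) k
      + (if k = 0 then 0 else coeff (pcompose P [:f, 1:]) (k - 1))"
    by (cases k) (simp_all add: pcompose_pCons coeff_pCons)
  also have "\<dots> \<in> R" using assms ih a by (intro assms(1)) auto
  finally show ?case .
qed

text \<open>The rational function \<open>v = u / n\<close> would satisfy
  \<open>v = v ^ p + q\<close>. A pole of \<open>v\<close> at infinity gives \<open>v ^ p\<close> a
  pole of order at least \<open>p\<close>, which neither \<open>v\<close> nor the simple pole of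
  \<open>q\<close> can cancel; without a pole of \<open>v\<close>, that of \<open>q\<close> is left
  over.\<close>

lemma poly_equation_linear:
  fixes n u q :: "'a::field poly"
  assumes "p > 1" "n \<noteq> 0" "degree q = 1" "n ^ (p - 1) * u = u ^ p + n ^ p * q"
  shows False
proof -
  have q0: "q \<noteq> 0" using assms(3) by auto
  have dr: "degree (n ^ p * q) = p * degree n + 1"
    using assms q0 by (simp add: degree_mult_eq degree_power_eq)
  have d1: "degree (n ^ (p - 1) * u) \<le> (p - 1) * degree n + degree u"
    using degree_mult_le[of "n ^ (p - 1)" u] degree_power_le[of n "p - 1"] by (simp add: mult.commute)
  show False
  proof (cases "degree u \<le> degree n")
    case True
    have "n ^ p * q = n ^ (p - 1) * u - u ^ p" using assms(4) by simp
    moreover have "degree (n ^ (p - 1) * u - u ^ p) \<le> p * degree n"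
    proof (rule degree_diff_le)
      have "(p - 1) * degree n + degree u \<le> (p - 1) * degree n + degree n" using True by simp
      also have "\<dots> = p * degree n" using assms(1) by (simp add: algebra_simps diff_mult_distrib)
      finally show "degree (n ^ (p - 1) * u) \<le> p * degree n" using d1 by simp
      show "degree (u ^ p) \<le> p * degree n"
        using order_trans[OF degree_power_le[of u p] mult_le_mono1[OF True, of p]] by (simp only: mult.commute)
    qed
    ultimately show False using dr by simp
  next
    case False
    then have lt: "degree n < degree u" by simp
    then have u0: "u \<noteq> 0" by auto
    have "u ^ p = n ^ (p - 1) * u - n ^ p * q" using assms(4) by simp
    moreover have "degree (n ^ (p - 1) * u - n ^ p * q) < p * degree u"
    proof (rule degree_diff_less)
      have "(p - 1) * degree n + degree u < (p - 1) * degree u + degree u" using lt assms(1) by simp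
      also have "\<dots> = p * degree u" using assms(1) by (simp add: algebra_simps diff_mult_distrib)
      finally show "degree (n ^ (p - 1) * u) < p * degree u" using d1 by simp
      have "p * degree n + 1 < p * degree n + p" using assms(1) by simp
      also have "\<dots> = p * Suc (degree n)" by simp
      also have "\<dots> \<le> p * degree u" using lt by (intro mult_le_mono) auto
      finally show "degree (n ^ p * q) < p * degree u" using dr by simp
    qed
    ultimately show False using degree_power_eq[OF u0, of p] by simp
  qed
qed

text \<open>With \<open>v = u / n\<close> the equation reads \<open>v = v ^ p * h + k\<close>. If
  \<open>v\<close> vanishes at infinity, so does \<open>v ^ p * h\<close>, and the constant
  \<open>k\<close> is left over; otherwise \<open>v ^ p * h\<close> has the largest degree of all
  terms.\<close>

lemma poly_equation_const:
  fixes n u h :: "'a::field poly"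
  assumes "p > 1" "n \<noteq> 0" "k \<noteq> 0" "degree h = p - 1" "n ^ (p - 1) * u = u ^ p * h + n ^ p * [:k:]"
  shows False
proof -
  have h0: "h \<noteq> 0" using assms(1,4) by auto
  have dr: "degree (n ^ p * [:k:]) = p * degree n"
    using assms by (simp add: degree_mult_eq degree_power_eq)
  have d1: "degree (n ^ (p - 1) * u) \<le> (p - 1) * degree n + degree u"
    using degree_mult_le[of "n ^ (p - 1)" u] degree_power_le[of n "p - 1"] by (simp add: mult.commute)
  have u0: "u \<noteq> 0"
  proof
    assume "u = 0"
    then have "n ^ p * [:k:] = 0" using assms(1,5) by (simp add: power_0_left)
    then show False using assms(2,3) by simp
  qed
  have du: "degree (u ^ p * h) = p * degree u + (p - 1)"
    using u0 h0 assms(4) by (simp add: degree_mult_eq degree_power_eq)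
  show False
  proof (cases "degree u < degree n")
    case True
    have "n ^ p * [:k:] = n ^ (p - 1) * u - u ^ p * h" using assms(5) by simp
    moreover have "degree (n ^ (p - 1) * u - u ^ p * h) < p * degree n"
    proof (rule degree_diff_less)
      have "(p - 1) * degree n + degree u < (p - 1) * degree n + degree n" using True by simp
      also have "\<dots> = p * degree n" using assms(1) by (simp add: algebra_simps diff_mult_distrib)
      finally show "degree (n ^ (p - 1) * u) < p * degree n" using d1 by simp
      have "p * degree u + (p - 1) < p * Suc (degree u)" using assms(1) by simp
      also have "\<dots> \<le> p * degree n" using True by (intro mult_le_mono) auto
      finally show "degree (u ^ p * h) < p * degree n" using du by simp
    qed
    ultimately show False using dr by simp
  next
    case False
    have "u ^ p * h = n ^ (p - 1) * u - n ^ p * [:k:]" using assms(5) by simp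
    moreover have "degree (n ^ (p - 1) * u - n ^ p * [:k:]) \<le> p * degree u"
    proof (rule degree_diff_le)
      have "(p - 1) * degree n + degree u \<le> (p - 1) * degree u + degree u" using False by simp
      also have "\<dots> = p * degree u" using assms(1) by (simp add: algebra_simps diff_mult_distrib)
      finally show "degree (n ^ (p - 1) * u) \<le> p * degree u" using d1 by simp
      show "degree (n ^ p * [:k:]) \<le> p * degree u" using dr False by simp
    qed
    ultimately show False using du assms(1) by simp
  qed
qed

text \<open>The constant \<open>om\<close> serves to prescribe the value of a trace. By
  \<open>lam\<close> the right-hand side really involves \<open>z\<close> or some
  \<open>w i\<close>, which makes the equation for \<open>y\<close> irreducible.\<close>

locale artin_schreier_tower = quadratic_tower +
  fixes lam0 om :: 'a and lam :: "nat \<Rightarrow> 'a" and y :: "'a fps" and p :: nat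
  assumes p: "p = CHAR('a)"
    and lam: "lam0 \<noteq> 0 \<or> (\<exists>i<s. lam i \<noteq> 0)"
    and y: "y ^ p = y + (peval [:- om, lam0:] z + (\<Sum>i<s. fps_const (lam i) * w i))"
begin

definition F :: "'a fps" where "F = peval [:- om, lam0:] z + (\<Sum>i<s. fps_const (lam i) * w i)"

lemma p_gt_1: "p > 1" and prime_p: "prime p"
  using p prime_gt_1_nat[OF CHAR_prime[where 'a='a]] by simp_all

lemma odd_p: "odd p"
proof
  assume "even p"
  then have "p = 2" using prime_p primes_dvd_imp_eq two_is_prime_nat by blast
  then have "of_nat 2 = (0::'a)" using p of_nat_CHAR[where 'a='a] by metis
  then show False using two by simp
qed

lemma prime_CHAR_fps: "prime CHAR('a fps)" and p_fps: "p = CHAR('a fps)"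
  using p by simp_all

lemma F_in_M: "F \<in> M s"
  unfolding F_def by (intro M_add M_peval M_sum M_mult M_const M_w) auto

definition f :: "nat set \<Rightarrow> 'a poly" where
  "f S = (if S = {} then [:- om, lam0:] else if card S = 1 then [:lam (the_elem S):] else 0)"

lemma F_expansion: "F = (\<Sum>S\<in>Pow {..<s}. \<phi> (f S) * (\<Prod>i\<in>S. w i))"
proof -
  let ?T = "insert {} ((\<lambda>i. {i}) ` {..<s})"
  have "(\<Sum>S\<in>Pow {..<s}. \<phi> (f S) * (\<Prod>i\<in>S. w i)) = (\<Sum>S\<in>?T. \<phi> (f S) * (\<Prod>i\<in>S. w i))"
  proof (rule sum.mono_neutral_right)
    show "\<forall>S\<in>Pow {..<s} - ?T. \<phi> (f S) * (\<Prod>i\<in>S. w i) = 0"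
    proof
      fix S assume S: "S \<in> Pow {..<s} - ?T"
      then have "S \<noteq> {}" "card S \<noteq> 1" by (auto simp: card_1_singleton_iff)
      then show "\<phi> (f S) * (\<Prod>i\<in>S. w i) = 0" unfolding f_def by simp
    qed
  qed auto
  also have "\<dots> = \<phi> (f {}) + (\<Sum>S\<in>(\<lambda>i. {i}) ` {..<s}. \<phi> (f S) * (\<Prod>i\<in>S. w i))"
    by (subst sum.insert) auto
  also have "(\<Sum>S\<in>(\<lambda>i. {i}) ` {..<s}. \<phi> (f S) * (\<Prod>i\<in>S. w i)) = (\<Sum>i<s. \<phi> (f {i}) * w i)"
    by (subst sum.reindex) auto
  finally show ?thesis unfolding F_def f_def by simp
qed

text \<open>As \<open>p\<close> is odd, Frobenius maps each product of the \<open>w i\<close> to a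
  polynomial multiple of itself. Hence an Artin-Schreier equation splits into one polynomial
  equation for each \<open>S\<close>.\<close>

lemma w_prod_power_p:
  assumes "S \<subseteq> {..<s}"
  shows "(\<Prod>i\<in>S. w i) ^ p = \<phi> (\<Prod>i\<in>S. g i ^ ((p - 1) div 2)) * (\<Prod>i\<in>S. w i)"
proof -
  have "w i ^ p = \<phi> (g i ^ ((p - 1) div 2)) * w i" if "i < s" for i
  proof -
    have "p = Suc (2 * ((p - 1) div 2))" using odd_p p_gt_1 by (auto elim: oddE)
    then have "w i ^ p = w i ^ Suc (2 * ((p - 1) div 2))" by (rule arg_cong)
    also have "\<dots> = (w i * w i) ^ ((p - 1) div 2) * w i"
      by (simp only: power_Suc power_mult power2_eq_square mult.commute)
    finally show ?thesis using that by (simp only: w2 peval_power)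
  qed
  then have "(\<Prod>i\<in>S. w i ^ p) = (\<Prod>i\<in>S. \<phi> (g i ^ ((p - 1) div 2)) * w i)"
    by (intro prod.cong) (use assms in auto)
  then show ?thesis by (simp add: prod_power_distrib peval_prod prod.distrib)
qed

text \<open>The quotient \<open>v\<close> of \<open>B\<close> by \<open>\<phi> n\<close> would solve
  \<open>v = v ^ p + \<tau> * F\<close>. Its component at the empty set contradicts
  \<open>poly_equation_linear\<close> if \<open>lam0\<close> is nonzero; otherwise the component at
  some \<open>{i}\<close> contradicts \<open>poly_equation_const\<close>.\<close>

lemma no_artin_schreier_root:
  assumes B: "B \<in> M s" and n: "n \<noteq> 0" and \<tau>: "\<tau> \<noteq> 0"
    and eq: "\<phi> n ^ (p - 1) * B = B ^ p + fps_const \<tau> * \<phi> n ^ p * F"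
  shows False
proof -
  obtain u where u: "B = (\<Sum>S\<in>Pow {..<s}. \<phi> (u S) * (\<Prod>i\<in>S. w i))" using M_expansion[OF B] by blast
  define e where "e = (p - 1) div 2"
  have e2: "2 * e = p - 1" unfolding e_def using odd_p by simp
  define v where "v S = n ^ (p - 1) * u S - (u S ^ p * (\<Prod>i\<in>S. g i ^ e) + n ^ p * smult \<tau> (f S))" for S
  have Bp: "B ^ p = (\<Sum>S\<in>Pow {..<s}. \<phi> (u S ^ p * (\<Prod>i\<in>S. g i ^ e)) * (\<Prod>i\<in>S. w i))"
    unfolding u freshmans_dream_sum[OF prime_CHAR_fps p_fps] e_def
    by (rule sum.cong) (auto simp: power_mult_distrib w_prod_power_p peval_mult peval_power mult.assoc)
  have "(\<Sum>S\<in>Pow {..<s}. \<phi> (v S) * (\<Prod>i\<in>S. w i)) =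
      \<phi> n ^ (p - 1) * B - (B ^ p + fps_const \<tau> * \<phi> n ^ p * F)"
    unfolding Bp unfolding u F_expansion v_def
    by (simp add: peval_diff peval_add peval_mult peval_power peval_smult sum_subtractf sum.distrib
        sum_distrib_left algebra_simps)
  then have "(\<Sum>S\<in>Pow {..<s}. \<phi> (v S) * (\<Prod>i\<in>S. w i)) = 0" using eq by simp
  then have v0: "v S = 0" if "S \<subseteq> {..<s}" for S using kummer_indep[of s v S] that by simp
  show False
  proof (cases "lam0 = 0")
    case False
    have "n ^ (p - 1) * u {} = u {} ^ p + n ^ p * smult \<tau> [:- om, lam0:]"
      using v0[of "{}"] unfolding v_def f_def by simp
    then show False by (rule poly_equation_linear[OF p_gt_1 n, rotated]) (use False \<tau> in simp)
  next
    case True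
    then obtain i where i: "i < s" "lam i \<noteq> 0" using lam by auto
    have g2: "degree (g i) = 2" unfolding g_def using nu i by simp
    have "degree (g i ^ e) = p - 1"
      using g2 e2 by (subst degree_power_eq) auto
    moreover have "n ^ (p - 1) * u {i} = u {i} ^ p * g i ^ e + n ^ p * [:\<tau> * lam i:]"
      using v0[of "{i}"] i unfolding v_def f_def by simp
    ultimately show False using poly_equation_const[OF p_gt_1 n, of "\<tau> * lam i"] i \<tau> by auto
  qed
qed

text \<open>In a relation for \<open>y\<close> of least degree \<open>t\<close>, raising to the
  power \<open>p\<close> and replacing \<open>y ^ p\<close> by \<open>y + F\<close> gives another
  relation \<open>G\<close> of degree \<open>t\<close>. It must be proportional to \<open>P\<close>,
  and the coefficients at \<open>t - 1\<close> then yield a root excluded by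
  \<open>no_artin_schreier_root\<close>; here \<open>t < p\<close> makes \<open>of_nat t\<close>
  invertible.\<close>

lemma minimal_relation:
  fixes P :: "'a fps poly"
  assumes "P \<noteq> 0" "degree P < p" "\<And>k. coeff P k \<in> M s" "poly P y = 0"
  shows False
  using assms
proof (induction "degree P" arbitrary: P rule: less_induct)
  case less
  define t where "t = degree P"
  have t1: "t \<ge> 1"
  proof (rule ccontr)
    assume "\<not> t \<ge> 1"
    then obtain a where "P = [:a:]" unfolding t_def using degree_eq_zeroE by (metis less_one not_le)
    then show False using less.prems by simp
  qed
  define A where "A = coeff P t" define B where "B = coeff P (t - 1)"
  have A0: "A \<noteq> 0" unfolding A_def t_def using less.prems by simp
  have p0: "p > 0" using p_gt_1 by simp
  define Q where "Q = map_poly (\<lambda>x. x ^ p) P"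
  have Qc: "coeff Q k = coeff P k ^ p" for k unfolding Q_def using p0 by (simp add: coeff_map_poly)
  have Qd: "degree Q = t" unfolding Q_def t_def by (rule degree_map_poly) (use less.prems in simp)
  have "poly Q (y ^ p) = (\<Sum>i\<le>t. coeff P i ^ p * (y ^ p) ^ i)"
    unfolding poly_altdef Qd Qc by simp
  also have "\<dots> = (\<Sum>i\<le>t. (coeff P i * y ^ i) ^ p)"
    by (rule sum.cong) (simp_all add: power_mult_distrib mult.commute flip: power_mult)
  also have "\<dots> = (poly P y) ^ p"
    unfolding poly_altdef t_def freshmans_dream_sum[OF prime_CHAR_fps p_fps] ..
  finally have Qy: "poly Q (y ^ p) = 0" using less.prems(4) p0 by simp
  define G where "G = pcompose Q [:F, 1:]"
  have Gy: "poly G y = 0" using Qy y unfolding G_def F_def by (simp add: poly_pcompose add_ac)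
  have GM: "coeff G k \<in> M s" for k unfolding G_def
    by (rule coeff_pcompose_in) (auto intro: M_add M_mult M_0 F_in_M M_power less.prems(3) simp: Qc)
  define H where "H = smult (A ^ p) P - smult A G"
  have Hk: "coeff H k = 0" if "k \<ge> t" for k
  proof (cases "k = t")
    case True
    then show ?thesis unfolding H_def G_def using coeff_pcompose_shift[of Q k F] Qd Qc
      by (simp add: A_def mult.commute)
  next
    case False
    then show ?thesis unfolding H_def G_def using coeff_pcompose_shift[of Q k F] Qd that t_def
      by (simp add: coeff_eq_0)
  qed
  have "H = 0"
  proof (rule ccontr)
    assume H0: "H \<noteq> 0"
    have "degree H < t"
      using Hk[of "degree H"] H0 by (metis leading_coeff_0_iff not_less)
    moreover have "coeff H k \<in> M s" for k unfolding H_def A_def coeff_diff coeff_smult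
      by (intro M_diff M_mult M_power less.prems(3) GM order_refl)
    moreover have "poly H y = 0" unfolding H_def using Gy less.prems(4) by simp
    ultimately show False using less.hyps[of H] H0 less.prems(2) unfolding t_def by auto
  qed
  have "coeff G (t - 1) = B ^ p + of_nat t * A ^ p * F"
    using coeff_pcompose_shift[of Q t F] Qd t1 unfolding G_def Qc A_def B_def by simp
  moreover have "coeff H (t - 1) = 0" using \<open>H = 0\<close> by simp
  ultimately have "A ^ p * B = A * (B ^ p + of_nat t * A ^ p * F)"
    unfolding H_def B_def by simp
  moreover have "A ^ p = A * A ^ (p - 1)" using p0 by (cases p) auto
  ultimately have "A * (A ^ (p - 1) * B) = A * (B ^ p + of_nat t * A ^ p * F)" by (simp only: mult.assoc)
  then have eq: "A ^ (p - 1) * B = B ^ p + of_nat t * A ^ p * F" using A0 mult_left_cancel by blast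
  have AM: "A \<in> M s" and BM: "B \<in> M s" unfolding A_def B_def using less.prems(3) by auto
  \<comment> \<open>The leading coefficient \<open>A\<close> acts as a denominator of
    \<open>B\<close>; \<open>C\<close> turns it into the polynomial \<open>n\<close> required by the
    excluded equation.\<close>
  obtain C n where C: "C \<in> M s" "n \<noteq> 0" "A * C = \<phi> n" using M_conjugate[OF order_refl AM A0] by blast
  have Cp: "C ^ p = C ^ (p - 1) * C" using p0 by (cases p) auto
  have "(A * C) ^ (p - 1) * (B * C) = (A ^ (p - 1) * B) * C ^ p"
    unfolding Cp power_mult_distrib by (simp only: mult_ac)
  also have "\<dots> = (B * C) ^ p + of_nat t * (A * C) ^ p * F"
    unfolding eq power_mult_distrib by (simp add: algebra_simps)
  finally have "\<phi> n ^ (p - 1) * (B * C) = (B * C) ^ p + fps_const (of_nat t) * \<phi> n ^ p * F"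
    unfolding C(3) fps_of_nat .
  moreover have "of_nat t \<noteq> (0::'a)"
    using t1 less.prems(2) p unfolding t_def[symmetric] of_nat_eq_0_iff_char_dvd by (auto dest: dvd_imp_le)
  ultimately show False using no_artin_schreier_root M_mult[OF order_refl BM C(1)] C(2) by blast
qed

definition basis :: "nat set \<times> nat \<times> nat \<Rightarrow> 'a fps" where
  "basis = (\<lambda>(S, k, j). z ^ j * (\<Prod>i\<in>S. w i) * y ^ k)"

lemma lin_indep_basis: "lin_indep basis (Pow {..<s} \<times> {..<p} \<times> {..<n})"
  unfolding lin_indep_def
proof (intro allI impI ballI)
  fix c x
  assume eq: "(\<Sum>x\<in>Pow {..<s} \<times> {..<p} \<times> {..<n}. fps_const (c x) * basis x) = 0"
    and x: "x \<in> Pow {..<s} \<times> {..<p} \<times> {..<n}"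
  define u where "u S k = (\<Sum>j<n. monom (c (S, k, j)) j)" for S k
  have pm: "peval (monom a j) z = fps_const a * z ^ j" for a j
    by (induction j) (simp_all add: monom_0 monom_Suc mult_ac)
  define A where "A k = (\<Sum>S\<in>Pow {..<s}. \<phi> (u S k) * (\<Prod>i\<in>S. w i))" for k
  have AM: "A k \<in> M s" for k unfolding A_def by (rule M_combination) simp
  have "(\<Sum>x\<in>Pow {..<s} \<times> {..<p} \<times> {..<n}. fps_const (c x) * basis x)
     = (\<Sum>S\<in>Pow {..<s}. \<Sum>k<p. \<Sum>j<n. fps_const (c (S, k, j)) * basis (S, k, j))"
    by (simp add: sum.cartesian_product case_prod_unfold)
  also have "\<dots> = (\<Sum>k<p. \<Sum>S\<in>Pow {..<s}. \<Sum>j<n. fps_const (c (S, k, j)) * basis (S, k, j))"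
    by (rule sum.swap)
  also have "\<dots> = (\<Sum>k<p. A k * y ^ k)"
    unfolding A_def u_def basis_def
    by (intro sum.cong refl) (simp add: peval_sum pm sum_distrib_right sum_distrib_left mult_ac)
  finally have Ay: "(\<Sum>k<p. A k * y ^ k) = 0" using eq by simp
  define P where "P = (\<Sum>k<p. monom (A k) k)"
  have Pc: "coeff P k = (if k < p then A k else 0)" for k
    unfolding P_def by (simp add: coeff_sum)
  have "P = 0"
  proof (rule ccontr)
    assume P0: "P \<noteq> 0"
    have "degree P < p" using Pc[of "degree P"] P0 by (metis leading_coeff_0_iff)
    moreover have "poly P y = 0" unfolding P_def using Ay by (simp add: poly_sum poly_monom)
    moreover have "coeff P k \<in> M s" for k unfolding Pc using AM M_0 by simp
    ultimately show False using minimal_relation[OF P0] by blast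
  qed
  obtain S k j where xs: "x = (S, k, j)" "S \<subseteq> {..<s}" "k < p" "j < n" using x by auto
  have "A k = 0" using Pc[of k] \<open>P = 0\<close> xs by simp
  then have "u S k = 0" using kummer_indep[of s "\<lambda>S. u S k" S] xs unfolding A_def by simp
  moreover have "coeff (u S k) j = c (S, k, j)" unfolding u_def using xs by (simp add: coeff_sum)
  ultimately show "c x = 0" using xs by simp
qed

end

section \<open>Counting points on the Artin--Schreier cover\<close>

locale as_curve =
  fixes s p :: nat and d \<nu> lam :: "nat \<Rightarrow> 'a::finite_field" and lam0 om :: 'a
  assumes p: "p = CHAR('a)" and two: "(2::'a) \<noteq> 0"
    and d: "\<And>i. i < s \<Longrightarrow> d i \<noteq> 0" "inj_on d {..<s}" and nu: "\<And>i. i < s \<Longrightarrow> \<nu> i \<noteq> 0"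
    and lam: "lam0 \<noteq> 0 \<or> (\<exists>i<s. lam i \<noteq> 0)"
begin

text \<open>A context is a solution of the equations of the curve, either an expansion of the coordinate functions
  or a rational point written with constant series. A definable function has the same coefficients in
  all contexts, which is how power series are evaluated at the points.\<close>

type_synonym 'b ctx = "'b fps \<times> (nat \<Rightarrow> 'b fps) \<times> 'b fps"

definition valid :: "'a ctx \<Rightarrow> bool" where
  "valid = (\<lambda>(z, w, y). (\<forall>i<s. w i ^ 2 = peval (smult (\<nu> i) [:d i, 0, 1:]) z) \<and>
     y ^ p = y + (peval [:- om, lam0:] z + (\<Sum>i<s. fps_const (lam i) * w i)))"

definition bas :: "'a ctx \<Rightarrow> nat set \<times> nat \<times> nat \<Rightarrow> 'a fps" where
  "bas = (\<lambda>(z, w, y) (S, k, j). z ^ j * (\<Prod>i\<in>S. w i) * y ^ k)"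

definition E :: "nat \<Rightarrow> (nat set \<times> nat \<times> nat) set" where
  "E n = Pow {..<s} \<times> {..<p} \<times> {..<n}"

definition definable :: "('a ctx \<Rightarrow> 'a fps) \<Rightarrow> nat \<Rightarrow> bool" where
  "definable G n \<longleftrightarrow> (\<exists>c. \<forall>C. valid C \<longrightarrow> G C = (\<Sum>x\<in>E n. fps_const (c x) * bas C x))"

lemma p_gt_1: "p > 1"
  using p prime_gt_1_nat[OF CHAR_prime[where 'a='a]] by simp

lemma finite_E: "finite (E n)" and E_mono: "k \<le> n \<Longrightarrow> E k \<subseteq> E n" and card_E: "card (E n) = 2 ^ s * p * n"
  unfolding E_def by (auto simp: card_cartesian_product card_Pow)

lemma definable_cong: "(\<And>C. valid C \<Longrightarrow> G C = G' C) \<Longrightarrow> definable G n \<Longrightarrow> definable G' n"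
  unfolding definable_def by metis

lemma definable_lin_span:
  "definable G n \<Longrightarrow> valid C \<Longrightarrow> G C \<in> lin_span (bas C) (E n)"
  unfolding definable_def by (metis lin_spanI)

lemma lin_span_definable:
  "h \<in> lin_span (bas C) (E n) \<Longrightarrow> \<exists>G. definable G n \<and> G C = h"
proof -
  assume "h \<in> lin_span (bas C) (E n)"
  then obtain c where "h = (\<Sum>x\<in>E n. fps_const (c x) * bas C x)" unfolding lin_span_def by auto
  then show ?thesis unfolding definable_def
    by (intro exI[of _ "\<lambda>C. \<Sum>x\<in>E n. fps_const (c x) * bas C x"]) auto
qed

lemma definable_add: "definable G n \<Longrightarrow> definable H n \<Longrightarrow> definable (\<lambda>C. G C + H C) n"
proof -
  assume "definable G n" "definable H n"
  then obtain c e where "\<And>C. valid C \<Longrightarrow> G C = (\<Sum>x\<in>E n. fps_const (c x) * bas C x)"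
    "\<And>C. valid C \<Longrightarrow> H C = (\<Sum>x\<in>E n. fps_const (e x) * bas C x)" unfolding definable_def by auto
  then have "\<forall>C. valid C \<longrightarrow> G C + H C = (\<Sum>x\<in>E n. fps_const (c x + e x) * bas C x)"
    by (simp add: sum.distrib[symmetric] ring_distribs fps_const_add[symmetric] del: fps_const_add)
  then show ?thesis unfolding definable_def by (rule exI[of _ "\<lambda>x. c x + e x"])
qed

lemma definable_smult: "definable G n \<Longrightarrow> definable (\<lambda>C. fps_const a * G C) n"
proof -
  assume "definable G n"
  then obtain c where "\<And>C. valid C \<Longrightarrow> G C = (\<Sum>x\<in>E n. fps_const (c x) * bas C x)"
    unfolding definable_def by auto
  then have "\<forall>C. valid C \<longrightarrow> fps_const a * G C = (\<Sum>x\<in>E n. fps_const (a * c x) * bas C x)"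
    by (simp add: sum_distrib_left mult.assoc[symmetric])
  then show ?thesis unfolding definable_def by (rule exI[of _ "\<lambda>x. a * c x"])
qed

lemma definable_0: "definable (\<lambda>C. 0) n"
  unfolding definable_def by (rule exI[of _ "\<lambda>_. 0"]) simp

lemma definable_sum: "(\<And>i. i \<in> I \<Longrightarrow> definable (G i) n) \<Longrightarrow> definable (\<lambda>C. \<Sum>i\<in>I. G i C) n"
  by (induction I rule: infinite_finite_induct) (auto intro: definable_0 definable_add)

lemma definable_diff: "definable G n \<Longrightarrow> definable H n \<Longrightarrow> definable (\<lambda>C. G C - H C) n"
  using definable_add[of G n "\<lambda>C. fps_const (-1) * H C"] definable_smult[of H n "-1"]
  by (simp add: fps_const_neg[symmetric] del: fps_const_neg)

lemma definable_bas: "x \<in> E n \<Longrightarrow> definable (\<lambda>C. bas C x) n"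
  unfolding definable_def
proof (intro exI[of _ "\<lambda>y. if y = x then 1 else 0"] allI impI)
  fix C assume x: "x \<in> E n"
  have "(\<Sum>y\<in>E n. fps_const (if y = x then 1 else 0) * bas C y) = (\<Sum>y\<in>E n. if y = x then bas C y else 0)"
    by (rule sum.cong) auto
  then show "bas C x = (\<Sum>y\<in>E n. fps_const (if y = x then 1 else 0) * bas C y)"
    using x finite_E by simp
qed

lemma definable_linear:
  assumes "\<And>x. x \<in> E n \<Longrightarrow> definable (\<lambda>C. H C * bas C x) n'" "definable G n"
  shows "definable (\<lambda>C. H C * G C) n'"
proof -
  obtain c where c: "\<And>C. valid C \<Longrightarrow> G C = (\<Sum>x\<in>E n. fps_const (c x) * bas C x)"
    using assms(2) unfolding definable_def by auto
  have "definable (\<lambda>C. \<Sum>x\<in>E n. fps_const (c x) * (H C * bas C x)) n'"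
    by (intro definable_sum definable_smult assms(1))
  then show ?thesis
    by (rule definable_cong[rotated]) (simp add: c sum_distrib_left mult_ac)
qed

lemma definable_mono: "k \<le> n \<Longrightarrow> definable G k \<Longrightarrow> definable G n"
proof -
  assume "k \<le> n" "definable G k"
  moreover from this have "definable (\<lambda>C. 1 * bas C x) n" if "x \<in> E k" for x
    using definable_bas[OF subsetD[OF E_mono that]] by simp
  ultimately show ?thesis using definable_linear[of k "\<lambda>_. 1" n G] by simp
qed

lemma definable_z: "definable G n \<Longrightarrow> definable (\<lambda>C. fst C * G C) (Suc n)"
proof (rule definable_linear)
  fix x assume "x \<in> E n"
  then obtain S k j where x: "x = (S, k, j)" "(S, k, Suc j) \<in> E (Suc n)" unfolding E_def by auto
  show "definable (\<lambda>C. fst C * bas C x) (Suc n)"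
    by (rule definable_cong[OF _ definable_bas[OF x(2)]]) (auto simp: bas_def x mult_ac)
qed

text \<open>A second factor \<open>w i\<close> is removed by its quadratic equation, which raises
  the degree in \<open>z\<close> by two.\<close>

lemma definable_w: "i < s \<Longrightarrow> definable G n \<Longrightarrow> definable (\<lambda>C. fst (snd C) i * G C) (n + 2)"
proof (rule definable_linear)
  fix x assume i: "i < s" and "x \<in> E n"
  then obtain S k j where x: "x = (S, k, j)" "S \<subseteq> {..<s}" "k < p" "j < n" unfolding E_def by auto
  have fin: "finite S" using x finite_subset by auto
  show "definable (\<lambda>C. fst (snd C) i * bas C x) (n + 2)"
  proof (cases "i \<in> S")
    case False
    have m: "(insert i S, k, j) \<in> E (n + 2)" using x i unfolding E_def by auto
    show ?thesis
      by (rule definable_cong[OF _ definable_bas[OF m]]) (use False fin in \<open>auto simp: bas_def x mult_ac\<close>)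
  next
    case True
    have m: "(S - {i}, k, j) \<in> E (n + 2)" "(S - {i}, k, j + 2) \<in> E (n + 2)"
      using x unfolding E_def by auto
    have "definable (\<lambda>C. fps_const (\<nu> i * d i) * bas C (S - {i}, k, j) + fps_const (\<nu> i) * bas C (S - {i}, k, j + 2)) (n + 2)"
      by (intro definable_add definable_smult definable_bas m)
    then show ?thesis
    proof (rule definable_cong[rotated])
      fix C assume C: "valid C"
      obtain z w y where zwy: "C = (z, w, y)" by (cases C)
      have w2: "w i * w i = fps_const (\<nu> i * d i) + fps_const (\<nu> i) * z ^ 2"
        using C i unfolding valid_def zwy
        by (simp add: power2_eq_square peval_smult algebra_simps fps_const_mult[symmetric] del: fps_const_mult)
      have "(\<Prod>i\<in>S. w i) = w i * (\<Prod>i\<in>S - {i}. w i)" by (rule prod.remove[OF fin True])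
      then have "fst (snd C) i * bas C x = (w i * w i) * (z ^ j * (\<Prod>i\<in>S - {i}. w i) * y ^ k)"
        unfolding bas_def zwy x by (simp add: mult_ac)
      also have "\<dots> = fps_const (\<nu> i * d i) * bas C (S - {i}, k, j) + fps_const (\<nu> i) * bas C (S - {i}, k, j + 2)"
        unfolding w2 bas_def zwy by (simp add: power_add power2_eq_square algebra_simps)
      finally show "fps_const (\<nu> i * d i) * bas C (S - {i}, k, j) + fps_const (\<nu> i) * bas C (S - {i}, k, j + 2)
        = fst (snd C) i * bas C x" ..
    qed
  qed
qed

text \<open>When the power of \<open>y\<close> reaches \<open>p\<close>, the equation of the curve
  replaces it by lower terms; among these, the products with \<open>w i\<close> may cost two degrees
  in \<open>z\<close>.\<close>

lemma definable_y: "definable G n \<Longrightarrow> definable (\<lambda>C. snd (snd C) * G C) (n + 2)"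
proof (rule definable_linear)
  fix x assume "x \<in> E n"
  then obtain S k j where x: "x = (S, k, j)" "S \<subseteq> {..<s}" "k < p" "j < n" unfolding E_def by auto
  show "definable (\<lambda>C. snd (snd C) * bas C x) (n + 2)"
  proof (cases "Suc k < p")
    case True
    then have m: "(S, Suc k, j) \<in> E (n + 2)" using x unfolding E_def by auto
    show ?thesis
      by (rule definable_cong[OF _ definable_bas[OF m]]) (auto simp: bas_def x mult_ac)
  next
    case False
    then have k: "Suc k = p" using x by simp
    have m: "(S, 1, j) \<in> E (n + 2)" "(S, 0, j) \<in> E n" "(S, 0, j) \<in> E (n + 2)" "(S, 0, Suc j) \<in> E (n + 2)"
      using x p_gt_1 unfolding E_def by auto
    have "definable (\<lambda>C. bas C (S, 1, j) + (fps_const (- om) * bas C (S, 0, j) + fps_const lam0 * bas C (S, 0, Suc j)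
        + (\<Sum>i<s. fps_const (lam i) * (fst (snd C) i * bas C (S, 0, j))))) (n + 2)"
      by (intro definable_add definable_smult definable_sum definable_w definable_bas m) simp
    then show ?thesis
    proof (rule definable_cong[rotated])
      fix C assume C: "valid C"
      obtain z w y where zwy: "C = (z, w, y)" by (cases C)
      let ?b = "z ^ j * (\<Prod>i\<in>S. w i)"
      have "snd (snd C) * bas C x = ?b * y ^ p"
        unfolding k[symmetric] bas_def zwy x by (simp add: mult_ac)
      also have "y ^ p = y + (fps_const (- om) + z * fps_const lam0 + (\<Sum>i<s. fps_const (lam i) * w i))"
        using C unfolding valid_def zwy by simp
      also have "?b * \<dots> = ?b * y + (fps_const (- om) * ?b + fps_const lam0 * (z * ?b)
          + (\<Sum>i<s. fps_const (lam i) * (w i * ?b)))"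
        by (simp add: distrib_left sum_distrib_left mult_ac)
      finally show "bas C (S, 1, j) + (fps_const (- om) * bas C (S, 0, j) + fps_const lam0 * bas C (S, 0, Suc j)
        + (\<Sum>i<s. fps_const (lam i) * (fst (snd C) i * bas C (S, 0, j)))) = snd (snd C) * bas C x"
        unfolding bas_def zwy by (simp add: mult_ac)
    qed
  qed
qed

text \<open>A monomial has at most \<open>s\<close> factors \<open>w i\<close> and fewer than
  \<open>p\<close> factors \<open>y\<close>, each costing at most two degrees. This is the source of
  the defect \<open>2 * s + 2 * p\<close>.\<close>

lemma definable_monomial:
  assumes x: "x \<in> E m" and G: "definable G n"
  shows "definable (\<lambda>C. bas C x * G C) (m + n + (2 * s + 2 * p))"
proof -
  obtain S k j where xs: "x = (S, k, j)" "S \<subseteq> {..<s}" "k < p" "j < m" using x unfolding E_def by auto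
  have "definable (\<lambda>C. snd (snd C) ^ l * G C) (n + 2 * l)" for l
  proof (induction l)
    case (Suc l) then show ?case using definable_y[OF Suc] by (simp add: mult.assoc)
  qed (use G in simp)
  then have 1: "definable (\<lambda>C. snd (snd C) ^ k * G C) (n + 2 * k)" .
  have "finite S" using xs finite_subset by auto
  then have 2: "definable (\<lambda>C. (\<Prod>i\<in>S. fst (snd C) i) * (snd (snd C) ^ k * G C)) (n + 2 * k + 2 * card S)"
    using xs(2)
  proof (induction S)
    case (insert i S)
    then have "definable (\<lambda>C. fst (snd C) i * ((\<Prod>i\<in>S. fst (snd C) i) * (snd (snd C) ^ k * G C))) (n + 2 * k + 2 * card S + 2)"
      by (intro definable_w) auto
    then show ?case using insert.hyps by (simp add: mult.assoc)
  qed (use 1 in simp)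
  have 3: "definable (\<lambda>C. fst C ^ l * ((\<Prod>i\<in>S. fst (snd C) i) * (snd (snd C) ^ k * G C))) (n + 2 * k + 2 * card S + l)" for l
  proof (induction l)
    case (Suc l) then show ?case using definable_z[OF Suc] by (simp add: mult.assoc)
  qed (use 2 in simp)
  have "card S \<le> s" using xs(2) card_mono[of "{..<s}" S] by simp
  then have "n + 2 * k + 2 * card S + j \<le> m + n + (2 * s + 2 * p)" using xs by simp
  then have "definable (\<lambda>C. fst C ^ j * ((\<Prod>i\<in>S. fst (snd C) i) * (snd (snd C) ^ k * G C))) (m + n + (2 * s + 2 * p))"
    using 3 definable_mono by blast
  then show ?thesis
    by (rule definable_cong[rotated]) (auto simp: bas_def xs mult_ac split: prod.split)
qed

lemma definable_mult:
  assumes "definable G m" "definable H n"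
  shows "definable (\<lambda>C. G C * H C) (m + n + (2 * s + 2 * p))"
proof -
  have "definable (\<lambda>C. H C * bas C x) (m + n + (2 * s + 2 * p))" if "x \<in> E m" for x
    using definable_monomial[OF that assms(2)] by (simp add: mult.commute)
  then have "definable (\<lambda>C. H C * G C) (m + n + (2 * s + 2 * p))" using assms(1) by (rule definable_linear)
  then show ?thesis by (simp add: mult.commute)
qed

lemma definable_1: "definable (\<lambda>C. 1) 1"
proof -
  have m: "({}, 0, 0) \<in> E 1" using p_gt_1 unfolding E_def by auto
  show ?thesis by (rule definable_cong[OF _ definable_bas[OF m]]) (auto simp: bas_def)
qed

lemma definable_const: "definable (\<lambda>C. fps_const a) 1"
  using definable_smult[OF definable_1, of a] by simp

text \<open>Zeros of the \<open>w i\<close> are left out: at the remaining points \<open>z\<close>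
  minus its value is a local parameter in which all coordinates can be expanded. Extensionality of
  \<open>w\<close> makes points correspond to tuples.\<close>

definition points :: "('a \<times> (nat \<Rightarrow> 'a) \<times> 'a) set" where
  "points = {(z, w, y). w \<in> {..<s} \<rightarrow>\<^sub>E UNIV \<and> (\<forall>i<s. w i \<noteq> 0 \<and> w i ^ 2 = \<nu> i * (z ^ 2 + d i)) \<and>
     y ^ p = y + (lam0 * z - om + (\<Sum>i<s. lam i * w i))}"

definition const_ctx :: "'a \<times> (nat \<Rightarrow> 'a) \<times> 'a \<Rightarrow> 'a ctx" where
  "const_ctx = (\<lambda>(z, w, y). (fps_const z, \<lambda>i. fps_const (w i), fps_const y))"

lemma finite_points: "finite points"
proof (rule finite_subset)
  show "points \<subseteq> UNIV \<times> ({..<s} \<rightarrow>\<^sub>E UNIV) \<times> UNIV" unfolding points_def by auto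
  show "finite ((UNIV :: 'a set) \<times> ({..<s} \<rightarrow>\<^sub>E (UNIV :: 'a set)) \<times> (UNIV :: 'a set))"
    by (intro finite_SigmaI finite_PiE) auto
qed

lemma fps_const_sum: "fps_const (sum h I) = (\<Sum>i\<in>I. fps_const (h i :: 'a))"
  by (induction I rule: infinite_finite_induct) (simp_all add: fps_const_add[symmetric] del: fps_const_add)

lemma valid_const_ctx: "P \<in> points \<Longrightarrow> valid (const_ctx P)"
proof -
  assume "P \<in> points"
  then obtain z w y where P: "P = (z, w, y)" "\<forall>i<s. w i ^ 2 = \<nu> i * (z ^ 2 + d i)"
    "y ^ p = y + (lam0 * z - om + (\<Sum>i<s. lam i * w i))" unfolding points_def by auto
  have "fps_const y ^ p = fps_const (y + (lam0 * z - om + (\<Sum>i<s. lam i * w i)))" using P(3) by simp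
  then have "fps_const y ^ p = fps_const y + (peval [:- om, lam0:] (fps_const z) + (\<Sum>i<s. fps_const (lam i) * fps_const (w i)))"
    by (simp add: fps_const_sum[symmetric] algebra_simps)
  then show ?thesis using P(2) unfolding valid_def const_ctx_def P(1)
    by (simp add: peval_smult power2_eq_square algebra_simps)
qed

lemma peval_shift: "peval u (fps_const a + fps_X) = fps_of_poly (pcompose u [:a, 1:])"
proof (induction u)
  case (pCons b u)
  have "fps_of_poly [:a, 1:] = fps_const a + fps_X" by (simp add: fps_of_poly_linear)
  then show ?case using pCons by (simp add: pcompose_pCons fps_of_poly_add fps_of_poly_mult fps_of_poly_const)
qed simp

lemma expansion_exists:
  assumes "(z, w, y) \<in> points"
  obtains w' y' where "valid (fps_const z + fps_X, w', y')"
proof -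
  let ?z = "fps_const z + fps_X"
  have pt: "\<forall>i<s. w i \<noteq> 0 \<and> w i ^ 2 = \<nu> i * (z ^ 2 + d i)"
    "y ^ p = y + (lam0 * z - om + (\<Sum>i<s. lam i * w i))" using assms unfolding points_def by auto
  have "\<exists>h. h ^ 2 = peval (smult (\<nu> i) [:d i, 0, 1:]) ?z \<and> h $ 0 = w i" if "i < s" for i
    by (rule fps_sqrt_exists[OF two]) (use pt that in \<open>auto simp: peval_smult power2_eq_square algebra_simps fps_mult_nth_0\<close>)
  then obtain w' where w': "\<And>i. i < s \<Longrightarrow> w' i ^ 2 = peval (smult (\<nu> i) [:d i, 0, 1:]) ?z \<and> w' i $ 0 = w i"
    by metis
  have "(peval [:- om, lam0:] ?z + (\<Sum>i<s. fps_const (lam i) * w' i)) $ 0 = lam0 * z - om + (\<Sum>i<s. lam i * w i)"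
    using w' by (simp add: fps_sum_nth mult.commute)
  then obtain y' where "y' ^ p = y' + (peval [:- om, lam0:] ?z + (\<Sum>i<s. fps_const (lam i) * w' i))"
    using fps_artin_schreier_exists[OF p] pt(2) by metis
  then show ?thesis using that w' unfolding valid_def by auto
qed

text \<open>A single rational point suffices to embed the functions into power series, and if there
  is none, the bound is trivial.\<close>

theorem card_points_le:
  assumes r: "r = CHAR('a) ^ \<mu>" "CARD('a) = r ^ 2"
    and A: "A = 2 ^ s * p * (2 * s + 2 * p + 1) + 1" and big: "r \<ge> 2 * A + 1"
  shows "card points \<le> r ^ 2 + 5 * A * r"
proof (cases "points = {}")
  case False
  then obtain z1 w1 y1 where P1: "(z1, w1, y1) \<in> points" by auto
  then obtain w y where C0: "valid (fps_const z1 + fps_X, w, y)" by (rule expansion_exists)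
  define z where "z = fps_const z1 + fps_X"
  define C where "C = (z, w, y)"
  have vC: "valid C" using C0 unfolding C_def z_def .
  interpret T: artin_schreier_tower s d \<nu> z w lam0 om lam y p
  proof unfold_locales
    show "u = 0" if "peval u z = 0" for u
    proof -
      have "fps_of_poly (pcompose u [:z1, 1:]) = fps_of_poly 0" using that unfolding z_def peval_shift by simp
      then have "pcompose u [:z1, 1:] = 0" by (simp only: fps_of_poly_eq_iff)
      then show ?thesis by (simp add: pcompose_eq_0_iff)
    qed
    show "w i ^ 2 = peval (smult (\<nu> i) [:d i, 0, 1:]) z" if "i < s" for i
      using vC that unfolding valid_def C_def by auto
    show "y ^ p = y + (peval [:- om, lam0:] z + (\<Sum>i<s. fps_const (lam i) * w i))"
      using vC unfolding valid_def C_def by auto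
  qed (use two d nu p lam in auto)
  have bas: "bas C = T.basis" unfolding bas_def C_def T.basis_def by auto
  have ind: "lin_indep (bas C) (E n)" for n unfolding bas E_def by (rule T.lin_indep_basis)
  \<comment> \<open>Monomials are independent at the expansion \<open>C\<close>, so an identity that
    holds at \<open>C\<close> holds coefficientwise and therefore at all contexts. Hence evaluation
    at points is well defined.\<close>
  have unique: "G C' = H C'" if G: "definable G m" and H: "definable H n" and eq: "G C = H C" and C': "valid C'" for G H m n C'
  proof -
    have "definable (\<lambda>C. G C - H C) (m + n)"
      using definable_diff[OF definable_mono[OF _ G] definable_mono[OF _ H], of "m + n"] by simp
    then obtain c where c: "\<And>C. valid C \<Longrightarrow> G C - H C = (\<Sum>x\<in>E (m + n). fps_const (c x) * bas C x)"
      unfolding definable_def by auto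
    have "(\<Sum>x\<in>E (m + n). fps_const (c x) * bas C x) = 0" using c[OF vC] eq by simp
    then have "\<forall>x\<in>E (m + n). c x = 0" using ind[of "m + n"] unfolding lin_indep_def by blast
    then have "G C' - H C' = 0" unfolding c[OF C'] by (intro sum.neutral) auto
    then show ?thesis by simp
  qed
  define ev where "ev P h = (SOME v. \<exists>G n. definable G n \<and> G C = h \<and> v = G (const_ctx P) $ 0)" for P h
  have evI: "ev P (G C) = G (const_ctx P) $ 0" if P: "P \<in> points" and G: "definable G n" for P G n
  proof -
    have "\<exists>v. \<exists>H n. definable H n \<and> H C = G C \<and> v = H (const_ctx P) $ 0" using G by blast
    then have "\<exists>H n. definable H n \<and> H C = G C \<and> ev P (G C) = H (const_ctx P) $ 0"
      unfolding ev_def by (rule someI_ex)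
    then show ?thesis using unique[OF _ G _ valid_const_ctx[OF P]] by metis
  qed
  have repr: "\<exists>G. definable G n \<and> G C = h" if "h \<in> lin_span (bas C) (E n)" for h n
    using lin_span_definable[OF that] .
  interpret R: curve_ring "bas C" E "2 ^ s * p" "2 * s + 2 * p" points ev
  proof unfold_locales
    show "h * h' \<in> lin_span (bas C) (E (k + n + (2 * s + 2 * p)))"
      if h: "h \<in> lin_span (bas C) (E k)" "h' \<in> lin_span (bas C) (E n)" for h h' k n
    proof -
      obtain G H where "definable G k" "G C = h" "definable H n" "H C = h'" using repr h by blast
      then show ?thesis using definable_lin_span[OF definable_mult vC, of G k H n] by simp
    qed
    show "fps_X ^ i \<in> lin_span (bas C) (E (Suc i))" for i
    proof -
      \<comment> \<open>At \<open>C\<close> the function \<open>z - z1\<close> is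
        \<open>fps_X\<close>.\<close>
      have "definable (\<lambda>C. (fst C - fps_const z1) ^ i) (Suc i)"
      proof (induction i)
        case 0 then show ?case using definable_1 by simp
      next
        case (Suc i)
        have "definable (\<lambda>C. fst C * (fst C - fps_const z1) ^ i - fps_const z1 * (fst C - fps_const z1) ^ i) (Suc (Suc i))"
          by (intro definable_diff definable_z definable_smult definable_mono[OF _ Suc] Suc) simp
        then show ?case by (simp add: algebra_simps)
      qed
      from definable_lin_span[OF this vC] show ?thesis by (simp add: C_def z_def)
    qed
    show "ev P (h + h') = ev P h + ev P h'" if P: "P \<in> points"
      and h: "h \<in> lin_span (bas C) (E k)" "h' \<in> lin_span (bas C) (E n)" for P h h' k n
    proof -
      obtain G H where G: "definable G k" "G C = h" and H: "definable H n" "H C = h'" using repr h by blast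
      have d: "definable (\<lambda>C. G C + H C) (k + n)"
        using definable_add[OF definable_mono[OF _ G(1)] definable_mono[OF _ H(1)], of "k + n"] by simp
      show ?thesis using evI[OF P d] evI[OF P G(1)] evI[OF P H(1)] unfolding G(2) H(2) by simp
    qed
    show "ev P (h * h') = ev P h * ev P h'" if P: "P \<in> points"
      and h: "h \<in> lin_span (bas C) (E k)" "h' \<in> lin_span (bas C) (E n)" for P h h' k n
    proof -
      obtain G H where G: "definable G k" "G C = h" and H: "definable H n" "H C = h'" using repr h by blast
      show ?thesis using evI[OF P definable_mult[OF G(1) H(1)]] evI[OF P G(1)] evI[OF P H(1)] G H
        by (simp add: fps_mult_nth_0)
    qed
    show "ev P (fps_const a) = a" if P: "P \<in> points" for P a
      using evI[OF P definable_const[of a]] by simp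
    show "\<exists>k. \<exists>h\<in>lin_span (bas C) (E k). ev P h = 1 \<and> (\<forall>P'\<in>points. P' \<noteq> P \<longrightarrow> ev P' h = 0)"
      if P: "P \<in> points" for P
    proof -
      \<comment> \<open>Two points differ in a coordinate, and an affine function of it takes the
        values 1 and 0 there. Products of such functions separate \<open>P\<close> from all other
        points.\<close>
      have sep: "\<exists>G n. definable G n \<and> G (const_ctx P) $ 0 = 1 \<and> G (const_ctx P') $ 0 = 0"
        if P': "P' \<in> points" "P' \<noteq> P" for P'
      proof -
        have coord: "\<exists>G n. definable G n \<and> G (const_ctx P) $ 0 = 1 \<and> G (const_ctx P') $ 0 = 0"
          if G: "definable G n" and ne: "G (const_ctx P) $ 0 \<noteq> G (const_ctx P') $ 0" for G n
        proof -
          define a where "a = G (const_ctx P) $ 0" define b where "b = G (const_ctx P') $ 0"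
          have "definable (\<lambda>C. fps_const (1 / (a - b)) * (G C - fps_const b)) (n + 1)"
            by (intro definable_smult definable_diff definable_mono[OF _ G] definable_mono[OF _ definable_const]) auto
          moreover have "a - b \<noteq> 0" using ne unfolding a_def b_def by simp
          ultimately show ?thesis unfolding a_def b_def
            by (intro exI[of _ "\<lambda>C. fps_const (1 / (a - b)) * (G C - fps_const b)"] exI[of _ "n + 1"])
               (simp add: a_def b_def fps_mult_nth_0)
        qed
        obtain z w y z' w' y' where PP: "P = (z, w, y)" "P' = (z', w', y')" by (cases P, cases P')
        have dz: "definable (\<lambda>C. fst C) 2" using definable_z[OF definable_1] by (simp add: numeral_2_eq_2)
        have dw: "definable (\<lambda>C. fst (snd C) i) 3" if "i < s" for i
          using definable_w[OF that definable_1] by (simp add: numeral_eq_Suc)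
        have dy: "definable (\<lambda>C. snd (snd C)) 3" using definable_y[OF definable_1] by (simp add: numeral_eq_Suc)
        consider "z \<noteq> z'" | "y \<noteq> y'" | "w \<noteq> w'" using P'(2) PP by auto
        then show ?thesis
        proof cases
          case 1 then show ?thesis using coord[OF dz] unfolding PP const_ctx_def by simp
        next
          case 2 then show ?thesis using coord[OF dy] unfolding PP const_ctx_def by simp
        next
          case 3
          have "w \<in> {..<s} \<rightarrow>\<^sub>E UNIV" "w' \<in> {..<s} \<rightarrow>\<^sub>E UNIV" using P P' unfolding PP points_def by auto
          then obtain i where "i < s" "w i \<noteq> w' i" using 3 PiE_ext by blast
          then show ?thesis using coord[OF dw] unfolding PP const_ctx_def by simp
        qed
      qed
      have "finite B \<Longrightarrow> B \<subseteq> points - {P} \<Longrightarrow> \<exists>G n. definable G n \<and> G (const_ctx P) $ 0 = 1 \<and> (\<forall>P'\<in>B. G (const_ctx P') $ 0 = 0)" for B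
      proof (induction B rule: finite_induct)
        case empty then show ?case by (intro exI[of _ "\<lambda>_. 1"] exI[of _ 1]) (use definable_1 in simp)
      next
        case (insert P' B)
        then obtain G n where G: "definable G n" "G (const_ctx P) $ 0 = 1" "\<forall>P'\<in>B. G (const_ctx P') $ 0 = 0" by auto
        obtain H m where H: "definable H m" "H (const_ctx P) $ 0 = 1" "H (const_ctx P') $ 0 = 0"
          using sep[of P'] insert.prems by auto
        show ?case
          by (rule exI[of _ "\<lambda>C. G C * H C"], rule exI, rule conjI[OF definable_mult[OF G(1) H(1)]])
             (use G H in \<open>auto simp: fps_mult_nth_0\<close>)
      qed
      from this[of "points - {P}"] obtain G n where G: "definable G n" "G (const_ctx P) $ 0 = 1"
        "\<forall>P'\<in>points - {P}. G (const_ctx P') $ 0 = 0" using finite_points by auto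
      show ?thesis
        by (rule exI[of _ n], rule bexI[OF _ definable_lin_span[OF G(1) vC]])
           (use G P evI[OF _ G(1)] in auto)
    qed
  qed (use finite_E E_mono card_E ind finite_points in auto)
  show ?thesis using R.card_points_le[OF r _ A big] p_gt_1 by simp
qed simp

end

section \<open>Frobenius fixed fields and traces\<close>

lemma additive_fiber:
  fixes f :: "'a::{finite, ab_group_add} \<Rightarrow> 'b::ab_group_add"
  assumes add: "\<And>x y. f (x + y) = f x + f y" and v: "v \<in> range f"
  shows "card {x. f x = v} = card {x. f x = 0}"
proof -
  obtain a where a: "f a = v" using v by auto
  have fd: "f (x - y) = f x - f y" for x y using add[of "x - y" y] by (simp add: eq_diff_eq)
  have "bij_betw (\<lambda>x. x + a) {x. f x = 0} {x. f x = v}"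
    by (rule bij_betwI[where g = "\<lambda>x. x - a"]) (auto simp: add fd a)
  then show ?thesis by (simp add: bij_betw_same_card)
qed

lemma additive_card:
  fixes f :: "'a::{finite, ab_group_add} \<Rightarrow> 'b::ab_group_add"
  assumes add: "\<And>x y. f (x + y) = f x + f y"
  shows "card (UNIV :: 'a set) = card (range f) * card {x. f x = 0}"
proof -
  have "card (UNIV :: 'a set) = card (\<Union>v\<in>range f. {x. f x = v})" by (rule arg_cong[where f = card]) auto
  also have "\<dots> = (\<Sum>v\<in>range f. card {x. f x = v})" by (rule card_UN_disjoint) auto
  also have "\<dots> = (\<Sum>v\<in>range f. card {x. f x = 0})" by (rule sum.cong) (auto intro: additive_fiber[OF add])
  finally show ?thesis by simp
qed

text \<open>Subfields are sets of fixed points inside one type, which allows several of them to be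
  used at once.\<close>

definition frob_fixed :: "nat \<Rightarrow> 'a::finite_field set" where
  "frob_fixed N = {x. x ^ N = x}"

definition trace :: "nat \<Rightarrow> nat \<Rightarrow> 'a::finite_field \<Rightarrow> 'a" where
  "trace N h x = (\<Sum>i<h. x ^ (N ^ i))"

locale subfield_power =
  fixes ty :: "'a::finite_field itself" and N h a :: nat
  assumes N: "N = CHAR('a) ^ a" "a > 0" and Nh: "CARD('a) = N ^ h"
begin

lemma N_gt_1: "N > 1"
  using N one_less_power[OF prime_gt_1_nat[OF CHAR_prime[where 'a='a]], of a] by simp

lemma h_pos: "h > 0"
proof (rule ccontr)
  assume "\<not> h > 0"
  then have "CARD('a) = 1" using Nh by simp
  moreover have "card {0, 1::'a} \<le> CARD('a)" by (rule card_mono) auto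
  ultimately show False by simp
qed

lemma frob_add: "(x + y :: 'a) ^ (N ^ i) = x ^ (N ^ i) + y ^ (N ^ i)"
  by (rule freshmans_dream'[where n = "a * i"]) (simp_all add: N power_mult)

lemma frob_add1: "(x + y :: 'a) ^ N = x ^ N + y ^ N"
  using frob_add[of x y 1] by simp

lemma frob_minus1: "(- x :: 'a) ^ N = - (x ^ N)"
  using frob_add1[of "- x" x] N_gt_1 by (simp add: eq_neg_iff_add_eq_0 power_0_left)

lemma frob_sum: "(\<Sum>j\<in>J. f j :: 'a) ^ N = (\<Sum>j\<in>J. f j ^ N)"
  by (rule freshmans_dream_sum'[where n = a]) (simp_all add: N)

lemma trace_add: "trace N h (x + y) = trace N h x + (trace N h y :: 'a)"
  unfolding trace_def by (simp add: frob_add sum.distrib)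

lemma trace_0: "trace N h (0::'a) = 0"
  using trace_add[of 0 0] by (metis add_0 add_cancel_right_right)

lemma trace_minus: "trace N h (- x) = - (trace N h x :: 'a)"
  using trace_add[of "- x" x] by (simp add: trace_0 eq_neg_iff_add_eq_0)

lemma trace_diff: "trace N h (x - y) = trace N h x - (trace N h y :: 'a)"
  using trace_add[of x "- y"] by (simp add: trace_minus)

lemma trace_sum: "trace N h (\<Sum>j\<in>J. f j) = (\<Sum>j\<in>J. trace N h (f j :: 'a))"
  by (induction J rule: infinite_finite_induct) (simp_all add: trace_add trace_0)

lemma power_card: "(x::'a) ^ (N ^ h) = x"
  using finite_field_power_card_eq_same[of x] Nh by simp

lemma fixed_closed:
  "0 \<in> (frob_fixed N :: 'a set)" "1 \<in> (frob_fixed N :: 'a set)"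
  "(x::'a) \<in> frob_fixed N \<Longrightarrow> y \<in> frob_fixed N \<Longrightarrow> x + y \<in> frob_fixed N"
  "(x::'a) \<in> frob_fixed N \<Longrightarrow> y \<in> frob_fixed N \<Longrightarrow> x - y \<in> frob_fixed N"
  "(x::'a) \<in> frob_fixed N \<Longrightarrow> y \<in> frob_fixed N \<Longrightarrow> x * y \<in> frob_fixed N"
  "(x::'a) \<in> frob_fixed N \<Longrightarrow> y \<in> frob_fixed N \<Longrightarrow> x / y \<in> frob_fixed N"
  "(x::'a) \<in> frob_fixed N \<Longrightarrow> x ^ n \<in> frob_fixed N"
  "(x::'a) \<in> frob_fixed N \<Longrightarrow> - x \<in> frob_fixed N"
proof -
  have "(x - y) ^ N = x ^ N - y ^ N" for x y :: 'a
    using frob_add1[of x "- y"] frob_minus1[of y] by simp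
  moreover have "(x ^ n) ^ N = (x ^ N) ^ n" for x :: 'a by (simp add: mult.commute flip: power_mult)
  ultimately show "0 \<in> (frob_fixed N :: 'a set)" "1 \<in> (frob_fixed N :: 'a set)"
    "(x::'a) \<in> frob_fixed N \<Longrightarrow> y \<in> frob_fixed N \<Longrightarrow> x + y \<in> frob_fixed N"
    "(x::'a) \<in> frob_fixed N \<Longrightarrow> y \<in> frob_fixed N \<Longrightarrow> x - y \<in> frob_fixed N"
    "(x::'a) \<in> frob_fixed N \<Longrightarrow> y \<in> frob_fixed N \<Longrightarrow> x * y \<in> frob_fixed N"
    "(x::'a) \<in> frob_fixed N \<Longrightarrow> y \<in> frob_fixed N \<Longrightarrow> x / y \<in> frob_fixed N"
    "(x::'a) \<in> frob_fixed N \<Longrightarrow> x ^ n \<in> frob_fixed N"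
    "(x::'a) \<in> frob_fixed N \<Longrightarrow> - x \<in> frob_fixed N"
    using N_gt_1 unfolding frob_fixed_def
    by (simp_all add: frob_add1 frob_minus1 power_mult_distrib power_divide power_0_left)
qed

lemma fixed_sum: "(\<And>j. j \<in> J \<Longrightarrow> f j \<in> (frob_fixed N :: 'a set)) \<Longrightarrow> sum f J \<in> frob_fixed N"
  by (induction J rule: infinite_finite_induct) (auto intro: fixed_closed)

lemma fixed_prod: "(\<And>j. j \<in> J \<Longrightarrow> f j \<in> (frob_fixed N :: 'a set)) \<Longrightarrow> prod f J \<in> frob_fixed N"
  by (induction J rule: infinite_finite_induct) (auto intro: fixed_closed)

lemma fixed_power: "(c::'a) \<in> frob_fixed N \<Longrightarrow> c ^ (N ^ i) = c"
  by (induction i) (simp_all add: power_mult frob_fixed_def)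

lemma trace_smult: "(c::'a) \<in> frob_fixed N \<Longrightarrow> trace N h (c * x) = c * trace N h x"
  unfolding trace_def by (simp add: power_mult_distrib fixed_power sum_distrib_left)

lemma trace_frob: "trace N h (x ^ N) = (trace N h x :: 'a)"
proof -
  have "trace N h (x ^ N) = (\<Sum>i<h. x ^ (N ^ Suc i))"
    unfolding trace_def by (simp add: power_mult)
  also have "\<dots> = (\<Sum>i<Suc h. x ^ (N ^ i)) - x"
    by (subst sum.lessThan_Suc_shift) simp
  also have "\<dots> = trace N h x" unfolding trace_def using power_card[of x] by simp
  finally show ?thesis .
qed

lemma trace_fixed: "(trace N h x :: 'a) \<in> frob_fixed N"
proof -
  have "trace N h x ^ N = (\<Sum>i<h. (x ^ (N ^ i)) ^ N)" unfolding trace_def by (rule frob_sum)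
  also have "\<dots> = trace N h (x ^ N)" unfolding trace_def
    by (rule sum.cong) (simp_all add: mult.commute flip: power_mult)
  finally show ?thesis unfolding frob_fixed_def by (simp add: trace_frob)
qed

lemma card_trace_kernel_le: "card {x::'a. trace N h x = 0} \<le> N ^ (h - 1)"
proof -
  define q where "q = (\<Sum>i<h. monom (1::'a) (N ^ i))"
  have q: "poly q x = trace N h x" for x unfolding q_def trace_def by (simp add: poly_sum poly_monom)
  have "N ^ i = N ^ j \<longleftrightarrow> i = j" for i j by (rule power_inject_exp[OF N_gt_1])
  then have c: "coeff q (N ^ i) = 1" if "i < h" for i
    unfolding q_def using that by (simp add: coeff_sum)
  have q0: "q \<noteq> 0" using c[of 0] h_pos by auto
  have "degree q \<le> N ^ (h - 1)"
    unfolding q_def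
  proof (rule degree_sum_le)
    fix i assume "i \<in> {..<h}"
    then have "N ^ i \<le> N ^ (h - 1)" using N_gt_1 by (intro power_increasing) auto
    then show "degree (monom (1::'a) (N ^ i)) \<le> N ^ (h - 1)" by (simp add: degree_monom_eq)
  qed simp
  moreover have "card {x. poly q x = 0} \<le> degree q" by (rule card_poly_roots_bound[OF q0])
  ultimately show ?thesis unfolding q by simp
qed

lemma card_fixed_le: "card (frob_fixed N :: 'a set) \<le> N"
proof -
  define q where "q = monom (1::'a) N - monom 1 1"
  have "coeff q N = 1" unfolding q_def using N_gt_1 by simp
  then have q0: "q \<noteq> 0" by auto
  have "degree q \<le> N" unfolding q_def
    by (rule degree_diff_le) (use N_gt_1 in \<open>simp_all add: degree_monom_eq\<close>)
  moreover have "card {x. poly q x = 0} \<le> degree q" by (rule card_poly_roots_bound[OF q0])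
  moreover have "{x. poly q x = 0} = (frob_fixed N :: 'a set)"
    unfolding q_def frob_fixed_def by (simp add: poly_monom)
  ultimately show ?thesis by simp
qed

definition wp :: "'a \<Rightarrow> 'a" where "wp y = y ^ N - y"

lemma wp_add: "wp (x + y) = wp x + wp y"
  unfolding wp_def by (simp add: frob_add1)

lemma card_fixed: "card (frob_fixed N :: 'a set) = N"
  and range_wp: "range wp = {x. trace N h x = 0}"
  and card_trace_kernel: "card {x::'a. trace N h x = 0} = N ^ (h - 1)"
proof -
  have sub: "range wp \<subseteq> {x. trace N h x = 0}"
    unfolding wp_def by (auto simp: trace_diff trace_frob)
  have "{x. wp x = 0} = frob_fixed N" unfolding wp_def frob_fixed_def by auto
  then have eq: "N ^ h = card (range wp) * card (frob_fixed N :: 'a set)"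
    using additive_card[of wp, OF wp_add] Nh by simp
  have Nh1: "N ^ h = N ^ (h - 1) * N" using h_pos by (cases h) auto
  have le: "card (range wp) \<le> card {x::'a. trace N h x = 0}" by (rule card_mono[OF _ sub]) simp
  have p0: "N > 0" using N_gt_1 by simp
  have rl: "card (range wp) \<le> N ^ (h - 1)" using le card_trace_kernel_le by simp
  show cf: "card (frob_fixed N :: 'a set) = N"
  proof (rule antisym[OF card_fixed_le])
    have "N ^ (h - 1) * N \<le> N ^ (h - 1) * card (frob_fixed N :: 'a set)"
      unfolding Nh1[symmetric] eq by (rule mult_right_mono[OF rl]) simp
    then show "N \<le> card (frob_fixed N :: 'a set)" using p0 by simp
  qed
  have "card (range wp) = N ^ (h - 1)" using eq p0 unfolding cf Nh1 by simp
  then have "card (range wp) = card {x::'a. trace N h x = 0}" using le card_trace_kernel_le by simp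
  then show "range wp = {x. trace N h x = 0}" using sub by (intro card_subset_eq) auto
  show "card {x::'a. trace N h x = 0} = N ^ (h - 1)"
    using le card_trace_kernel_le \<open>card (range wp) = N ^ (h - 1)\<close> by simp
qed

lemma range_trace: "range (trace N h) = (frob_fixed N :: 'a set)"
proof (rule card_subset_eq)
  show "range (trace N h) \<subseteq> (frob_fixed N :: 'a set)" using trace_fixed by auto
  have "N ^ h = card (range (trace N h :: 'a \<Rightarrow> 'a)) * N ^ (h - 1)"
    using additive_card[of "trace N h :: 'a \<Rightarrow> 'a", OF trace_add] Nh card_trace_kernel by simp
  moreover have "N ^ h = N * N ^ (h - 1)" using h_pos by (cases h) auto
  ultimately have "card (range (trace N h :: 'a \<Rightarrow> 'a)) = N" using N_gt_1 by simp
  then show "card (range (trace N h :: 'a \<Rightarrow> 'a)) = card (frob_fixed N :: 'a set)" by (simp only: card_fixed)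
qed simp

lemma card_wp_fiber: "trace N h v = 0 \<Longrightarrow> card {y. wp y = v} = N"
proof -
  assume "trace N h v = 0"
  then have "v \<in> range wp" using range_wp by auto
  then have "card {y. wp y = v} = card {y. wp y = 0}" by (rule additive_fiber[OF wp_add])
  also have "{y. wp y = 0} = frob_fixed N" unfolding wp_def frob_fixed_def by auto
  finally show ?thesis by (simp only: card_fixed)
qed

lemma trace_eq_fixed_card:
  assumes "c \<noteq> 0" "v \<in> frob_fixed N"
  shows "N * card {x::'a. trace N h (c * x) = v} = CARD('a)"
proof -
  have inj: "inj (\<lambda>x. c * x)" using assms by (auto intro: injI)
  then have "range (\<lambda>x. c * x) = UNIV" using finite_UNIV_inj_surj[of "\<lambda>x. c * x"] by simp
  then have "range (\<lambda>x. trace N h (c * x)) = frob_fixed N" using range_trace by (metis image_image)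
  moreover have "\<And>x y. trace N h (c * (x + y)) = trace N h (c * x) + (trace N h (c * y) :: 'a)"
    by (simp add: distrib_left trace_add)
  ultimately show ?thesis
    using additive_card[of "\<lambda>x. trace N h (c * x) :: 'a"] additive_fiber[of "\<lambda>x. trace N h (c * x) :: 'a" v]
      assms(2) card_fixed by simp
qed

end

lemma prime_field_eq:
  assumes "CARD('a::finite_field) = CHAR('a) ^ h"
  shows "(frob_fixed CHAR('a) :: 'a set) = of_nat ` {..<CHAR('a)}"
proof -
  interpret subfield_power "TYPE('a)" "CHAR('a)" h 1 by unfold_locales (use assms in auto)
  show ?thesis
  proof (rule card_subset_eq[symmetric])
    have "of_nat k \<in> (frob_fixed CHAR('a) :: 'a set)" for k
      by (induction k) (auto intro: fixed_closed)
    then show "of_nat ` {..<CHAR('a)} \<subseteq> (frob_fixed CHAR('a) :: 'a set)" by auto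
    have "inj_on (of_nat :: nat \<Rightarrow> 'a) {..<CHAR('a)}"
    proof (rule linorder_inj_onI)
      fix i j :: nat assume "i < j" "i \<in> {..<CHAR('a)}" "j \<in> {..<CHAR('a)}"
      then have "\<not> CHAR('a) dvd (j - i)" by (auto dest: dvd_imp_le)
      then have "of_nat (j - i) \<noteq> (0::'a)" by (simp add: of_nat_eq_0_iff_char_dvd)
      then show "(of_nat i :: 'a) \<noteq> of_nat j" using \<open>i < j\<close> by (simp add: of_nat_diff)
    qed auto
    then show "card (of_nat ` {..<CHAR('a)} :: 'a set) = card (frob_fixed CHAR('a) :: 'a set)"
      by (simp add: card_image card_fixed)
  qed simp
qed

section \<open>Squares in finite fields\<close>

lemma nonsquare_exists:
  assumes "(2::'a::finite_field) \<noteq> 0"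
  shows "\<exists>\<eta>::'a. \<forall>b. b ^ 2 \<noteq> \<eta>"
proof (rule ccontr)
  assume "\<not> ?thesis"
  then have "surj (\<lambda>b::'a. b ^ 2)" by (metis surjI)
  then have "inj (\<lambda>b::'a. b ^ 2)" by (rule finite_UNIV_surj_inj[OF finite])
  then have "(1::'a) = - 1" by (rule injD) simp
  then show False using assms by (metis add_eq_0_iff one_add_one)
qed

text \<open>The nonzero squares are half of the nonzero elements, so multiplication by
  \<open>\<eta>\<close> maps them onto the nonsquares.\<close>

lemma nonsquare_times_nonsquare:
  fixes \<eta> a :: "'a::finite_field"
  assumes two: "(2::'a) \<noteq> 0" and eta: "\<And>b. b ^ 2 \<noteq> \<eta>" and a: "\<And>b. b ^ 2 \<noteq> a"
  shows "\<exists>b. \<eta> * b ^ 2 = a"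
proof -
  define S where "S = range (\<lambda>b::'a. b ^ 2) - {0}"
  have e0: "\<eta> \<noteq> 0" using eta[of 0] by auto
  have "2 * card S = card (UNIV - {0::'a})"
  proof -
    have "card (UNIV - {0::'a}) = card (\<Union>v\<in>S. {b. b ^ 2 = v})"
      by (rule arg_cong[where f = card]) (auto simp: S_def)
    also have "\<dots> = (\<Sum>v\<in>S. card {b::'a. b ^ 2 = v})" by (rule card_UN_disjoint) auto
    also have "\<dots> = (\<Sum>v\<in>S. 2)"
    proof (rule sum.cong)
      fix v assume "v \<in> S"
      then obtain c where c: "v = c ^ 2" "c \<noteq> 0" unfolding S_def by auto
      have "{b. b ^ 2 = v} = {c, - c}" using c by (auto simp: power2_eq_iff)
      moreover have "c \<noteq> - c" using c two by (metis add_eq_0_iff mult_2 mult_eq_0_iff)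
      ultimately show "card {b. b ^ 2 = v} = 2" by simp
    qed simp
    finally show ?thesis by simp
  qed
  moreover have ci: "card ((\<lambda>v. \<eta> * v) ` S) = card S" by (rule card_image) (use e0 in \<open>auto intro: inj_onI\<close>)
  moreover have disj: "S \<inter> (\<lambda>v. \<eta> * v) ` S = {}"
  proof -
    have False if vb: "\<eta> * b ^ 2 = c ^ 2" "b ^ 2 \<noteq> 0" for b c :: 'a
    proof -
      have "(c / b) ^ 2 = \<eta>" using vb by (simp add: power_divide field_simps)
      then show False using eta by blast
    qed
    then show ?thesis unfolding S_def by force
  qed
  ultimately have "card (S \<union> (\<lambda>v. \<eta> * v) ` S) = card (UNIV - {0::'a})" by (simp add: card_Un_disjoint)
  moreover have "S \<union> (\<lambda>v. \<eta> * v) ` S \<subseteq> UNIV - {0}" using e0 unfolding S_def by auto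
  ultimately have "S \<union> (\<lambda>v. \<eta> * v) ` S = UNIV - {0}" by (intro card_subset_eq) auto
  moreover have "a \<noteq> 0" using a[of 0] by auto
  moreover have "a \<notin> S" using a unfolding S_def by auto
  ultimately have "a \<in> (\<lambda>v. \<eta> * v) ` S" by blast
  then show ?thesis unfolding S_def by auto
qed

text \<open>Exactly one of \<open>a\<close> and \<open>\<eta> * a\<close> is a square, and that one
  has two roots.\<close>

lemma card_twisted_roots:
  fixes \<eta> a :: "'a::finite_field"
  assumes two: "(2::'a) \<noteq> 0" and eta: "\<And>b. b ^ 2 \<noteq> \<eta>" and a: "a \<noteq> 0"
  shows "(\<Sum>\<nu>\<in>{1, \<eta>}. card {w. w \<noteq> 0 \<and> w ^ 2 = \<nu> * a}) = 2"
proof -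
  have e1: "\<eta> \<noteq> 1" using eta[of 1] by auto
  have expand: "(\<Sum>\<nu>\<in>{1, \<eta>}. f \<nu>) = f 1 + f \<eta>" for f :: "'a \<Rightarrow> nat" using e1 by (subst sum.insert) auto
  have sq: "card {w. w \<noteq> 0 \<and> w ^ 2 = c ^ 2} = 2" if "c \<noteq> 0" for c :: 'a
  proof -
    have "{w. w \<noteq> 0 \<and> w ^ 2 = c ^ 2} = {c, - c}" using that by (auto simp: power2_eq_iff)
    moreover have "c \<noteq> - c" using that two by (metis add_eq_0_iff mult_2 mult_eq_0_iff)
    ultimately show ?thesis by simp
  qed
  show ?thesis
  proof (cases "\<exists>b. b ^ 2 = a")
    case True
    then obtain b where b: "b ^ 2 = a" by blast
    then have b0: "b \<noteq> 0" using a by auto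
    have "{w. w \<noteq> 0 \<and> w ^ 2 = \<eta> * a} = {}"
    proof -
      have False if "w ^ 2 = \<eta> * a" for w
      proof -
        have "(w / b) ^ 2 = \<eta>" using that b0 unfolding b[symmetric] by (simp add: power_divide field_simps)
        then show False using eta by blast
      qed
      then show ?thesis by blast
    qed
    moreover have "card {w. w \<noteq> 0 \<and> w ^ 2 = 1 * a} = 2" using sq[OF b0] b by simp
    ultimately show ?thesis unfolding expand by (simp only: card.empty)
  next
    case False
    then obtain b where b: "\<eta> * b ^ 2 = a" using nonsquare_times_nonsquare[OF two eta, of a] by blast
    then have b0: "\<eta> * b \<noteq> 0" using a by auto
    have "(\<eta> * b) ^ 2 = \<eta> * a" unfolding b[symmetric] by (simp add: power2_eq_square)
    then have "card {w. w \<noteq> 0 \<and> w ^ 2 = \<eta> * a} = 2" using sq[OF b0] by simp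
    moreover have "{w. w \<noteq> 0 \<and> w ^ 2 = 1 * a} = {}" using False by auto
    ultimately show ?thesis unfolding expand by (simp only: card.empty)
  qed
qed

section \<open>Simultaneous square roots with prescribed traces\<close>

locale multiquadratic_curve =
  fixes s p \<mu> r A :: nat and d :: "nat \<Rightarrow> 'a::finite_field"
  assumes p: "p = CHAR('a)" and two: "(2::'a) \<noteq> 0"
    and d: "\<And>i. i < s \<Longrightarrow> d i \<noteq> 0" "inj_on d {..<s}"
    and r: "r = p ^ \<mu>" "CARD('a) = r ^ 2"
    and A: "A = 2 ^ s * p * (2 * s + 2 * p + 1) + 1" and big: "r \<ge> 2 * A + 1"
begin

sublocale subfield_power "TYPE('a)" p "2 * \<mu>" 1
  by unfold_locales (use p r in \<open>auto simp: power_mult mult.commute\<close>)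

abbreviation Tr :: "'a \<Rightarrow> 'a" where "Tr \<equiv> trace p (2 * \<mu>)"

definition Y :: "(nat \<Rightarrow> 'a) \<Rightarrow> ('a \<times> (nat \<Rightarrow> 'a)) set" where
  "Y \<nu> = {(z, w). w \<in> {..<s} \<rightarrow>\<^sub>E UNIV \<and> (\<forall>i<s. w i \<noteq> 0 \<and> w i ^ 2 = \<nu> i * (z ^ 2 + d i))}"

definition lin :: "'a \<Rightarrow> (nat \<Rightarrow> 'a) \<Rightarrow> 'a \<times> (nat \<Rightarrow> 'a) \<Rightarrow> 'a" where
  "lin l0 l P = l0 * fst P + (\<Sum>i<s. l i * snd P i)"

lemma finite_Y: "finite (Y \<nu>)"
proof (rule finite_subset)
  show "Y \<nu> \<subseteq> UNIV \<times> ({..<s} \<rightarrow>\<^sub>E UNIV)" unfolding Y_def by auto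
  show "finite ((UNIV :: 'a set) \<times> ({..<s} \<rightarrow>\<^sub>E (UNIV :: 'a set)))" by (intro finite_SigmaI finite_PiE) auto
qed

text \<open>Over a point of \<open>Y \<nu>\<close> the Artin-Schreier equation has \<open>p\<close>
  solutions \<open>y\<close> if the trace condition holds and none otherwise, so the left-hand side
  counts the points of an \<open>as_curve\<close>.\<close>

lemma card_trace_fiber_le:
  assumes nu: "\<And>i. i < s \<Longrightarrow> \<nu> i \<noteq> 0" and l: "l0 \<noteq> 0 \<or> (\<exists>i<s. l i \<noteq> 0)"
  shows "p * card {P \<in> Y \<nu>. Tr (lin l0 l P - om) = 0} \<le> r ^ 2 + 5 * A * r"
proof -
  interpret C: as_curve s p d \<nu> l l0 om by unfold_locales (use p two d nu l in auto)
  let ?B = "{P \<in> Y \<nu>. Tr (lin l0 l P - om) = 0}"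
  let ?S = "SIGMA P:?B. {y. wp y = lin l0 l P - om}"
  have iff: "y ^ p = y + (l0 * z - om + (\<Sum>i<s. l i * w i)) \<longleftrightarrow> wp y = lin l0 l (z, w) - om" for y z w
    unfolding wp_def lin_def by (auto simp: algebra_simps)
  have tr: "Tr (wp y) = 0" for y using range_wp by auto
  have "C.points = (\<lambda>(P, y). (fst P, snd P, y)) ` ?S"
  proof (intro equalityI subsetI)
    fix x assume x: "x \<in> C.points"
    obtain z w y where zwy: "x = (z, w, y)" by (cases x)
    have "(z, w) \<in> Y \<nu>" "wp y = lin l0 l (z, w) - om"
      using x unfolding zwy C.points_def Y_def iff by auto
    then have "((z, w), y) \<in> ?S" using tr[of y] by auto
    then show "x \<in> (\<lambda>(P, y). (fst P, snd P, y)) ` ?S" unfolding zwy by force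
  next
    fix x assume "x \<in> (\<lambda>(P, y). (fst P, snd P, y)) ` ?S"
    then obtain z w y where "x = (z, w, y)" "(z, w) \<in> Y \<nu>" "wp y = lin l0 l (z, w) - om" by auto
    then show "x \<in> C.points" unfolding C.points_def Y_def iff[symmetric] by auto
  qed
  moreover have "inj_on (\<lambda>(P, y). (fst P, snd P, y)) ?S" by (auto intro!: inj_onI)
  ultimately have "card C.points = card ?S" by (simp add: card_image)
  also have "\<dots> = (\<Sum>P\<in>?B. card {y. wp y = lin l0 l P - om})"
    using finite_Y by (intro card_SigmaI) auto
  also have "\<dots> = (\<Sum>P\<in>?B. p)" by (intro sum.cong refl card_wp_fiber) auto
  finally have "card C.points = p * card ?B" by (simp add: mult.commute)
  moreover have "card C.points \<le> r ^ 2 + 5 * A * r"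
    by (rule C.card_points_le[OF _ r(2) A big]) (use r p in simp)
  ultimately show ?thesis by simp
qed

lemma card_Y_trace_split:
  "card (Y \<nu>) = (\<Sum>v\<in>frob_fixed p. card {P \<in> Y \<nu>. Tr (lin l0 l P) = v})"
proof -
  have "card (Y \<nu>) = card (\<Union>v\<in>frob_fixed p. {P \<in> Y \<nu>. Tr (lin l0 l P) = v})"
    by (rule arg_cong[where f = card]) (auto simp: trace_fixed)
  also have "\<dots> = (\<Sum>v\<in>frob_fixed p. card {P \<in> Y \<nu>. Tr (lin l0 l P) = v})"
    by (rule card_UN_disjoint) (use finite_Y in auto)
  finally show ?thesis .
qed

lemma card_trace_value_le:
  assumes nu: "\<And>i. i < s \<Longrightarrow> \<nu> i \<noteq> 0" and l: "l0 \<noteq> 0 \<or> (\<exists>i<s. l i \<noteq> 0)" and v: "v \<in> frob_fixed p"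
  shows "p * card {P \<in> Y \<nu>. Tr (lin l0 l P) = v} \<le> r ^ 2 + 5 * A * r"
proof -
  obtain om where om: "v = Tr om" using v range_trace by auto
  have "{P \<in> Y \<nu>. Tr (lin l0 l P) = v} = {P \<in> Y \<nu>. Tr (lin l0 l P - om) = 0}"
    unfolding om by (simp add: trace_diff)
  then show ?thesis using card_trace_fiber_le[OF nu l, where om = om] by simp
qed

text \<open>The trace of \<open>z\<close> takes \<open>p\<close> values, and the bounds for the
  single values add up to a bound without trace condition.\<close>

lemma card_Y_le:
  assumes nu: "\<And>i. i < s \<Longrightarrow> \<nu> i \<noteq> 0"
  shows "card (Y \<nu>) \<le> r ^ 2 + 5 * A * r"
proof -
  have "p * card (Y \<nu>) = (\<Sum>v\<in>frob_fixed p. p * card {P \<in> Y \<nu>. Tr (lin 1 (\<lambda>_. 0) P) = v})"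
    unfolding card_Y_trace_split[of \<nu> 1 "\<lambda>_. 0"] by (simp add: sum_distrib_left)
  also have "\<dots> \<le> (\<Sum>v\<in>(frob_fixed p :: 'a set). r ^ 2 + 5 * A * r)"
    by (intro sum_mono card_trace_value_le nu) auto
  also have "\<dots> = p * (r ^ 2 + 5 * A * r)" by (simp add: card_fixed)
  finally show ?thesis using N_gt_1 by simp
qed

text \<open>Summed over all twists \<open>\<nu> i \<in> {1, \<eta>}\<close>, with \<open>\<eta>\<close> a nonsquare, almost every \<open>z\<close> carries exactly
  \<open>2\<^sup>s\<close> points. So the upper bounds for the other twists imply this lower bound.\<close>

lemma card_Y_ge: "int (r ^ 2) - 2 ^ s * (2 * int s + 5 * int A * int r) \<le> int (card (Y (\<lambda>_. 1)))"
proof -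
  obtain \<eta> :: 'a where eta: "\<And>b. b ^ 2 \<noteq> \<eta>" using nonsquare_exists[OF two] by blast
  have e0: "\<eta> \<noteq> 0" using eta[of 0] by auto
  have e1: "\<eta> \<noteq> 1" using eta[of 1] by auto
  define \<E> where "\<E> = ({..<s} \<rightarrow>\<^sub>E {1, \<eta>})"
  \<comment> \<open>Outside \<open>Z\<close> some \<open>w i\<close> would have to be 0, which
    \<open>Y\<close> forbids; this loses at most \<open>2 * s\<close> values of
    \<open>z\<close>.\<close>
  define Z where "Z = {z::'a. \<forall>i<s. z ^ 2 + d i \<noteq> 0}"
  have cE: "card \<E> = 2 ^ s" unfolding \<E>_def using e1 by (simp add: card_PiE card_insert_if numeral_2_eq_2)
  have finE: "finite \<E>" unfolding \<E>_def by (intro finite_PiE) auto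
  have Zc: "CARD('a) \<le> card Z + 2 * s"
  proof -
    have "card {z::'a. z ^ 2 + d i = 0} \<le> 2" for i
    proof -
      have "card {z. poly [:d i, 0, 1:] z = 0} \<le> degree [:d i, 0, 1:]" by (rule card_poly_roots_bound) simp
      then show ?thesis by (simp add: power2_eq_square add.commute)
    qed
    then have "(\<Sum>i<s. card {z::'a. z ^ 2 + d i = 0}) \<le> (\<Sum>i<s. 2)" by (intro sum_mono) auto
    moreover have "card (\<Union>i<s. {z::'a. z ^ 2 + d i = 0}) \<le> (\<Sum>i<s. card {z::'a. z ^ 2 + d i = 0})"
      by (rule card_UN_le) simp
    moreover have "UNIV = Z \<union> (\<Union>i<s. {z::'a. z ^ 2 + d i = 0})" unfolding Z_def by auto
    then have "CARD('a) \<le> card Z + card (\<Union>i<s. {z::'a. z ^ 2 + d i = 0})" by (metis card_Un_le)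
    ultimately show ?thesis by simp
  qed
  have zcount: "(\<Sum>\<epsilon>\<in>\<E>. card {w. (z, w) \<in> Y \<epsilon>}) = 2 ^ s" if z: "z \<in> Z" for z
  proof -
    have "{w. (z, w) \<in> Y \<epsilon>} = (\<Pi>\<^sub>E i\<in>{..<s}. {x. x \<noteq> 0 \<and> x ^ 2 = \<epsilon> i * (z ^ 2 + d i)})" for \<epsilon>
      unfolding Y_def by (auto simp: PiE_iff extensional_def)
    then have "card {w. (z, w) \<in> Y \<epsilon>} = (\<Prod>i<s. card {x. x \<noteq> 0 \<and> x ^ 2 = \<epsilon> i * (z ^ 2 + d i)})" for \<epsilon>
      by (simp add: card_PiE)
    then have "(\<Sum>\<epsilon>\<in>\<E>. card {w. (z, w) \<in> Y \<epsilon>})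
        = (\<Prod>i<s. \<Sum>\<nu>\<in>{1, \<eta>}. card {x. x \<noteq> 0 \<and> x ^ 2 = \<nu> * (z ^ 2 + d i)})"
      unfolding \<E>_def by (simp only: prod_sum_PiE[OF finite_lessThan, of s "\<lambda>_. {1, \<eta>}"] finite.intros)
    also have "\<dots> = (\<Prod>i<s. 2)"
      by (intro prod.cong refl card_twisted_roots two eta) (use z in \<open>auto simp: Z_def\<close>)
    finally show ?thesis by simp
  qed
  have Yslice: "card (Y \<epsilon>) \<ge> (\<Sum>z\<in>Z. card {w. (z, w) \<in> Y \<epsilon>})" for \<epsilon>
  proof -
    have fw: "finite {w. (z, w) \<in> Y \<epsilon>}" for z
      by (rule finite_subset[of _ "snd ` Y \<epsilon>"]) (use finite_Y in \<open>force+\<close>)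
    have "(\<Sum>z\<in>Z. card {w. (z, w) \<in> Y \<epsilon>}) = card (SIGMA z:Z. {w. (z, w) \<in> Y \<epsilon>})"
      by (rule card_SigmaI[symmetric]) (use fw in auto)
    also have "\<dots> \<le> card (Y \<epsilon>)" by (rule card_mono[OF finite_Y]) auto
    finally show ?thesis .
  qed
  have "2 ^ s * card Z = (\<Sum>z\<in>Z. \<Sum>\<epsilon>\<in>\<E>. card {w. (z, w) \<in> Y \<epsilon>})" by (simp add: zcount)
  also have "\<dots> = (\<Sum>\<epsilon>\<in>\<E>. \<Sum>z\<in>Z. card {w. (z, w) \<in> Y \<epsilon>})" by (rule sum.swap)
  also have "\<dots> \<le> (\<Sum>\<epsilon>\<in>\<E>. card (Y \<epsilon>))" by (intro sum_mono Yslice)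
  also have "\<dots> = card (Y (\<lambda>i\<in>{..<s}. 1)) + (\<Sum>\<epsilon>\<in>\<E> - {\<lambda>i\<in>{..<s}. 1}. card (Y \<epsilon>))"
    by (rule sum.remove[OF finE]) (auto simp: \<E>_def)
  also have "(\<Sum>\<epsilon>\<in>\<E> - {\<lambda>i\<in>{..<s}. 1}. card (Y \<epsilon>)) \<le> (\<Sum>\<epsilon>\<in>\<E> - {\<lambda>i\<in>{..<s}. 1}. r ^ 2 + 5 * A * r)"
  proof (intro sum_mono card_Y_le)
    fix \<epsilon> i assume "\<epsilon> \<in> \<E> - {\<lambda>i\<in>{..<s}. 1}" "i < s"
    then have "\<epsilon> i \<in> {1, \<eta>}" unfolding \<E>_def by (intro PiE_mem[of \<epsilon> "{..<s}" "\<lambda>_. {1, \<eta>}" i]) auto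
    then show "\<epsilon> i \<noteq> 0" using e0 by auto
  qed
  also have "\<dots> = (2 ^ s - 1) * (r ^ 2 + 5 * A * r)"
    using finE cE by (subst sum_constant, subst card_Diff_singleton) (auto simp: \<E>_def)
  also have "Y (\<lambda>i\<in>{..<s}. 1) = Y (\<lambda>_. 1)" unfolding Y_def by auto
  finally have "2 ^ s * card Z \<le> card (Y (\<lambda>_. 1)) + (2 ^ s - 1) * (r ^ 2 + 5 * A * r)" by simp
  then have "int (2 ^ s * card Z) \<le> int (card (Y (\<lambda>_. 1)) + (2 ^ s - 1) * (r ^ 2 + 5 * A * r))"
    by (rule of_nat_mono)
  then have 1: "2 ^ s * int (card Z) \<le> int (card (Y (\<lambda>_. 1))) + (2 ^ s - 1) * (int r ^ 2 + 5 * int A * int r)"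
    by (simp add: of_nat_diff)
  have "int (r ^ 2) \<le> int (card Z + 2 * s)" using Zc r(2) by (intro of_nat_mono) simp
  then have "2 ^ s * int (r ^ 2) \<le> 2 ^ s * (int (card Z) + 2 * int s)" by (intro mult_left_mono) auto
  moreover have "R - T * (S + U) \<le> y"
    if "T * Z \<le> y + (T - 1) * (R + U)" "T * R \<le> T * (Z + S)" "U \<ge> 0" for T Z y R U S :: int
    using that by (simp add: algebra_simps)
  ultimately show ?thesis using 1 by simp
qed

text \<open>The points with the other \<open>p - 1\<close> trace values are bounded from above, so
  the lower bound for the whole curve leaves enough points with value \<open>v\<close>.\<close>

lemma card_trace_value_ge:
  assumes l: "l0 \<noteq> 0 \<or> (\<exists>i<s. l i \<noteq> 0)" and v: "v \<in> frob_fixed p"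
  shows "int p * int (card {P \<in> Y (\<lambda>_. 1). Tr (lin l0 l P) = v})
    \<ge> int (r ^ 2) - int p * (2 ^ s * (2 * int s + 5 * int A * int r) + 5 * int A * int r)"
proof -
  let ?c = "\<lambda>v. card {P \<in> Y (\<lambda>_. 1). Tr (lin l0 l P) = v}"
  have "p * card (Y (\<lambda>_. 1)) = p * ?c v + (\<Sum>v'\<in>frob_fixed p - {v}. p * ?c v')"
    unfolding card_Y_trace_split[of _ l0 l] sum_distrib_left by (rule sum.remove) (use v in auto)
  also have "(\<Sum>v'\<in>frob_fixed p - {v}. p * ?c v') \<le> (\<Sum>v'\<in>frob_fixed p - {v}. r ^ 2 + 5 * A * r)"
    by (intro sum_mono card_trace_value_le l) auto
  also have "\<dots> = (p - 1) * (r ^ 2 + 5 * A * r)"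
    using v by (simp add: card_fixed)
  finally have "p * card (Y (\<lambda>_. 1)) \<le> p * ?c v + (p - 1) * (r ^ 2 + 5 * A * r)" by simp
  then have "int (p * card (Y (\<lambda>_. 1))) \<le> int (p * ?c v + (p - 1) * (r ^ 2 + 5 * A * r))" by (rule of_nat_mono)
  then have 1: "int p * int (card (Y (\<lambda>_. 1))) \<le> int p * int (?c v) + (int p - 1) * (int r ^ 2 + 5 * int A * int r)"
    using N_gt_1 by (simp add: of_nat_diff)
  have "int p * (int (r ^ 2) - 2 ^ s * (2 * int s + 5 * int A * int r)) \<le> int p * int (card (Y (\<lambda>_. 1)))"
    by (rule mult_left_mono[OF card_Y_ge]) simp
  moreover have "R - P * (E0 + U) \<le> P * c"
    if "P * (R - E0) \<le> P * y" "P * y \<le> P * c + (P - 1) * (R + U)" "U \<ge> 0" for P R E0 U y c :: int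
    using that by (simp add: algebra_simps)
  ultimately show ?thesis using 1 by simp
qed

text \<open>The trace is an additive function of the tuple. If it is nonzero at a tuple supported on
  \<open>i\<close>, the multiples of this tuple translate the kernel onto each of the
  \<open>p\<close> fibres, which therefore have equal size.\<close>

lemma test_count:
  fixes L :: "nat \<Rightarrow> 'a set" and \<delta> :: "nat \<Rightarrow> 'a"
  assumes L: "\<And>i. i \<le> s \<Longrightarrow> 0 \<in> L i" "\<And>i x y. i \<le> s \<Longrightarrow> x \<in> L i \<Longrightarrow> y \<in> L i \<Longrightarrow> x - y \<in> L i"
    and i: "i \<le> s" "l \<in> L i" "Tr (l * \<delta> i) \<noteq> 0"
  shows "p * card {\<kappa> \<in> PiE {..s} L. Tr (\<Sum>j\<le>s. \<kappa> j * \<delta> j) = 0} = card (PiE {..s} L)"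
proof -
  let ?V = "\<lambda>\<kappa>. Tr (\<Sum>j\<le>s. \<kappa> j * \<delta> j)"
  let ?T = "PiE {..s} L"
  have fin: "finite ?T" by (intro finite_PiE) auto
  have Lm: "- x \<in> L i" if "x \<in> L i" for x using L(2)[OF i(1) L(1)[OF i(1)] that] by simp
  have La: "x + y \<in> L i" if "x \<in> L i" "y \<in> L i" for x y using L(2)[OF i(1) that(1) Lm[OF that(2)]] by simp
  have Lk: "of_nat k * l \<in> L i" for k
    by (induction k) (use L(1) i La in \<open>auto simp: distrib_right\<close>)
  have upd: "?V (\<kappa>(i := \<kappa> i + x)) = ?V \<kappa> + Tr (x * \<delta> i)" for \<kappa> x
  proof -
    have "(\<Sum>j\<le>s. (\<kappa>(i := \<kappa> i + x)) j * \<delta> j) = (\<Sum>j\<le>s. \<kappa> j * \<delta> j + (if j = i then x * \<delta> i else 0))"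
      by (rule sum.cong) (auto simp: distrib_right)
    also have "\<dots> = (\<Sum>j\<le>s. \<kappa> j * \<delta> j) + x * \<delta> i" using i(1) by (simp add: sum.distrib)
    finally show ?thesis by (simp add: trace_add)
  qed
  have kt: "Tr (of_nat k * l * \<delta> i) = of_nat k * Tr (l * \<delta> i)" for k
    by (induction k) (simp_all add: trace_0 trace_add distrib_right)
  have fib: "card {\<kappa> \<in> ?T. ?V \<kappa> = v} = card {\<kappa> \<in> ?T. ?V \<kappa> = 0}" if v: "v \<in> frob_fixed p" for v
  proof -
    \<comment> \<open>The prime field consists of the multiples of 1, so adding multiples of
      \<open>l\<close> reaches every value although \<open>L i\<close> is only assumed to be a
      group.\<close>
    have "v / Tr (l * \<delta> i) \<in> frob_fixed p" by (rule fixed_closed(6)[OF v trace_fixed])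
    then obtain k where "v / Tr (l * \<delta> i) = of_nat k" using prime_field_eq[where 'a='a, of "2 * \<mu>"] Nh p by auto
    then have k: "v = of_nat k * Tr (l * \<delta> i)" using i(3) by (simp add: field_simps)
    have "bij_betw (\<lambda>\<kappa>. \<kappa>(i := \<kappa> i + of_nat k * l)) {\<kappa> \<in> ?T. ?V \<kappa> = 0} {\<kappa> \<in> ?T. ?V \<kappa> = v}"
    proof (rule bij_betwI[where g = "\<lambda>\<kappa>. \<kappa>(i := \<kappa> i + - (of_nat k * l))"])
      have mem: "\<kappa>(i := \<kappa> i + x) \<in> ?T" if "\<kappa> \<in> ?T" "x \<in> L i" for \<kappa> x
        using that i(1) La by (auto simp: PiE_iff extensional_def)
      have neg: "Tr (- (of_nat k * l) * \<delta> i) = - v" using kt[of k] k by (simp add: trace_minus)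
      show "(\<lambda>\<kappa>. \<kappa>(i := \<kappa> i + of_nat k * l)) \<in> {\<kappa> \<in> ?T. ?V \<kappa> = 0} \<rightarrow> {\<kappa> \<in> ?T. ?V \<kappa> = v}"
      proof
        fix \<kappa> assume "\<kappa> \<in> {\<kappa> \<in> ?T. ?V \<kappa> = 0}"
        then show "\<kappa>(i := \<kappa> i + of_nat k * l) \<in> {\<kappa> \<in> ?T. ?V \<kappa> = v}"
          using mem[OF _ Lk] upd[of \<kappa> "of_nat k * l"] kt[of k] k by simp
      qed
      show "(\<lambda>\<kappa>. \<kappa>(i := \<kappa> i + - (of_nat k * l))) \<in> {\<kappa> \<in> ?T. ?V \<kappa> = v} \<rightarrow> {\<kappa> \<in> ?T. ?V \<kappa> = 0}"
      proof
        fix \<kappa> assume "\<kappa> \<in> {\<kappa> \<in> ?T. ?V \<kappa> = v}"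
        then show "\<kappa>(i := \<kappa> i + - (of_nat k * l)) \<in> {\<kappa> \<in> ?T. ?V \<kappa> = 0}"
          using mem[OF _ Lm[OF Lk]] upd[of \<kappa> "- (of_nat k * l)"] neg by simp
      qed
    qed auto
    then show ?thesis by (simp add: bij_betw_same_card)
  qed
  have "card ?T = card (\<Union>v\<in>frob_fixed p. {\<kappa> \<in> ?T. ?V \<kappa> = v})"
    by (rule arg_cong[where f = card]) (auto simp: trace_fixed)
  also have "\<dots> = (\<Sum>v\<in>frob_fixed p. card {\<kappa> \<in> ?T. ?V \<kappa> = v})"
    by (rule card_UN_disjoint) (use fin in auto)
  also have "\<dots> = (\<Sum>v\<in>(frob_fixed p :: 'a set). card {\<kappa> \<in> ?T. ?V \<kappa> = 0})" by (rule sum.cong) (auto simp: fib)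
  finally show ?thesis by (simp add: card_fixed)
qed

text \<open>Coordinates below \<open>s\<close> are the square roots \<open>w i\<close>, and coordinate \<open>s\<close> is \<open>z\<close>. If there were no solution,
  each point of the curve would satisfy exactly \<open>1 / p\<close> of the trace conditions given by the tuples in the
  product of the \<open>L i\<close>; but the zero tuple gives a condition satisfied by all points, and each other
  one by about \<open>1 / p\<close> of them.\<close>

theorem exists_prescribed_traces:
  fixes L :: "nat \<Rightarrow> 'a set" and t :: "nat \<Rightarrow> 'a"
  assumes L: "\<And>i. i \<le> s \<Longrightarrow> 0 \<in> L i" "\<And>i x y. i \<le> s \<Longrightarrow> x \<in> L i \<Longrightarrow> y \<in> L i \<Longrightarrow> x - y \<in> L i"
    and B: "(\<Prod>i\<le>s. card (L i)) \<le> B" and odd: "p \<ge> 3"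
    and large: "r ^ 2 > 2 * B * (2 ^ s * (2 * s + 5 * A * r) + 5 * A * r)"
  shows "\<exists>z w. (\<forall>i<s. w i \<noteq> 0 \<and> w i ^ 2 = z ^ 2 + d i)
    \<and> (\<forall>l\<in>L s. Tr (l * (z - t s)) = 0) \<and> (\<forall>i<s. \<forall>l\<in>L i. Tr (l * (w i - t i)) = 0)"
proof (rule ccontr)
  assume no: "\<not> ?thesis"
  let ?Y = "Y (\<lambda>_. 1)" and ?T = "PiE {..s} L"
  define \<delta> where "\<delta> P i = (if i = s then fst P - t s else snd P i - t i)" for P :: "'a \<times> (nat \<Rightarrow> 'a)" and i
  define V where "V P \<kappa> = Tr (\<Sum>j\<le>s. \<kappa> j * \<delta> P j)" for P \<kappa>
  define E where "E = 2 ^ s * (2 * s + 5 * A * r) + 5 * A * r"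
  have finT: "finite ?T" by (intro finite_PiE) auto
  have cT: "card ?T = (\<Prod>i\<le>s. card (L i))" by (simp add: card_PiE)
  have eachP: "p * card {\<kappa> \<in> ?T. V P \<kappa> = 0} = card ?T" if P: "P \<in> ?Y" for P
  proof -
    obtain z w where zw: "P = (z, w)" by (cases P)
    have "\<forall>i<s. w i \<noteq> 0 \<and> w i ^ 2 = z ^ 2 + d i" using P unfolding zw Y_def by auto
    then have "\<not> ((\<forall>l\<in>L s. Tr (l * (z - t s)) = 0) \<and> (\<forall>i<s. \<forall>l\<in>L i. Tr (l * (w i - t i)) = 0))"
      using no by blast
    then consider l where "l \<in> L s" "Tr (l * (z - t s)) \<noteq> 0"
      | i l where "i < s" "l \<in> L i" "Tr (l * (w i - t i)) \<noteq> 0" by blast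
    then have "\<exists>i\<le>s. \<exists>l\<in>L i. Tr (l * \<delta> P i) \<noteq> 0"
    proof cases
      case 1 then show ?thesis unfolding \<delta>_def zw by (intro exI[of _ s]) auto
    next
      case 2 then show ?thesis unfolding \<delta>_def zw by (intro exI[of _ i]) auto
    qed
    then obtain i l where "i \<le> s" "l \<in> L i" "Tr (l * \<delta> P i) \<noteq> 0" by blast
    then show ?thesis unfolding V_def using test_count[of L i l "\<delta> P"] L by blast
  qed
  define z0 where "z0 = (\<lambda>i\<in>{..s}. 0 :: 'a)"
  have z0T: "z0 \<in> ?T" unfolding z0_def using L(1) by auto
  have V0: "V P z0 = 0" for P unfolding V_def z0_def by (simp add: trace_0)
  have other: "int p * int (card {P \<in> ?Y. V P \<kappa> = 0}) \<ge> int (r ^ 2) - int p * int E"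
    if l: "\<kappa> \<in> ?T - {z0}" for \<kappa>
  proof -
    have nz: "\<kappa> s \<noteq> 0 \<or> (\<exists>i<s. \<kappa> i \<noteq> 0)"
    proof (rule ccontr)
      assume "\<not> ?thesis"
      then have "\<kappa> i = z0 i" if "i \<le> s" for i using that unfolding z0_def by (auto simp: le_less)
      then have "\<kappa> = z0" using l z0T by (intro PiE_ext[of \<kappa> "{..s}" L z0]) auto
      then show False using l by simp
    qed
    define v where "v = Tr (\<kappa> s * t s + (\<Sum>i<s. \<kappa> i * t i))"
    have "(\<Sum>j\<le>s. \<kappa> j * \<delta> P j) = lin (\<kappa> s) \<kappa> P - (\<kappa> s * t s + (\<Sum>i<s. \<kappa> i * t i))" for P
    proof -
      have "(\<Sum>j\<le>s. \<kappa> j * \<delta> P j) = (\<Sum>j<s. \<kappa> j * \<delta> P j) + \<kappa> s * \<delta> P s"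
        by (simp add: lessThan_Suc_atMost[symmetric])
      also have "(\<Sum>j<s. \<kappa> j * \<delta> P j) = (\<Sum>j<s. \<kappa> j * snd P j) - (\<Sum>j<s. \<kappa> j * t j)"
        unfolding sum_subtractf[symmetric] by (rule sum.cong) (auto simp: \<delta>_def algebra_simps)
      finally show ?thesis unfolding lin_def \<delta>_def by (simp add: algebra_simps)
    qed
    then have "{P \<in> ?Y. V P \<kappa> = 0} = {P \<in> ?Y. Tr (lin (\<kappa> s) \<kappa> P) = v}"
      unfolding V_def v_def by (simp add: trace_diff)
    moreover have "v \<in> frob_fixed p" unfolding v_def by (rule trace_fixed)
    ultimately show ?thesis using card_trace_value_ge[OF nz, of v] unfolding E_def by simp
  qed
  have swap: "(\<Sum>\<kappa>\<in>?T. card {P \<in> ?Y. V P \<kappa> = 0}) = (\<Sum>P\<in>?Y. card {\<kappa> \<in> ?T. V P \<kappa> = 0})"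
  proof -
    have "(\<Sum>\<kappa>\<in>?T. card {P \<in> ?Y. V P \<kappa> = 0}) = (\<Sum>\<kappa>\<in>?T. \<Sum>P\<in>?Y. if V P \<kappa> = 0 then 1 else 0)"
      using finite_Y by (intro sum.cong refl) (simp add: sum.If_cases Int_def)
    also have "\<dots> = (\<Sum>P\<in>?Y. \<Sum>\<kappa>\<in>?T. if V P \<kappa> = 0 then 1 else 0)" by (rule sum.swap)
    also have "\<dots> = (\<Sum>P\<in>?Y. card {\<kappa> \<in> ?T. V P \<kappa> = 0})"
      using finT by (intro sum.cong refl) (simp add: sum.If_cases Int_def)
    finally show ?thesis .
  qed
  have "int (card ?T) * int (card ?Y) = (\<Sum>P\<in>?Y. int (p * card {\<kappa> \<in> ?T. V P \<kappa> = 0}))"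
    using eachP by simp
  also have "\<dots> = int p * (\<Sum>\<kappa>\<in>?T. int (card {P \<in> ?Y. V P \<kappa> = 0}))"
    using arg_cong[OF swap, of int] by (simp add: sum_distrib_left)
  also have "\<dots> = int p * int (card ?Y) + (\<Sum>\<kappa>\<in>?T - {z0}. int p * int (card {P \<in> ?Y. V P \<kappa> = 0}))"
    unfolding sum_distrib_left[symmetric] by (subst sum.remove[OF finT z0T]) (simp add: V0 distrib_left)
  also have "\<dots> \<ge> int p * int (card ?Y) + (\<Sum>\<kappa>\<in>?T - {z0}. int (r ^ 2) - int p * int E)"
    by (intro add_left_mono sum_mono other)
  also have "(\<Sum>\<kappa>\<in>?T - {z0}. int (r ^ 2) - int p * int E) = (int (card ?T) - 1) * (int (r ^ 2) - int p * int E)"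
  proof -
    have "card ?T \<ge> 1" using finT z0T by (metis One_nat_def Suc_leI card_gt_0_iff empty_iff)
    then show ?thesis using finT z0T by (simp add: card_Diff_singleton of_nat_diff)
  qed
  finally have main: "int (card ?T) * int (card ?Y) \<ge> int p * int (card ?Y) + (int (card ?T) - 1) * (int (r ^ 2) - int p * int E)" .
  have up: "int (card ?Y) \<le> int (r ^ 2) + int E"
  proof -
    have "card ?Y \<le> r ^ 2 + E" using card_Y_le[of "\<lambda>_. 1"] unfolding E_def by simp
    then show ?thesis by linarith
  qed
  have lo: "int (card ?Y) \<ge> int (r ^ 2) - int E"
  proof -
    have "int E = 2 ^ s * (2 * int s + 5 * int A * int r) + 5 * int A * int r" unfolding E_def by simp
    moreover have "0 \<le> 5 * int A * int r" by simp
    ultimately show ?thesis using card_Y_ge by linarith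
  qed
  define q where "q = int p" define \<tau> where "\<tau> = int (card ?T)" define y where "y = int (card ?Y)"
  define Q where "Q = int (r ^ 2)" define e where "e = int E"
  have b: "q \<ge> 3" "\<tau> \<ge> 0" "e \<ge> 0" "y \<le> Q + e" "y \<ge> Q - e" "\<tau> * y \<ge> q * y + (\<tau> - 1) * (Q - q * e)"
    using main up lo odd unfolding q_def \<tau>_def y_def Q_def e_def by auto
  have "\<tau> * y \<le> \<tau> * (Q + e)" using b by (intro mult_left_mono) auto
  moreover have "q * y \<ge> q * (Q - e)" using b by (intro mult_left_mono) auto
  ultimately have "(q - 1) * Q \<le> \<tau> * (q + 1) * e" using b(6) by (simp add: algebra_simps)
  \<comment> \<open>By \<open>q \<ge> 3\<close> the factor \<open>q + 1\<close> is at most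
    \<open>2 * (q - 1)\<close>; this is the origin of the factor 2 in \<open>large\<close>.\<close>
  also have "\<tau> * (q + 1) * e \<le> \<tau> * (2 * (q - 1)) * e" using b by (intro mult_right_mono mult_left_mono) auto
  finally have "(q - 1) * Q \<le> (q - 1) * (2 * \<tau> * e)" by (simp add: mult_ac)
  then have "Q \<le> 2 * \<tau> * e" using b(1) by simp
  then have "int (r ^ 2) \<le> int (2 * card ?T * E)" unfolding Q_def \<tau>_def e_def by simp
  then have "r ^ 2 \<le> 2 * card ?T * E" by (simp only: of_nat_le_iff)
  also have "\<dots> \<le> 2 * B * E" using B unfolding cT by (intro mult_right_mono) auto
  finally show False using large unfolding E_def by simp
qed

end

section \<open>Arcs built from translates of a parabola\<close>

text \<open>The error term in \<open>exists_prescribed_traces\<close> is at most \<open>r\<close>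
  times a constant. If \<open>r\<close> exceeds twice \<open>B\<close> times that constant, then
  \<open>large\<close> holds; \<open>B\<close> bounds the number of tuples of trace
  conditions.\<close>

definition curve_bound :: "nat \<Rightarrow> nat \<Rightarrow> nat \<Rightarrow> nat" where
  "curve_bound p s B = (let A = 2 ^ s * p * (2 * s + 2 * p + 1) + 1
     in 2 * B * (2 ^ s * (2 * s + 5 * A) + 5 * A))"

lemma curve_bound_mono: "s \<le> s' \<Longrightarrow> B \<le> B' \<Longrightarrow> curve_bound p s B \<le> curve_bound p s' B'"
  unfolding curve_bound_def Let_def by (intro mult_mono add_mono power_increasing) auto

lemma curve_bound_ge: "B \<le> curve_bound p s B"
proof -
  define A where "A = 2 ^ s * p * (2 * s + 2 * p + 1) + 1"
  have "B * 1 \<le> B * (2 * (2 ^ s * (2 * s + 5 * A) + 5 * A))"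
    by (rule mult_left_mono) (simp_all add: A_def)
  also have "\<dots> = curve_bound p s B" unfolding curve_bound_def A_def Let_def by simp
  finally show ?thesis by simp
qed

section \<open>Relative and absolute traces\<close>

locale trace_tower =
  fixes ty :: "'a::finite_field itself" and p M f h :: nat
  assumes p: "p = CHAR('a)" "p > 3" and M: "M = p ^ f" "f > 0" and CARD: "CARD('a) = (M ^ 2) ^ h"
begin

text \<open>Three subfields are used: the prime field for the Artin-Schreier covers, the field with
  \<open>M\<close> elements for the cosets, and \<open>F\<close> for the arc.\<close>

sublocale P: subfield_power ty p "2 * (f * h)" 1
  by unfold_locales (use p M CARD in \<open>auto simp: power_mult mult.commute simp flip: power_mult\<close>)

sublocale FM: subfield_power ty M "2 * h" f
  by unfold_locales (use p M CARD in \<open>auto simp flip: power_mult\<close>)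

sublocale FN: subfield_power ty "M ^ 2" h "2 * f"
  by unfold_locales (use p M CARD in \<open>auto simp: mult.commute simp flip: power_mult\<close>)

abbreviation F :: "'a set" where "F \<equiv> frob_fixed (M ^ 2)"
abbreviation tr :: "'a \<Rightarrow> 'a" where "tr \<equiv> trace (M ^ 2) h"
abbreviation Tr :: "'a \<Rightarrow> 'a" where "Tr \<equiv> trace p (2 * (f * h))"

lemma two_nonzero: "(2::'a) \<noteq> 0"
proof
  assume "(2::'a) = 0"
  then have "CHAR('a) dvd 2" using of_nat_eq_0_iff_char_dvd[of 2, where 'a = 'a] by simp
  then show False using p by (auto dest: dvd_imp_le)
qed

lemma Tr_power: "Tr (x ^ ((M ^ 2) ^ i)) = Tr x"
proof -
  have "Tr (x ^ (p ^ n)) = Tr x" for n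
    by (induction n) (simp_all add: P.trace_frob power_mult mult.commute[of p])
  then show ?thesis using M by (simp flip: power_mult)
qed

text \<open>\<open>Tr\<close> is invariant under Frobenius. With \<open>N = M ^ 2\<close>, the
  exponent \<open>N ^ i\<close> at \<open>z\<close> can therefore be traded for the exponent
  \<open>N ^ (h - i)\<close> at \<open>y\<close>.\<close>

lemma trace_adjoint: "Tr (tr z * y) = Tr (z * tr y)"
proof -
  have e: "z ^ ((M ^ 2) ^ i) * y = (z * y ^ ((M ^ 2) ^ (h - i))) ^ ((M ^ 2) ^ i)" if "i < h" for i
  proof -
    have "(y ^ ((M ^ 2) ^ (h - i))) ^ ((M ^ 2) ^ i) = y ^ ((M ^ 2) ^ (h - i + i))"
      by (simp only: power_mult power_add)
    also have "\<dots> = y" using that FN.power_card[of y] by simp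
    finally show ?thesis by (simp add: power_mult_distrib)
  qed
  have "Tr (tr z * y) = (\<Sum>i<h. Tr (z ^ ((M ^ 2) ^ i) * y))"
    unfolding trace_def[of "M ^ 2"] by (simp add: sum_distrib_right P.trace_sum)
  also have "\<dots> = (\<Sum>i<h. Tr (z * y ^ ((M ^ 2) ^ (h - i))))"
    by (rule sum.cong) (simp_all only: e lessThan_iff Tr_power)
  also have "\<dots> = Tr (z * (\<Sum>i<h. y ^ ((M ^ 2) ^ (h - i))))"
    by (simp add: sum_distrib_left P.trace_sum)
  \<comment> \<open>The exponents \<open>h - i\<close> run through 1 to \<open>h\<close>, a
    Frobenius shift of those in \<open>tr y\<close>.\<close>
  also have "(\<Sum>i<h. y ^ ((M ^ 2) ^ (h - i))) = (\<Sum>i<h. y ^ ((M ^ 2) ^ Suc (h - Suc i)))"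
    by (rule sum.cong) (auto simp: Suc_diff_Suc)
  also have "\<dots> = (\<Sum>i<h. y ^ ((M ^ 2) ^ Suc i))"
    by (rule sum.nat_diff_reindex)
  also have "\<dots> = tr (y ^ (M ^ 2))" unfolding trace_def by (simp add: power_mult)
  also have "\<dots> = tr y" by (rule FN.trace_frob)
  finally show ?thesis .
qed

text \<open>The point counts control only traces to the prime field, so conditions in
  \<open>F\<close> are reduced to these. A test element of the form \<open>tr (x / tr y)\<close> is
  moved to the other side by \<open>trace_adjoint\<close>.\<close>

lemma trace_eq_0I:
  assumes "\<And>a. a \<in> F \<Longrightarrow> Tr (a * y) = 0"
  shows "tr y = 0"
proof (rule ccontr)
  assume n: "tr y \<noteq> 0"
  obtain x where x: "Tr x = 1"
    using P.range_trace P.fixed_closed(2) by (metis imageE)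
  have "Tr (tr (x / tr y) * y) = 0" by (rule assms) (rule FN.trace_fixed)
  then show False unfolding trace_adjoint using n x by simp
qed

text \<open>Since the trace form is nondegenerate, any \<open>g\<close> outside the
  \<open>F\<close>-span of the earlier \<open>\<delta>\<close> can be added. The steps are those of
  orthogonalization: \<open>e\<close> is dual to the earlier \<open>\<delta>\<close>, and
  \<open>y'\<close> is orthogonal to them with \<open>tr (g * y') = 1\<close>.\<close>

lemma exists_dual_system:
  "d \<le> h \<Longrightarrow> \<exists>\<delta>. \<forall>v. (\<forall>i<d. v i \<in> F) \<longrightarrow> (\<exists>x. \<forall>i<d. tr (\<delta> i * x) = v i)"
proof (induction d)
  case (Suc d)
  then obtain \<delta> where \<delta>: "\<And>v. (\<forall>i<d. v i \<in> F) \<Longrightarrow> \<exists>x. \<forall>i<d. tr (\<delta> i * x) = v i" by auto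
  have "\<exists>x. \<forall>i<d. tr (\<delta> i * x) = (if i = j then 1 else 0)" for j
    by (rule \<delta>) (simp add: FN.fixed_closed)
  then obtain e where e: "\<And>i j. i < d \<Longrightarrow> tr (\<delta> i * e j) = (if i = j then 1 else 0)" by metis
  let ?span = "(\<lambda>c. \<Sum>j<d. c j * \<delta> j) ` ({..<d} \<rightarrow>\<^sub>E F)"
  have "card ?span \<le> card ({..<d} \<rightarrow>\<^sub>E F)" by (rule card_image_le) (auto intro: finite_PiE)
  also have "\<dots> = (M ^ 2) ^ d" by (simp add: card_PiE FN.card_fixed)
  also have "\<dots> < CARD('a)" unfolding CARD
    by (rule power_strict_increasing) (use Suc.prems FN.N_gt_1 in auto)
  finally have "?span \<noteq> UNIV" by auto
  then obtain g where g: "g \<notin> ?span" by auto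
  define g' where "g' = g - (\<Sum>j<d. tr (g * e j) * \<delta> j)"
  have "g' \<noteq> 0"
  proof
    assume "g' = 0"
    then have "g = (\<Sum>j<d. restrict (\<lambda>j. tr (g * e j)) {..<d} j * \<delta> j)" unfolding g'_def by simp
    moreover have "restrict (\<lambda>j. tr (g * e j)) {..<d} \<in> {..<d} \<rightarrow>\<^sub>E F" by (auto simp: FN.trace_fixed)
    ultimately have "g \<in> ?span" by blast
    then show False using g by simp
  qed
  obtain y0 where y0: "tr y0 = 1" using FN.range_trace FN.fixed_closed(2) by (metis imageE)
  define y where "y = y0 / g'"
  have y: "tr (g' * y) = 1" unfolding y_def using y0 \<open>g' \<noteq> 0\<close> by simp
  define y' where "y' = y - (\<Sum>j<d. tr (\<delta> j * y) * e j)"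
  have expand: "tr (c * y') = tr (c * y) - (\<Sum>j<d. tr (\<delta> j * y) * tr (c * e j))" for c
    unfolding y'_def right_diff_distrib sum_distrib_left FN.trace_diff FN.trace_sum
    by (simp add: mult.left_commute[of c] FN.trace_smult[OF FN.trace_fixed])
  have y'0: "tr (\<delta> i * y') = 0" if "i < d" for i
  proof -
    have "(\<Sum>j<d. tr (\<delta> j * y) * tr (\<delta> i * e j)) = (\<Sum>j<d. if i = j then tr (\<delta> j * y) else 0)"
      by (rule sum.cong) (use that in \<open>auto simp: e\<close>)
    then show ?thesis unfolding expand using that by simp
  qed
  have "tr (g' * y) = tr (g * y) - (\<Sum>j<d. tr (g * e j) * tr (\<delta> j * y))"
    unfolding g'_def left_diff_distrib sum_distrib_right FN.trace_diff FN.trace_sum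
    by (simp add: mult.assoc FN.trace_smult[OF FN.trace_fixed])
  then have y'1: "tr (g * y') = 1" unfolding expand using y by (simp add: mult.commute)
  show ?case
  proof (intro exI[of _ "\<delta>(d := g)"] allI impI)
    fix v :: "nat \<Rightarrow> 'a" assume v: "\<forall>i<Suc d. v i \<in> F"
    then obtain x where x: "\<forall>i<d. tr (\<delta> i * x) = v i" using \<delta>[of v] by auto
    define c where "c = v d - tr (g * x)"
    have c: "c \<in> F" unfolding c_def using v by (auto intro: FN.fixed_closed FN.trace_fixed)
    have "tr (b * (x + c * y')) = tr (b * x) + c * tr (b * y')" for b
      by (simp add: distrib_left FN.trace_add mult.left_commute[of b] FN.trace_smult[OF c])
    then have "\<forall>i<Suc d. tr ((\<delta>(d := g)) i * (x + c * y')) = v i"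
      using x y'0 y'1 by (auto simp: less_Suc_eq c_def)
    then show "\<exists>x. \<forall>i<Suc d. tr ((\<delta>(d := g)) i * x) = v i" by blast
  qed
qed auto

end

locale dual_system = trace_tower ty p M f h for ty :: "'a::finite_field itself" and p M f h +
  fixes d :: nat and \<delta> :: "nat \<Rightarrow> 'a"
  assumes d: "d > 0" and dual: "\<And>v. (\<And>i. i < d \<Longrightarrow> v i \<in> F) \<Longrightarrow> \<exists>x. \<forall>i<d. tr (\<delta> i * x) = v i"
begin

text \<open>Written as one weighted trace, \<open>\<phi> k\<close> is additive for every
  \<open>k\<close>, and its fibres can be counted. The polynomial form in \<open>k\<close> agrees
  with it for \<open>k\<close> in \<open>F\<close>.\<close>

definition \<phi> :: "'a \<Rightarrow> 'a \<Rightarrow> 'a" where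
  "\<phi> k x = tr ((\<Sum>i<d. k ^ i * \<delta> i) * x)"

lemma phi_eq: "k \<in> F \<Longrightarrow> \<phi> k x = (\<Sum>i<d. k ^ i * tr (\<delta> i * x))"
  unfolding \<phi>_def by (simp add: sum_distrib_right FN.trace_sum mult.assoc FN.trace_smult FN.fixed_closed)

lemma phi_add: "\<phi> k (x + y) = \<phi> k x + \<phi> k y"
  unfolding \<phi>_def by (simp add: distrib_left FN.trace_add)

lemma phi_diff: "\<phi> k (x - y) = \<phi> k x - \<phi> k y"
  unfolding \<phi>_def by (simp add: right_diff_distrib FN.trace_diff)

lemma phi_fixed: "\<phi> k x \<in> F"
  unfolding \<phi>_def by (rule FN.trace_fixed)

lemma weight_nonzero:
  assumes "k \<in> F" shows "(\<Sum>i<d. k ^ i * \<delta> i) \<noteq> 0"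
proof
  assume z: "(\<Sum>i<d. k ^ i * \<delta> i) = 0"
  obtain x where x: "\<forall>i<d. tr (\<delta> i * x) = (if i = 0 then 1 else 0)"
    using dual[of "\<lambda>i. if i = 0 then 1 else 0"] FN.fixed_closed(1,2) by (metis (full_types))
  have "\<phi> k x = (\<Sum>i<d. if i = 0 then 1 else 0)"
    unfolding phi_eq[OF assms] by (rule sum.cong) (use x in auto)
  then show False using d z unfolding \<phi>_def by (simp add: FN.trace_0)
qed

lemma phi_fiber:
  assumes "k \<in> F" "v \<in> F" shows "M ^ 2 * card {x. \<phi> k x = v} = CARD('a)"
  unfolding \<phi>_def by (rule FN.trace_eq_fixed_card[OF weight_nonzero[OF assms(1)] assms(2)])

lemma phi_surj:
  assumes "k \<in> F" "v \<in> F" shows "\<exists>x. \<phi> k x = v"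
proof (rule ccontr)
  assume "\<not> ?thesis"
  then have "{x. \<phi> k x = v} = {}" by auto
  then show False using phi_fiber[OF assms] by simp
qed

text \<open>All conditions are turned into traces to the prime field. Since \<open>e\<close> is not
  in \<open>K\<close>, the constants \<open>e - k\<close> are distinct and nonzero, as the curve
  requires.\<close>

lemma exists_square_roots:
  assumes K: "K \<subseteq> F" "e \<notin> K" and g: "\<And>i. i < d \<Longrightarrow> g i \<in> F" and g': "\<And>k. k \<in> K \<Longrightarrow> g' k \<in> F"
    and big: "M ^ h > curve_bound p (card K) ((M ^ 2) ^ (card K + d))"
  shows "\<exists>z w. (\<forall>k\<in>K. w k \<noteq> 0 \<and> w k ^ 2 = z ^ 2 + e - k \<and> \<phi> k (w k) = g' k) \<and> (\<forall>i<d. tr (\<delta> i * z) = g i)"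
proof -
  define s where "s = card K"
  obtain \<kappa> where \<kappa>: "bij_betw \<kappa> {..<s} K"
    using ex_bij_betw_nat_finite[of K] unfolding s_def by (auto simp: lessThan_atLeast0)
  define A where "A = 2 ^ s * p * (2 * s + 2 * p + 1) + 1"
  \<comment> \<open>One factor \<open>M ^ 2\<close> for each of the \<open>s\<close> square roots,
    and \<open>d\<close> of them for \<open>z\<close>.\<close>
  define B where "B = (M ^ 2) ^ (s + d)"
  define r where "r = M ^ h"
  define E where "E = 2 ^ s * (2 * s + 5 * A) + 5 * A"
  have \<kappa>K: "\<kappa> i \<in> K" if "i < s" for i using \<kappa> that by (auto simp: bij_betw_def)
  have r0: "r > 2 * B * E" using big unfolding r_def curve_bound_def s_def A_def B_def E_def Let_def by simp
  have B0: "B \<ge> 1" unfolding B_def by (rule one_le_power) (use FN.N_gt_1 in linarith)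
  have "2 * A + 1 \<le> 2 * 1 * (c + 5 * A)" for c using A_def by simp
  then have "2 * A + 1 \<le> 2 * 1 * E" unfolding E_def .
  also have "\<dots> \<le> 2 * B * E" by (rule mult_right_mono) (use B0 in auto)
  finally have rA: "r \<ge> 2 * A + 1" using r0 by simp
  interpret C: multiquadratic_curve s p "f * h" r A "\<lambda>i. e - \<kappa> i"
  proof unfold_locales
    show "inj_on (\<lambda>i. e - \<kappa> i) {..<s}" using \<kappa> by (auto simp: bij_betw_def inj_on_def)
    show "e - \<kappa> i \<noteq> 0" if "i < s" for i using \<kappa>K[OF that] K(2) by auto
    show "r = p ^ (f * h)" unfolding r_def M by (simp add: power_mult)
    show "CARD('a) = r ^ 2" unfolding r_def CARD by (simp add: mult.commute flip: power_mult)
  qed (use p two_nonzero A_def rA in auto)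
  \<comment> \<open>\<open>t0\<close> and \<open>T\<close> satisfy the conditions for each
    coordinate separately; differences from them are subject to homogeneous conditions.\<close>
  obtain t0 where t0: "\<forall>i<d. tr (\<delta> i * t0) = g i" using dual[of g] g by auto
  have "\<forall>k\<in>K. \<exists>x. \<phi> k x = g' k" using phi_surj K(1) g' by blast
  then obtain T where T: "\<And>k. k \<in> K \<Longrightarrow> \<phi> k (T k) = g' k" by metis
  \<comment> \<open>For \<open>z\<close> the tests range over the \<open>F\<close>-span of all
    \<open>\<delta> j\<close>, for a square root over the multiples of the weight in
    \<open>\<phi> (\<kappa> i)\<close>.\<close>
  define L where "L i = (if i = s then (\<lambda>a. \<Sum>j<d. a j * \<delta> j) ` ({..<d} \<rightarrow>\<^sub>E F)
    else (\<lambda>a. a * (\<Sum>j<d. \<kappa> i ^ j * \<delta> j)) ` F)" for i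
  define t where "t i = (if i = s then t0 else T (\<kappa> i))" for i
  have "\<exists>z w. (\<forall>i<s. w i \<noteq> 0 \<and> w i ^ 2 = z ^ 2 + (e - \<kappa> i))
    \<and> (\<forall>l\<in>L s. Tr (l * (z - t s)) = 0) \<and> (\<forall>i<s. \<forall>l\<in>L i. Tr (l * (w i - t i)) = 0)"
  proof (rule C.exists_prescribed_traces)
    fix i assume "i \<le> s"
    show "0 \<in> L i"
    proof (cases "i = s")
      case True
      have "0 = (\<Sum>j<d. restrict (\<lambda>_. 0) {..<d} j * \<delta> j)" by simp
      moreover have "restrict (\<lambda>_. 0) {..<d} \<in> {..<d} \<rightarrow>\<^sub>E F" by (auto intro: FN.fixed_closed)
      ultimately have "0 \<in> (\<lambda>a. \<Sum>j<d. a j * \<delta> j) ` ({..<d} \<rightarrow>\<^sub>E F)" by (rule image_eqI)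
      then show ?thesis unfolding L_def using True by simp
    next
      case False
      then show ?thesis unfolding L_def by (auto intro!: image_eqI[of _ _ 0] FN.fixed_closed)
    qed
    fix x y assume xy: "x \<in> L i" "y \<in> L i"
    show "x - y \<in> L i"
    proof (cases "i = s")
      case True
      obtain a b where ab: "a \<in> {..<d} \<rightarrow>\<^sub>E F" "b \<in> {..<d} \<rightarrow>\<^sub>E F" "x = (\<Sum>j<d. a j * \<delta> j)" "y = (\<Sum>j<d. b j * \<delta> j)"
        using xy unfolding L_def using True by auto
      have "x - y = (\<Sum>j<d. restrict (\<lambda>j. a j - b j) {..<d} j * \<delta> j)"
        unfolding ab by (simp add: left_diff_distrib sum_subtractf)
      moreover have "restrict (\<lambda>j. a j - b j) {..<d} \<in> {..<d} \<rightarrow>\<^sub>E F"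
        using ab by (auto intro: FN.fixed_closed)
      ultimately have "x - y \<in> (\<lambda>a. \<Sum>j<d. a j * \<delta> j) ` ({..<d} \<rightarrow>\<^sub>E F)" by (rule image_eqI)
      then show ?thesis unfolding L_def using True by simp
    next
      case False
      then show ?thesis using xy unfolding L_def
        by (auto simp: left_diff_distrib[symmetric] intro!: imageI FN.fixed_closed)
    qed
  next
    have c: "card (L i) \<le> (if i = s then (M ^ 2) ^ d else M ^ 2)" for i
    proof (cases "i = s")
      case True
      have "card (L i) \<le> card ({..<d} \<rightarrow>\<^sub>E F)" unfolding L_def using True by (auto intro!: card_image_le finite_PiE)
      then show ?thesis using True by (simp add: card_PiE FN.card_fixed)
    next
      case False
      have "card (L i) \<le> card F" unfolding L_def using False by (auto intro: card_image_le)
      then show ?thesis using False by (simp add: FN.card_fixed)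
    qed
    have "(\<Prod>i\<le>s. card (L i)) = (\<Prod>i<s. card (L i)) * card (L s)" by (simp flip: lessThan_Suc_atMost)
    also have "\<dots> \<le> (\<Prod>i<s. M ^ 2) * (M ^ 2) ^ d"
    proof (intro mult_mono prod_mono)
      show "card (L s) \<le> (M ^ 2) ^ d" using c[of s] by simp
      show "0 \<le> card (L i) \<and> card (L i) \<le> M ^ 2" if "i \<in> {..<s}" for i using c[of i] that by simp
    qed auto
    also have "\<dots> = B" unfolding B_def by (simp add: power_add)
    finally show "(\<Prod>i\<le>s. card (L i)) \<le> B" .
    show "p \<ge> 3" using p by simp
    have "2 ^ s * (2 * s + 5 * A * r) + 5 * A * r \<le> E * r"
    proof -
      have "s \<le> s * r" using rA by simp
      then have "2 ^ s * (2 * s) \<le> 2 ^ s * (2 * (s * r))" by simp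
      then show ?thesis unfolding E_def by (simp add: algebra_simps)
    qed
    then have "2 * B * (2 ^ s * (2 * s + 5 * A * r) + 5 * A * r) \<le> 2 * B * E * r" by simp
    also have "\<dots> < r ^ 2" unfolding power2_eq_square by (rule mult_strict_right_mono[OF r0]) (use rA in simp)
    finally show "r ^ 2 > 2 * B * (2 ^ s * (2 * s + 5 * A * r) + 5 * A * r)" .
  qed
  then obtain z w where w: "\<And>i. i < s \<Longrightarrow> w i \<noteq> 0 \<and> w i ^ 2 = z ^ 2 + (e - \<kappa> i)"
    and z: "\<And>l. l \<in> L s \<Longrightarrow> Tr (l * (z - t s)) = 0"
    and wt: "\<And>i l. i < s \<Longrightarrow> l \<in> L i \<Longrightarrow> Tr (l * (w i - t i)) = 0" by blast
  define w' where "w' k = w (inv_into {..<s} \<kappa> k)" for k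
  have w': "w' (\<kappa> i) = w i" if "i < s" for i
    unfolding w'_def using \<kappa> that by (simp add: bij_betw_def inv_into_f_f)
  have "w' k \<noteq> 0 \<and> w' k ^ 2 = z ^ 2 + e - k \<and> \<phi> k (w' k) = g' k" if k: "k \<in> K" for k
  proof -
    obtain i where i: "i < s" "k = \<kappa> i" using \<kappa> k by (auto simp: bij_betw_def)
    have "tr ((\<Sum>j<d. \<kappa> i ^ j * \<delta> j) * (w i - t i)) = 0"
    proof (rule trace_eq_0I)
      fix a assume "a \<in> F"
      then have "a * (\<Sum>j<d. \<kappa> i ^ j * \<delta> j) \<in> L i" unfolding L_def using i by auto
      from wt[OF i(1) this] show "Tr (a * ((\<Sum>j<d. \<kappa> i ^ j * \<delta> j) * (w i - t i))) = 0"
        by (simp add: mult.assoc)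
    qed
    then have "\<phi> k (w i) = \<phi> k (t i)" using phi_diff[of k "w i" "t i"] unfolding i(2) \<phi>_def by simp
    also have "\<dots> = g' k" unfolding t_def using i T[OF k] by auto
    finally show ?thesis using w[OF i(1)] w'[OF i(1)] i(2) by simp
  qed
  moreover have "tr (\<delta> i * z) = g i" if i: "i < d" for i
  proof -
    have "tr (\<delta> i * (z - t0)) = 0"
    proof (rule trace_eq_0I)
      fix a assume a: "a \<in> F"
      have "(\<Sum>j<d. restrict (\<lambda>j. if j = i then a else 0) {..<d} j * \<delta> j) = (\<Sum>j<d. if j = i then a * \<delta> i else 0)"
        by (rule sum.cong) auto
      also have "\<dots> = a * \<delta> i" using i by simp
      finally have "a * \<delta> i = (\<Sum>j<d. restrict (\<lambda>j. if j = i then a else 0) {..<d} j * \<delta> j)" ..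
      moreover have "restrict (\<lambda>j. if j = i then a else 0) {..<d} \<in> {..<d} \<rightarrow>\<^sub>E F"
        using a by (auto simp: FN.fixed_closed)
      ultimately have "a * \<delta> i \<in> (\<lambda>a. \<Sum>j<d. a j * \<delta> j) ` ({..<d} \<rightarrow>\<^sub>E F)" by blast
      then have "a * \<delta> i \<in> L s" unfolding L_def by simp
      from z[OF this] show "Tr (a * (\<delta> i * (z - t0))) = 0" unfolding t_def by (simp add: mult.assoc)
    qed
    then show ?thesis using t0 i by (simp add: right_diff_distrib FN.trace_diff)
  qed
  ultimately show ?thesis by blast
qed

end

section \<open>The arc and the lines that meet it\<close>

context dual_system
begin

definition parabola_arc :: "'a set \<Rightarrow> ('a \<times> 'a) set" where
  "parabola_arc K = {(x, x ^ 2 + k) | x k. k \<in> K \<and> \<phi> k x = - (k ^ d)}"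

lemma slice: "k \<in> K \<Longrightarrow> \<phi> k x = - (k ^ d) \<Longrightarrow> (x, x ^ 2 + k) \<in> parabola_arc K"
  unfolding parabola_arc_def by blast

lemma card_parabola_arc:
  assumes "K \<subseteq> F" shows "M ^ 2 * card (parabola_arc K) = card K * CARD('a)"
proof -
  have "parabola_arc K = (\<lambda>(k, x). (x, x ^ 2 + k)) ` (SIGMA k:K. {x. \<phi> k x = - (k ^ d)})"
    unfolding parabola_arc_def by force
  moreover have "inj_on (\<lambda>(k, x :: 'a). (x, x ^ 2 + k)) (SIGMA k:K. {x. \<phi> k x = - (k ^ d)})"
    by (auto intro!: inj_onI)
  ultimately have "card (parabola_arc K) = (\<Sum>k\<in>K. card {x. \<phi> k x = - (k ^ d)})"
    by (simp add: card_image)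
  then have "M ^ 2 * card (parabola_arc K) = (\<Sum>k\<in>K. M ^ 2 * card {x. \<phi> k x = - (k ^ d)})"
    by (simp add: sum_distrib_left)
  also have "\<dots> = (\<Sum>k\<in>K. CARD('a))"
    by (rule sum.cong) (use assms in \<open>auto intro!: phi_fiber FN.fixed_closed\<close>)
  finally show ?thesis by simp
qed

lemma vertical_line_le: "card {P \<in> parabola_arc K. fst P = c} \<le> card K"
proof -
  have "{P \<in> parabola_arc K. fst P = c} \<subseteq> (\<lambda>k. (c, c ^ 2 + k)) ` K" unfolding parabola_arc_def by auto
  then have "card {P \<in> parabola_arc K. fst P = c} \<le> card ((\<lambda>k. (c, c ^ 2 + k)) ` K)" by (intro card_mono) auto
  then show ?thesis using card_image_le[of K] by (meson finite le_trans)
qed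

text \<open>If both intersections \<open>x, y\<close> of a line of slope \<open>2 \<tau>\<close> with the parabola indexed by \<open>k\<close> are in
  the arc, then \<open>x + y = 2 \<tau>\<close> makes \<open>k\<close> a root of a monic polynomial of degree \<open>d\<close> depending
  only on \<open>\<tau>\<close>.\<close>

lemma line_le:
  assumes K: "K \<subseteq> F"
  shows "card {P \<in> parabola_arc K. snd P = 2 * \<tau> * fst P + u} \<le> card K + d"
proof -
  define I where "I k = {x. \<phi> k x = - (k ^ d) \<and> x ^ 2 + k = 2 * \<tau> * x + u}" for k
  define D where "D = {k \<in> K. \<phi> k \<tau> = - (k ^ d)}"
  have I: "card (I k) \<le> 1 + (if k \<in> D then 1 else 0)" if k: "k \<in> K" for k
  proof -
    have two: "y = x \<or> y = 2 * \<tau> - x" if "x \<in> I k" "y \<in> I k" for x y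
    proof -
      have "(y - x) * (y - (2 * \<tau> - x)) = (y ^ 2 + k - 2 * \<tau> * y) - (x ^ 2 + k - 2 * \<tau> * x)"
        by (simp add: algebra_simps power2_eq_square)
      also have "\<dots> = 0" using that unfolding I_def by simp
      finally show ?thesis by simp
    qed
    show ?thesis
    proof (cases "I k = {}")
      case False
      then obtain x where x: "x \<in> I k" by auto
      show ?thesis
      proof (cases "k \<in> D")
        case True
        have "card (I k) \<le> card {x, 2 * \<tau> - x}" by (rule card_mono) (use two[OF x] in auto)
        also have "\<dots> \<le> 2" by (simp add: card_insert_if)
        finally show ?thesis using True by simp
      next
        case False
        have "I k \<subseteq> {x}"
        proof
          fix y assume y: "y \<in> I k"
          show "y \<in> {x}"
          proof (rule ccontr)
            assume "y \<notin> {x}"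
            then have "y = 2 * \<tau> - x" using two[OF x y] by blast
            then have "\<tau> + \<tau> = x + y" by simp
            then have "\<phi> k \<tau> + \<phi> k \<tau> = - (k ^ d) + - (k ^ d)"
              using x y phi_add[of k \<tau> \<tau>] phi_add[of k x y] unfolding I_def by simp
            then have "2 * (\<phi> k \<tau> + k ^ d) = 0" by (simp add: algebra_simps)
            then have "\<phi> k \<tau> + k ^ d = 0" by (simp only: mult_eq_0_iff two_nonzero simp_thms)
            then have "\<phi> k \<tau> = - (k ^ d)" by (rule eq_neg_iff_add_eq_0[THEN iffD2])
            then show False using False k unfolding D_def by blast
          qed
        qed
        then have "card (I k) \<le> card {x}" by (intro card_mono) auto
        then show ?thesis by simp
      qed
    qed simp
  qed
  have "card D \<le> d"
  proof -
    define q where "q = monom 1 d + (\<Sum>i<d. monom (tr (\<delta> i * \<tau>)) i)"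
    have "coeff q d = 1" unfolding q_def by (simp add: coeff_sum)
    then have q0: "q \<noteq> 0" by auto
    have dq: "degree q \<le> d" unfolding q_def
      by (intro degree_add_le degree_sum_le) (auto intro: order.trans[OF degree_monom_le])
    have "D \<subseteq> {k. poly q k = 0}"
    proof
      fix k assume "k \<in> D"
      then have "k \<in> F" "\<phi> k \<tau> = - (k ^ d)" unfolding D_def using K by auto
      then show "k \<in> {k. poly q k = 0}"
        using phi_eq[of k \<tau>] by (simp add: q_def poly_sum poly_monom mult.commute)
    qed
    then have "card D \<le> card {k. poly q k = 0}" by (intro card_mono) auto
    then show ?thesis using card_poly_roots_bound[OF q0] dq by simp
  qed
  have "{P \<in> parabola_arc K. snd P = 2 * \<tau> * fst P + u} \<subseteq> (\<lambda>(k, x). (x, x ^ 2 + k)) ` (SIGMA k:K. I k)"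
    unfolding parabola_arc_def I_def by force
  then have "card {P \<in> parabola_arc K. snd P = 2 * \<tau> * fst P + u}
      \<le> card ((\<lambda>(k, x). (x, x ^ 2 + k)) ` (SIGMA k:K. I k))" by (intro card_mono) auto
  also have "\<dots> \<le> card (SIGMA k:K. I k)" by (rule card_image_le) simp
  also have "\<dots> = (\<Sum>k\<in>K. card (I k))" by simp
  also have "\<dots> \<le> (\<Sum>k\<in>K. 1 + (if k \<in> D then 1 else 0))" by (rule sum_mono) (rule I)
  also have "\<dots> = card K + card D"
  proof -
    have "K \<inter> D = D" unfolding D_def by auto
    then have "(\<Sum>k\<in>K. if k \<in> D then 1 else 0) = card D" by (simp add: sum.If_cases)
    then show ?thesis unfolding sum.distrib by simp
  qed
  finally show ?thesis using \<open>card D \<le> d\<close> by simp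
qed

text \<open>The point \<open>(a, a\<^sup>2 + e)\<close> lies off the arc; if \<open>e \<in> K\<close> it lies on one of the parabolas used,
  and the product condition puts the second intersection of the line with that parabola into the arc.\<close>

lemma exists_full_line:
  assumes K: "K \<subseteq> F" and D: "D \<subseteq> K - {e}" "card D = d"
    and e: "e \<in> K \<Longrightarrow> 2 * (\<Prod>k\<in>D. e - k) = \<phi> e a + e ^ d"
    and big: "M ^ h > curve_bound p (card K) ((M ^ 2) ^ (card K + d))"
  shows "\<exists>\<tau>. card {P \<in> parabola_arc K. snd P = 2 * \<tau> * (fst P - a) + (a ^ 2 + e)} \<ge> card K + d"
proof -
  define K' where "K' = K - {e}"
  \<comment> \<open>The slope will satisfy \<open>\<phi> k \<tau> + k ^ d = poly q k\<close>, so the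
    parabolas in \<open>D\<close> become the ones met twice.\<close>
  define q where "q = (\<Prod>k\<in>D. [:- k, 1:])"
  have mq: "degree q = d" "coeff q d = 1"
  proof -
    show dg: "degree q = d" unfolding q_def by (subst degree_prod_eq_sum_degree) (use D in auto)
    have "lead_coeff q = 1" unfolding q_def by (simp add: lead_coeff_prod)
    then show "coeff q d = 1" using dg by simp
  qed
  have cF: "coeff q i \<in> F" for i
  proof -
    have "\<forall>i. coeff (\<Prod>k\<in>D. [:- k, 1:]) i \<in> F"
    proof -
      have "finite D" by simp
      then have "D \<subseteq> F \<Longrightarrow> \<forall>i. coeff (\<Prod>k\<in>D. [:- k, 1:]) i \<in> F"
      proof (induction D rule: finite_induct)
        case empty
        then show ?case by (simp add: coeff_1 FN.fixed_closed)
      next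
        case (insert k D)
        then have c: "k \<in> F" "\<And>i. coeff (\<Prod>k\<in>D. [:- k, 1:]) i \<in> F" by auto
        have "coeff ([:- k, 1:] * r) i = (case i of 0 \<Rightarrow> 0 | Suc j \<Rightarrow> coeff r j) - k * coeff r i" for r i
          by (cases i) simp_all
        then have "coeff ([:- k, 1:] * (\<Prod>k\<in>D. [:- k, 1:])) i \<in> F" for i
          using c by (cases i) (auto simp only: nat.case intro!: FN.fixed_closed)
        then show ?case unfolding prod.insert[OF insert.hyps] by blast
      qed
      then show ?thesis using D K by blast
    qed
    then show ?thesis unfolding q_def by blast
  qed
  have qp: "poly q k = (\<Sum>i<d. k ^ i * coeff q i) + k ^ d" for k
    unfolding poly_altdef mq(1) using mq(2) by (simp add: mult.commute flip: lessThan_Suc_atMost)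
  have qF: "poly q k \<in> F" if "k \<in> F" for k
    unfolding qp by (intro FN.fixed_closed FN.fixed_sum that cF)
  have "curve_bound p (card K') ((M ^ 2) ^ (card K' + d)) \<le> curve_bound p (card K) ((M ^ 2) ^ (card K + d))"
  proof -
    have "card K' \<le> card K" unfolding K'_def by (rule card_mono) auto
    then show ?thesis using FN.N_gt_1 by (intro curve_bound_mono power_increasing) auto
  qed
  then have big': "M ^ h > curve_bound p (card K') ((M ^ 2) ^ (card K' + d))" using big by simp
  \<comment> \<open>The value \<open>- poly q k\<close> puts the point with abscissa
    \<open>\<tau> + w k\<close> into the arc. The parabola of \<open>e\<close> is left out, as the
    line meets it at abscissa \<open>a\<close> already.\<close>
  have "\<exists>z w. (\<forall>k\<in>K'. w k \<noteq> 0 \<and> w k ^ 2 = z ^ 2 + e - k \<and> \<phi> k (w k) = - poly q k)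
      \<and> (\<forall>i<d. tr (\<delta> i * z) = coeff q i - tr (\<delta> i * a))"
    by (rule exists_square_roots[OF _ _ _ _ big'])
      (use K in \<open>auto simp: K'_def intro!: FN.fixed_closed qF cF FN.trace_fixed\<close>)
  then obtain z w where w: "\<And>k. k \<in> K' \<Longrightarrow> w k \<noteq> 0 \<and> w k ^ 2 = z ^ 2 + e - k \<and> \<phi> k (w k) = - poly q k"
    and z: "\<And>i. i < d \<Longrightarrow> tr (\<delta> i * z) = coeff q i - tr (\<delta> i * a)" by blast
  define \<tau> where "\<tau> = a + z"
  have phit: "\<phi> k \<tau> = poly q k - k ^ d" if "k \<in> F" for k
  proof -
    have "\<phi> k \<tau> = (\<Sum>i<d. k ^ i * coeff q i)"
      unfolding phi_eq[OF that] by (rule sum.cong) (simp_all add: \<tau>_def distrib_left FN.trace_add z)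
    then show ?thesis unfolding qp by simp
  qed
  let ?S = "{P \<in> parabola_arc K. snd P = 2 * \<tau> * (fst P - a) + (a ^ 2 + e)}"
  \<comment> \<open>The two intersections with the parabola of \<open>e\<close> have abscissas
    \<open>a\<close> and \<open>2 * \<tau> - a\<close>.\<close>
  define x where "x k = (if k = e then 2 * \<tau> - a else \<tau> + w k)" for k
  have on: "(\<tau> + v) ^ 2 + k = 2 * \<tau> * (\<tau> + v - a) + (a ^ 2 + e)" if "v ^ 2 = z ^ 2 + e - k" for v k
    using that unfolding \<tau>_def by (simp add: algebra_simps power2_eq_square)
  have inS: "(v, v ^ 2 + k) \<in> ?S"
    if "k \<in> K" "\<phi> k v = - (k ^ d)" "v ^ 2 + k = 2 * \<tau> * (v - a) + (a ^ 2 + e)" for v k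
    using slice[OF that(1,2)] that(3) by (simp only: mem_Collect_eq fst_conv snd_conv simp_thms)
  have A1: "(x k, x k ^ 2 + k) \<in> ?S" if k: "k \<in> K" for k
  proof (cases "k = e")
    case True
    have "poly q e = (\<Prod>k\<in>D. e - k)" unfolding q_def poly_prod by simp
    then have "2 * poly q e = \<phi> e a + e ^ d" using e k True by simp
    moreover have "\<phi> e \<tau> = poly q e - e ^ d" using phit k K True by blast
    moreover have "\<phi> e (2 * \<tau> - a) = 2 * \<phi> e \<tau> - \<phi> e a"
      using phi_diff[of e "2 * \<tau>" a] phi_add[of e \<tau> \<tau>] by (simp flip: mult_2)
    ultimately have "\<phi> e (2 * \<tau> - a) = (\<phi> e a + e ^ d) - 2 * e ^ d - \<phi> e a"
      by (simp add: right_diff_distrib)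
    then have "\<phi> e (2 * \<tau> - a) = - (e ^ d)" by simp
    moreover have "(2 * \<tau> - a) ^ 2 + e = 2 * \<tau> * ((2 * \<tau> - a) - a) + (a ^ 2 + e)"
      by (simp add: algebra_simps power2_eq_square)
    ultimately have "(2 * \<tau> - a, (2 * \<tau> - a) ^ 2 + e) \<in> ?S" using k True by (intro inS) simp_all
    then show ?thesis unfolding x_def using True by (simp only: if_True refl)
  next
    case False
    then have k': "k \<in> K'" using k unfolding K'_def by simp
    have "k \<in> F" using k K by blast
    then have "\<phi> k (\<tau> + w k) = - (k ^ d)" unfolding phi_add phit[OF \<open>k \<in> F\<close>] using w[OF k'] by simp
    moreover have "w k ^ 2 = z ^ 2 + e - k" using w[OF k'] by blast
    ultimately have "(\<tau> + w k, (\<tau> + w k) ^ 2 + k) \<in> ?S" by (intro inS[OF k] on)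
    then show ?thesis unfolding x_def using False by (simp only: if_False)
  qed
  \<comment> \<open>For \<open>k\<close> in \<open>D\<close> the value \<open>\<phi> k (w k)\<close>
    is 0, so the opposite root also gives a point of the arc.\<close>
  have A2: "(\<tau> - w k, (\<tau> - w k) ^ 2 + k) \<in> ?S" if k: "k \<in> D" for k
  proof -
    have k': "k \<in> K'" "k \<in> K" "k \<in> F" using k D K unfolding K'_def by auto
    have "poly q k = 0" unfolding q_def poly_prod using k by (auto simp: prod_zero_iff)
    then have "\<phi> k (\<tau> - w k) = - (k ^ d)" unfolding phi_diff phit[OF k'(3)] using w[OF k'(1)] by simp
    moreover have "(- w k) ^ 2 = z ^ 2 + e - k" using w[OF k'(1)] by simp
    from on[OF this] have "(\<tau> - w k) ^ 2 + k = 2 * \<tau> * (\<tau> - w k - a) + (a ^ 2 + e)" by simp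
    ultimately show ?thesis by (intro inS[OF k'(2)])
  qed
  define g1 where "g1 = (\<lambda>k. (x k, x k ^ 2 + k))"
  define g2 where "g2 = (\<lambda>k. (\<tau> - w k, (\<tau> - w k) ^ 2 + k))"
  have "g1 k \<noteq> g2 k'" if "k' \<in> D" for k k'
  proof
    assume g: "g1 k = g2 k'"
    then have "k = k'" unfolding g1_def g2_def by auto
    moreover have "k' \<in> K'" "k' \<noteq> e" using that D unfolding K'_def by auto
    ultimately have "\<tau> + w k' = \<tau> - w k'" using g unfolding g1_def g2_def x_def by auto
    then have "2 * w k' = 0" by (simp add: eq_diff_eq)
    then show False using two_nonzero w[OF \<open>k' \<in> K'\<close>] by simp
  qed
  then have "g1 ` K \<inter> g2 ` D = {}" by blast
  moreover have "inj_on g1 K" "inj_on g2 D" unfolding g1_def g2_def by (auto intro!: inj_onI)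
  ultimately have "card (g1 ` K \<union> g2 ` D) = card K + d"
    by (subst card_Un_disjoint) (use D in \<open>auto simp: card_image\<close>)
  moreover have "g1 ` K \<union> g2 ` D \<subseteq> ?S" using A1 A2 unfolding g1_def g2_def by blast
  then have "card (g1 ` K \<union> g2 ` D) \<le> card ?S" by (intro card_mono) auto
  ultimately have "card ?S \<ge> card K + d" by simp
  then show ?thesis by (rule exI)
qed

end

section \<open>Unions of cosets and prescribed products\<close>

context trace_tower
begin

text \<open>An element outside the field with \<open>M\<close> elements is linearly independent of 1
  over it.\<close>

lemma coset_unique:
  fixes \<rho> :: 'a
  assumes \<rho>: "\<rho> \<notin> frob_fixed M"
    and G: "i \<in> frob_fixed M" "u \<in> frob_fixed M" "i' \<in> frob_fixed M" "u' \<in> frob_fixed M"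
    and eq: "i * \<rho> + u = i' * \<rho> + u'"
  shows "i = i'" "u = u'"
proof -
  show ii: "i = i'"
  proof (rule ccontr)
    assume n: "i \<noteq> i'"
    have "(i - i') * \<rho> = u' - u" using eq by (simp add: algebra_simps)
    then have "\<rho> = (u' - u) / (i - i')" using n by (simp add: nonzero_eq_divide_eq mult.commute)
    moreover have "(u' - u) / (i - i') \<in> frob_fixed M" by (intro FM.fixed_closed G)
    ultimately have "\<rho> \<in> frob_fixed M" by (simp only:)
    then show False using \<rho> by simp
  qed
  then show "u = u'" using eq by simp
qed

lemma inj_coset:
  fixes \<rho> :: 'a
  assumes "\<rho> \<notin> frob_fixed M" "J \<subseteq> frob_fixed M"
  shows "inj_on (\<lambda>(i, u). i * \<rho> + u) (J \<times> frob_fixed M)"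
proof (rule inj_onI, clarify)
  fix i u i' u' assume "i \<in> J" "u \<in> frob_fixed M" "i' \<in> J" "u' \<in> frob_fixed M" "i * \<rho> + u = i' * \<rho> + u'"
  then show "i = i' \<and> u = u'" using coset_unique[OF assms(1), of i u i' u'] assms(2) by blast
qed

lemma card_F: "card F = M * M"
  using FN.card_fixed by (simp only: power2_eq_square)

lemma range_coset:
  assumes \<rho>: "\<rho> \<in> F" "\<rho> \<notin> frob_fixed M"
  shows "(\<lambda>(i, u). i * \<rho> + u) ` (frob_fixed M \<times> frob_fixed M) = F"
proof (rule card_subset_eq)
  have "x \<in> F" if "x \<in> frob_fixed M" for x
    using that unfolding frob_fixed_def power2_eq_square mem_Collect_eq power_mult by (simp only:)
  then have sub: "frob_fixed M \<subseteq> F" by blast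
  show "(\<lambda>(i, u). i * \<rho> + u) ` (frob_fixed M \<times> frob_fixed M) \<subseteq> F"
  proof clarify
    fix i u :: 'a assume "i \<in> frob_fixed M" "u \<in> frob_fixed M"
    then show "i * \<rho> + u \<in> F" using sub \<rho> by (intro FN.fixed_closed(3,5)) auto
  qed
  show "card ((\<lambda>(i, u). i * \<rho> + u) ` (frob_fixed M \<times> frob_fixed M)) = card F"
    unfolding card_image[OF inj_coset[OF \<rho>(2) order.refl]] card_F by (simp add: FM.card_fixed)
qed simp

definition cosets :: "'a \<Rightarrow> 'a set \<Rightarrow> 'a set" where
  "cosets \<rho> J = (\<lambda>(i, u). i * \<rho> + u) ` (J \<times> frob_fixed M)"

lemma card_cosets:
  assumes \<rho>: "\<rho> \<in> F" "\<rho> \<notin> frob_fixed M" and J: "J \<subseteq> frob_fixed M"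
  shows "card (cosets \<rho> J) = card J * M"
  unfolding cosets_def card_image[OF inj_coset[OF \<rho>(2) J]] by (simp add: card_cartesian_product FM.card_fixed)

lemma cosets_subset:
  assumes "\<rho> \<in> F" "\<rho> \<notin> frob_fixed M" "J \<subseteq> frob_fixed M"
  shows "cosets \<rho> J \<subseteq> F"
  using range_coset[OF assms(1,2)] assms(3) unfolding cosets_def by blast

text \<open>All but two of the factors \<open>e - k\<close> are chosen outside the coset of \<open>e\<close> and one further coset;
  the last two, taken from these cosets, adjust the product.\<close>

lemma exists_prescribed_product:
  assumes \<rho>: "\<rho> \<in> F" "\<rho> \<notin> frob_fixed M" and J: "J \<subseteq> frob_fixed M" "card J \<ge> 2"
    and d: "2 \<le> d" "d \<le> 2 + (card J - 2) * M" and e: "e \<in> cosets \<rho> J" and \<beta>: "\<beta> \<in> F" "\<beta> \<noteq> 0"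
  shows "\<exists>D\<subseteq>cosets \<rho> J - {e}. card D = d \<and> (\<Prod>k\<in>D. e - k) = \<beta>"
proof -
  let ?G = "frob_fixed M :: 'a set"
  obtain i0 u0 where i0: "i0 \<in> J" "u0 \<in> ?G" "e = i0 * \<rho> + u0" using e unfolding cosets_def by auto
  have "\<not> J \<subseteq> {i0}" using J(2) card_mono[of "{i0}" J] by auto
  then obtain i1 where i1: "i1 \<in> J" "i1 \<noteq> i0" by blast
  have G: "i0 \<in> ?G" "i1 \<in> ?G" using i0 i1 J by auto
  define J' where "J' = J - {i0, i1}"
  have J': "J' \<subseteq> ?G" "card J' = card J - 2" using i0 i1 J unfolding J'_def by (auto simp: card_Diff_subset)
  have "d - 2 \<le> card (cosets \<rho> J')" using d J' by (simp add: card_cosets[OF \<rho>])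
  then obtain D0 where D0: "D0 \<subseteq> cosets \<rho> J'" "card D0 = d - 2" by (rule obtain_subset_with_card_n) auto
  have notin: "i * \<rho> + u \<notin> D0" if "u \<in> ?G" "i \<in> ?G" "i \<notin> J'" for i u
  proof
    assume "i * \<rho> + u \<in> D0"
    then obtain i' u' where i': "i' \<in> J'" "u' \<in> ?G" "i * \<rho> + u = i' * \<rho> + u'"
      using D0(1) unfolding cosets_def by auto
    then show False using coset_unique(1)[OF \<rho>(2) that(2,1) _ i'(2,3)] J'(1) that(3) by blast
  qed
  have "i0 \<notin> J'" "i1 \<notin> J'" unfolding J'_def by auto
  note notin = notin[OF _ G(1) this(1)] notin[OF _ G(2) this(2)]
  have D0K: "D0 \<subseteq> cosets \<rho> J" using D0(1) unfolding cosets_def J'_def by auto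
  have eF: "e \<in> F" using e cosets_subset[OF \<rho> J(1)] by auto
  define \<pi> where "\<pi> = (\<Prod>k\<in>D0. e - k)"
  have \<pi>: "\<pi> \<noteq> 0" "\<pi> \<in> F"
  proof -
    show "\<pi> \<noteq> 0" unfolding \<pi>_def using notin(1)[OF i0(2)] i0(3) by (auto simp: prod_zero_iff)
    show "\<pi> \<in> F" unfolding \<pi>_def
      by (rule FN.fixed_prod) (use eF D0K cosets_subset[OF \<rho> J(1)] in \<open>auto intro: FN.fixed_closed\<close>)
  qed
  define \<gamma> where "\<gamma> = \<beta> / \<pi>"
  have \<gamma>: "\<gamma> \<in> F" "\<gamma> \<noteq> 0" unfolding \<gamma>_def using \<beta> \<pi> by (auto intro: FN.fixed_closed)
  have "\<exists>k k'. k \<noteq> k' \<and> k \<in> cosets \<rho> J - {e} - D0 \<and> k' \<in> cosets \<rho> J - {e} - D0 \<and> (e - k) * (e - k') = \<gamma>"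
  proof -
    obtain x y where xy: "x \<in> ?G" "y \<in> ?G" "\<gamma> = x * \<rho> + y"
      using \<gamma>(1) unfolding range_coset[OF \<rho>, symmetric] by auto
    have in0: "i0 * \<rho> + u \<in> cosets \<rho> J" "i1 * \<rho> + u \<in> cosets \<rho> J" if "u \<in> ?G" for u
      using i0 i1 that unfolding cosets_def by auto
    show ?thesis
    proof (cases "x = 0")
      case False
      \<comment> \<open>The factors will be \<open>c\<close> and
        \<open>(i0 - i1) * \<rho> + u0 - v\<close>. Comparing their product with
        \<open>x * \<rho> + y\<close> determines \<open>c\<close> and then \<open>v\<close>.\<close>
      define c where "c = x / (i0 - i1)"
      have c: "c \<in> ?G" "c \<noteq> 0" unfolding c_def using xy G i1 False by (auto intro!: FM.fixed_closed)
      define v where "v = u0 - y / c"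
      have v: "v \<in> ?G" unfolding v_def using c xy i0 by (auto intro!: FM.fixed_closed)
      have u: "u0 - c \<in> ?G" using c i0 by (auto intro!: FM.fixed_closed)
      have ne: "i0 * \<rho> + w \<noteq> i1 * \<rho> + w'" if "w \<in> ?G" "w' \<in> ?G" for w w'
        using coset_unique(1)[OF \<rho>(2) G(1) that(1) G(2) that(2)] i1 by blast
      have "c * (i0 - i1) = x" unfolding c_def using i1 by simp
      then have "c * ((i0 - i1) * \<rho> + y / c) = \<gamma>" using c(2) by (simp add: distrib_left xy(3) flip: mult.assoc)
      then have "(e - (i0 * \<rho> + (u0 - c))) * (e - (i1 * \<rho> + v)) = \<gamma>"
        unfolding i0(3) v_def by (simp add: algebra_simps)
      moreover have "i0 * \<rho> + (u0 - c) \<in> cosets \<rho> J - {e} - D0" "i1 * \<rho> + v \<in> cosets \<rho> J - {e} - D0"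
        using in0 u v notin c(2) ne[OF i0(2) v] unfolding i0(3) by auto
      ultimately show ?thesis using ne[OF u v] by blast
    next
      case True
      \<comment> \<open>Now \<open>\<gamma>\<close> lies in the small field, and both factors come
        from the coset of \<open>e\<close>. They must be nonzero and distinct, which excludes at
        most three values of \<open>c\<close>; hence the use of \<open>M > 3\<close>.\<close>
      then have g: "\<gamma> \<in> ?G" using xy by simp
      have "card {c. c ^ 2 = \<gamma>} \<le> 2"
      proof -
        have "card {c. poly (monom 1 2 - [:\<gamma>:]) c = 0} \<le> degree (monom 1 2 - [:\<gamma>:])"
        proof (rule card_poly_roots_bound)
          have "coeff [:\<gamma>:] 2 = 0" by (rule coeff_eq_0) simp
          then have "coeff (monom 1 2 - [:\<gamma>:]) 2 = 1" by simp
          then show "monom 1 2 - [:\<gamma>:] \<noteq> 0" by (metis coeff_0 zero_neq_one)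
        qed
        moreover have "degree (monom 1 2 - [:\<gamma>:]) \<le> 2"
          by (rule degree_diff_le) (simp_all add: degree_monom_le)
        ultimately show ?thesis by (simp add: poly_monom)
      qed
      then have "card ({0} \<union> {c. c ^ 2 = \<gamma>}) \<le> 3" using card_Un_le[of "{0}" "{c. c ^ 2 = \<gamma>}"] by simp
      moreover have "M > 3"
      proof -
        have "p ^ 1 \<le> M" unfolding M using p M by (intro power_increasing) auto
        then show ?thesis using p by simp
      qed
      ultimately have "\<not> ?G \<subseteq> {0} \<union> {c. c ^ 2 = \<gamma>}"
        using card_mono[of "{0} \<union> {c. c ^ 2 = \<gamma>}" ?G] FM.card_fixed by auto
      then obtain c where c: "c \<in> ?G" "c \<noteq> 0" "c ^ 2 \<noteq> \<gamma>" by auto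
      define c' where "c' = \<gamma> / c"
      have c': "c' \<in> ?G" "c' \<noteq> 0" "c * c' = \<gamma>"
        unfolding c'_def using c g \<gamma>(2) by (auto intro: FM.fixed_closed)
      have cc': "c \<noteq> c'" using c(3) c'(3) by (auto simp: power2_eq_square)
      have u: "u0 - c \<in> ?G" "u0 - c' \<in> ?G" using c c' i0 by (auto intro!: FM.fixed_closed)
      have "(e - (i0 * \<rho> + (u0 - c))) * (e - (i0 * \<rho> + (u0 - c'))) = \<gamma>"
        unfolding i0(3) using c'(3) by simp
      moreover have "i0 * \<rho> + (u0 - c) \<in> cosets \<rho> J - {e} - D0" "i0 * \<rho> + (u0 - c') \<in> cosets \<rho> J - {e} - D0"
        using in0 u notin c(2) c'(2) unfolding i0(3) by auto
      moreover have "i0 * \<rho> + (u0 - c) \<noteq> i0 * \<rho> + (u0 - c')" using cc' by simp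
      ultimately show ?thesis by blast
    qed
  qed
  then obtain k k' where k: "k \<noteq> k'" "k \<in> cosets \<rho> J - {e} - D0" "k' \<in> cosets \<rho> J - {e} - D0"
    "(e - k) * (e - k') = \<gamma>" by blast
  have "card (insert k (insert k' D0)) = d" using k D0(2) d(1) by simp
  moreover have "(\<Prod>x\<in>insert k (insert k' D0). e - x) = \<beta>"
    using k \<pi>(1) by (simp add: \<gamma>_def flip: \<pi>_def mult.assoc)
  moreover have "insert k (insert k' D0) \<subseteq> cosets \<rho> J - {e}"
    using k D0K notin(1)[OF i0(2)] i0(3) by auto
  ultimately show ?thesis by blast
qed

theorem exists_affine_arc:
  assumes j: "2 \<le> j" "j \<le> M" and d: "2 \<le> d" "d \<le> 2 + (j - 2) * M" and m: "m = j * M + d"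
    and big: "M ^ h > curve_bound p m ((M ^ 2) ^ m)"
  shows "\<exists>S :: ('a \<times> 'a) set. M * card S = j * CARD('a)
    \<and> (\<forall>\<alpha> u. card {P \<in> S. snd P = \<alpha> * fst P + u} \<le> m) \<and> (\<forall>c. card {P \<in> S. fst P = c} \<le> m)
    \<and> (\<forall>a b. (a, b) \<notin> S \<longrightarrow> (\<exists>\<alpha>. card {P \<in> S. snd P = \<alpha> * (fst P - a) + b} \<ge> m))"
proof -
  have M2: "M \<ge> 2" using FM.N_gt_1 by simp
  \<comment> \<open>The threshold contains \<open>(M ^ 2) ^ m\<close>, so it also ensures
    \<open>d \<le> h\<close>, that is, room for \<open>d\<close> independent elements over
    \<open>F\<close>.\<close>
  have "m \<le> h"
  proof (rule ccontr)
    assume "\<not> m \<le> h"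
    then have "M ^ h \<le> (M ^ 2) ^ m" using M2 by (simp add: power_increasing flip: power_mult)
    then show False using big curve_bound_ge[of "(M ^ 2) ^ m" p m] by simp
  qed
  then have dh: "d \<le> h" using m by simp
  obtain \<delta> where \<delta>: "\<And>v. (\<forall>i<d. v i \<in> F) \<Longrightarrow> \<exists>x. \<forall>i<d. tr (\<delta> i * x) = v i"
    using exists_dual_system[OF dh] by blast
  note dd = d
  interpret dual_system ty p M f h d \<delta>
    by unfold_locales (use \<delta> d in auto)
  obtain J where J: "J \<subseteq> (frob_fixed M :: 'a set)" "card J = j"
    by (rule obtain_subset_with_card_n[of j "frob_fixed M"]) (use j in \<open>auto simp: FM.card_fixed\<close>)
  have "\<not> F \<subseteq> frob_fixed M"
    using card_mono[of "frob_fixed M :: 'a set" F] M2 by (auto simp: FM.card_fixed card_F)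
  then obtain \<rho> where \<rho>: "\<rho> \<in> F" "\<rho> \<notin> frob_fixed M" by blast
  define K where "K = cosets \<rho> J"
  have cK: "card K = j * M" unfolding K_def using card_cosets[OF \<rho> J(1)] J(2) by simp
  have KF: "K \<subseteq> F" unfolding K_def by (rule cosets_subset[OF \<rho> J(1)])
  have big': "M ^ h > curve_bound p (card K) ((M ^ 2) ^ (card K + d))"
    using big curve_bound_mono[of "card K" m "(M ^ 2) ^ m" "(M ^ 2) ^ m" p] unfolding cK m by simp
  show ?thesis
  proof (intro exI[of _ "parabola_arc K"] conjI allI impI)
    have "M * (M * card (parabola_arc K)) = M * (j * CARD('a))"
      using card_parabola_arc[OF KF] unfolding cK by (simp add: power2_eq_square algebra_simps)
    then show "M * card (parabola_arc K) = j * CARD('a)" using M2 by simp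
    show "card {P \<in> parabola_arc K. snd P = \<alpha> * fst P + u} \<le> m" for \<alpha> u
      using line_le[OF KF, of "\<alpha> / 2" u] two_nonzero unfolding cK m by simp
    show "card {P \<in> parabola_arc K. fst P = c} \<le> m" for c
      using vertical_line_le[of K c] unfolding cK m by simp
    fix a b assume ab: "(a, b) \<notin> parabola_arc K"
    define e where "e = b - a ^ 2"
    have "\<exists>D\<subseteq>K - {e}. card D = d \<and> (e \<in> K \<longrightarrow> 2 * (\<Prod>k\<in>D. e - k) = \<phi> e a + e ^ d)"
    proof (cases "e \<in> K")
      case True
      then have "\<phi> e a \<noteq> - (e ^ d)" using slice[OF True, of a] ab unfolding e_def by auto
      then have "(\<phi> e a + e ^ d) / 2 \<noteq> 0" using two_nonzero by (simp add: add_eq_0_iff2)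
      moreover have "2 \<in> F" using FN.fixed_closed(3)[OF FN.fixed_closed(2) FN.fixed_closed(2)] by simp
      then have "(\<phi> e a + e ^ d) / 2 \<in> F" using True KF by (intro FN.fixed_closed phi_fixed) auto
      ultimately have "\<exists>D\<subseteq>K - {e}. card D = d \<and> (\<Prod>k\<in>D. e - k) = (\<phi> e a + e ^ d) / 2"
        unfolding K_def using True j dd J(2) by (intro exists_prescribed_product[OF \<rho> J(1)]) (simp_all add: K_def)
      then obtain D where D: "D \<subseteq> K - {e}" "card D = d" "(\<Prod>k\<in>D. e - k) = (\<phi> e a + e ^ d) / 2" by blast
      have "2 * (\<Prod>k\<in>D. e - k) = \<phi> e a + e ^ d" unfolding D(3) using two_nonzero by simp
      then show ?thesis using D(1,2) by blast
    next
      case False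
      \<comment> \<open>Off all parabolas any \<open>D\<close> of size \<open>d\<close> will do, and
        the bound on \<open>d\<close> shows that \<open>K\<close> is large enough.\<close>
      have "j - 2 + 2 = j" using j(1) by simp
      then have "(j - 2) * M + 2 * M = j * M" by (metis add_mult_distrib)
      then have "d \<le> card K" using dd M2 unfolding cK by linarith
      then obtain D where "D \<subseteq> K" "card D = d" by (rule obtain_subset_with_card_n) auto
      then show ?thesis using False by (intro exI[of _ D]) auto
    qed
    then obtain D where "D \<subseteq> K - {e}" "card D = d" "e \<in> K \<Longrightarrow> 2 * (\<Prod>k\<in>D. e - k) = \<phi> e a + e ^ d"
      by blast
    from exists_full_line[OF KF this big'] show "\<exists>\<alpha>. card {P \<in> parabola_arc K. snd P = \<alpha> * (fst P - a) + b} \<ge> m"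
      unfolding e_def cK m by auto
  qed
qed

end

hide_const (open) Polynomial.order

section \<open>Finite fields carried by natural numbers\<close>

text \<open>\<open>GF\<close> chooses among rings on \<open>nat\<close>, so the field is renamed
  along a bijection with an initial segment of the naturals.\<close>

lemma exists_nat_field:
  fixes E :: "'a::Fields.field set"
  assumes fin: "finite E" and c: "0 \<in> E" "1 \<in> E" "\<And>x y. x \<in> E \<Longrightarrow> y \<in> E \<Longrightarrow> x + y \<in> E"
    "\<And>x y. x \<in> E \<Longrightarrow> y \<in> E \<Longrightarrow> x * y \<in> E" "\<And>x. x \<in> E \<Longrightarrow> - x \<in> E" "\<And>x. x \<in> E \<Longrightarrow> inverse x \<in> E"
  shows "\<exists>R :: nat ring. Ring.field R \<and> order R = card E"
proof -
  define T :: "'a ring" where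
    "T = \<lparr>carrier = E, monoid.mult = (*), one = 1, ring.zero = 0, add = (+)\<rparr>"
  have cr: "cring T"
  proof (rule cringI)
    show "abelian_group T"
      by (rule abelian_groupI) (auto simp: T_def c intro: bexI[of _ "- _"])
    show "comm_monoid T"
      by (rule comm_monoidI) (auto simp: T_def c mult.assoc mult.commute)
  qed (auto simp: T_def distrib_right)
  have T: "Ring.field T"
  proof (rule cring.cring_fieldI2[OF cr])
    show "\<exists>b\<in>carrier T. a \<otimes>\<^bsub>T\<^esub> b = \<one>\<^bsub>T\<^esub>" if "a \<in> carrier T" "a \<noteq> \<zero>\<^bsub>T\<^esub>" for a
      using that by (intro bexI[of _ "inverse a"]) (auto simp: T_def c)
  qed (simp add: T_def)
  obtain g where g: "bij_betw g {..<card E} E"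
    using ex_bij_betw_nat_finite[OF fin] by (auto simp: lessThan_atLeast0)
  define h where "h = inv_into {..<card E} g"
  have hg: "bij_betw h E {..<card E}" "\<And>x. x \<in> E \<Longrightarrow> g (h x) = x"
    unfolding h_def using g by (auto intro: bij_betw_inv_into bij_betw_inv_into_right)
  define R :: "nat ring" where "R = \<lparr>carrier = {..<card E}, monoid.mult = (\<lambda>a b. h (g a * g b)),
    one = h 1, ring.zero = h 0, add = (\<lambda>a b. h (g a + g b))\<rparr>"
  have "h \<in> ring_iso T R"
    by (rule ring_iso_memI) (use hg in \<open>auto simp: T_def R_def c bij_betw_def\<close>)
  from field.ring_iso_imp_img_field[OF T this]
  have "Ring.field R" by (simp add: R_def T_def)
  then show ?thesis by (intro exI[of _ R]) (simp add: R_def Coset.order_def)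
qed

text \<open>Translation by 1 permutes the field. It changes the sum of all elements by
  \<open>CARD('a)\<close> times 1, which is therefore 0.\<close>

lemma CHAR_eq_prime:
  assumes "prime p" "CARD('a::finite_field) = p ^ a"
  shows "CHAR('a) = p"
proof -
  have b: "bij (\<lambda>x::'a. x + 1)" by (rule bij_betw_byWitness[of _ "\<lambda>x. x - 1"]) auto
  have "(\<Sum>x\<in>UNIV. x + 1) = (\<Sum>x\<in>UNIV. x :: 'a)"
    using sum.reindex_bij_betw[OF b, of "\<lambda>x. x"] by simp
  then have "of_nat CARD('a) = (0::'a)" by (simp add: sum.distrib)
  then have "CHAR('a) dvd p ^ a" using assms(2) by (simp only: of_nat_eq_0_iff_char_dvd)
  then show ?thesis
    using CHAR_prime[where 'a='a] assms(1) prime_dvd_power primes_dvd_imp_eq by blast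
qed

text \<open>The roots of \<open>x\<^sup>Q - x\<close> in an algebraic closure form the field of order \<open>Q\<close>.\<close>

lemma exists_nat_field_order:
  assumes p: "prime p" "CARD('a::finite_field) = p ^ a" and n: "n > 0"
  shows "\<exists>R :: nat ring. Ring.field R \<and> order R = CARD('a) ^ n"
proof -
  define Q where "Q = p ^ (a * n)"
  have Qp: "Q = CARD('a) ^ n" unfolding Q_def p(2) by (simp add: power_mult)
  have ch: "CHAR('a alg_closure) = p" using CHAR_eq_prime[OF p] by simp
  have Q1: "Q > 1"
  proof -
    have "card {0, 1 :: 'a} \<le> CARD('a)" by (rule card_mono) auto
    then show ?thesis unfolding Qp using n by (intro one_less_power) auto
  qed
  define f where "f = monom (1 :: 'a alg_closure) Q - monom 1 1"
  have pf: "poly f x = x ^ Q - x" for x unfolding f_def by (simp add: poly_monom)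
  have cf: "coeff f Q = 1" unfolding f_def using Q1 by simp
  then have f0: "f \<noteq> 0" by auto
  have df: "degree f = Q"
  proof (rule antisym)
    show "degree f \<le> Q" unfolding f_def
      by (rule degree_diff_le) (use Q1 in \<open>simp_all add: degree_monom_eq\<close>)
    show "Q \<le> degree f" using cf by (intro le_degree) simp
  qed
  have "a * n \<noteq> 0" using Q1 unfolding Q_def by (metis less_irrefl power_0)
  then have "p dvd Q" unfolding Q_def by (intro dvd_power) simp
  then have "of_nat Q = (0 :: 'a alg_closure)" unfolding of_nat_eq_0_iff_char_dvd ch .
  \<comment> \<open>The derivative has no zeros, so \<open>f\<close> has no repeated root and hence
    \<open>Q\<close> distinct ones.\<close>
  then have der: "pderiv f = [:- 1:]" unfolding f_def by (simp add: pderiv_diff pderiv_monom monom_0)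
  obtain A where A: "size A = Q" "f = smult (lead_coeff f) (\<Prod>x\<in>#A. [:-x, 1:])"
    using alg_closed_imp_factorization[OF f0] df by auto
  have nodup: "count A x \<le> 1" for x
  proof (rule ccontr)
    assume "\<not> count A x \<le> 1"
    then have "replicate_mset 2 x \<subseteq># A" by (simp flip: count_le_replicate_mset_subset_eq)
    then obtain B where "A = replicate_mset 2 x + B" by (auto simp: mset_subset_eq_exists_conv)
    then have B: "A = add_mset x (add_mset x B)" by (simp add: numeral_2_eq_2)
    have "f = smult (lead_coeff f) ([:-x, 1:] * ([:-x, 1:] * (\<Prod>x\<in>#B. [:-x, 1:])))"
      by (subst A(2)) (simp only: B image_mset_add_mset prod_mset.add_mset)
    then have "f = [:-x, 1:] * ([:-x, 1:] * smult (lead_coeff f) (\<Prod>x\<in>#B. [:-x, 1:]))"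
      by (simp only: mult_smult_right)
    then obtain g where "f = [:-x, 1:] * ([:-x, 1:] * g)" by blast
    then have "pderiv f = [:-x, 1:] * pderiv ([:-x, 1:] * g) + [:-x, 1:] * g * pderiv [:-x, 1:]"
      by (simp only: pderiv_mult)
    then have "poly (pderiv f) x = 0" by (simp only: poly_add poly_mult poly_pCons poly_0) simp
    then show False using der by simp
  qed
  define E where "E = {x :: 'a alg_closure. x ^ Q = x}"
  have EA: "E = set_mset A"
  proof -
    have "poly f x = 0 \<longleftrightarrow> x \<in># A" for x
    proof -
      have "poly f x = lead_coeff f * (\<Prod>y\<in>#A. x - y)"
        by (subst A(2)) (simp add: poly_prod_mset image_mset.compositionality o_def)
      then show ?thesis using f0 by (auto simp: prod_mset_zero_iff)
    qed
    then show ?thesis unfolding E_def pf by auto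
  qed
  then have "finite E" by simp
  have "card E = Q"
  proof -
    have "Q = (\<Sum>x\<in>set_mset A. count A x)" using A(1) by (simp add: size_multiset_overloaded_eq)
    also have "\<dots> = (\<Sum>x\<in>set_mset A. 1)"
      by (rule sum.cong) (use nodup in \<open>auto simp: le_antisym Suc_leI\<close>)
    finally show ?thesis unfolding EA by simp
  qed
  have add: "(x + y) ^ Q = x ^ Q + y ^ Q" for x y :: "'a alg_closure"
    by (rule freshmans_dream'[where n = "a * n"]) (use p(1) in \<open>simp_all only: ch Q_def\<close>)
  have "(- x) ^ Q = - (x ^ Q)" for x :: "'a alg_closure"
    using add[of "- x" x] Q1 by (simp add: eq_neg_iff_add_eq_0 power_0_left)
  then have "\<exists>R :: nat ring. Ring.field R \<and> order R = card E"
    using Q1 by (intro exists_nat_field[OF \<open>finite E\<close>]) (auto simp: E_def add power_mult_distrib power_inverse)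
  then show ?thesis unfolding \<open>card E = Q\<close> Qp .
qed

text \<open>For a prime \<open>l\<close> dividing the order, Sylow gives an additive subgroup of
  order \<open>l\<close>. A nonzero \<open>x\<close> in it is killed by \<open>l\<close>, and
  cancelling \<open>x\<close> shows that \<open>l\<close> is the characteristic, which is thus the
  only prime divisor.\<close>

lemma finite_field_order:
  fixes R (structure)
  assumes "Ring.field R" "finite (carrier R)" "ring_char R > 1"
  shows "prime (ring_char R) \<and> (\<exists>a>0. order R = ring_char R ^ a)"
proof -
  interpret Ring.field R by fact
  define c where "c = ring_char R"
  have c: "add_pow R n \<one> = \<zero> \<longleftrightarrow> c dvd n" for n :: nat
    using group.pow_eq_id[OF a_group, of \<one> n] unfolding c_def ring_char_def add_pow_def by simp
  have ell: "l = c" if l: "prime l" "l dvd order R" for l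
  proof -
    obtain b where "order R = l ^ 1 * b" using l(2) by auto
    then have "order (add_monoid R) = l ^ 1 * b" by (simp add: Coset.order_def)
    from sylow_thm[OF l(1) a_group this] assms(2)
    obtain H where H: "subgroup H (add_monoid R)" "card H = l" by auto
    have "\<not> H \<subseteq> {\<zero>}" using H(2) prime_gt_1_nat[OF l(1)] card_mono[of "{\<zero>}" H] by auto
    then obtain x where x: "x \<in> H" "x \<noteq> \<zero>" by auto
    have xR: "x \<in> carrier R" using subgroup.subset[OF H(1)] x by auto
    have gH: "group ((add_monoid R)\<lparr>carrier := H\<rparr>)" by (rule subgroup.subgroup_is_group[OF H(1) a_group])
    have "x [^]\<^bsub>(add_monoid R)\<lparr>carrier := H\<rparr>\<^esub> l = \<zero>"
      using group.pow_order_eq_1[OF gH, of x] x H(2) by (simp add: Coset.order_def)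
    then have "add_pow R l x = \<zero>"
      unfolding add_pow_def using monoid.nat_pow_consistent[OF group.is_monoid[OF a_group], of x l H] by simp
    then have "(add_pow R l \<one>) \<otimes> x = \<zero>" using add_pow_ldistr[of \<one> x l] xR by simp
    then have "add_pow R l \<one> = \<zero>" using integral_iff[of "add_pow R l \<one>" x] xR x by simp
    then have "c dvd l" using c by simp
    then show "l = c" using l(1) assms(3) unfolding c_def by (auto simp: prime_nat_iff)
  qed
  have o1: "order R > 1"
  proof -
    have "card {\<zero>, \<one>} \<le> order R" unfolding Coset.order_def by (rule card_mono) (use assms in auto)
    then show ?thesis by simp
  qed
  then obtain l where l: "prime l" "l dvd order R" using prime_factor_nat[of "order R"] by auto
  then have pc: "prime c" using ell by blast
  obtain k b where kb: "order R = c ^ k * b" "\<not> c dvd b"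
  proof (rule multiplicity_decompose'[of "order R" c])
    show "order R \<noteq> 0" using o1 by simp
    show "\<not> is_unit c" using pc by auto
  qed
  have "b = 1"
  proof (rule ccontr)
    assume "b \<noteq> 1"
    then obtain l where "prime l" "l dvd b" using prime_factor_nat by blast
    then show False using ell[of l] kb by auto
  qed
  then have "order R = c ^ k" using kb by simp
  moreover have "k > 0" using calculation o1 by (cases k) auto
  ultimately show ?thesis using pc unfolding c_def by blast
qed

section \<open>Transfer to fields carried by natural numbers\<close>

definition affine_arc :: "('a, 'b) ring_scheme \<Rightarrow> nat \<Rightarrow> ('a \<times> 'a) set \<Rightarrow> bool" where
  "affine_arc R m S \<longleftrightarrow> S \<subseteq> carrier R \<times> carrier R \<and>
     (\<forall>a\<in>carrier R. \<forall>u\<in>carrier R. card {P \<in> S. snd P = a \<otimes>\<^bsub>R\<^esub> fst P \<oplus>\<^bsub>R\<^esub> u} \<le> m) \<and>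
     (\<forall>c\<in>carrier R. card {P \<in> S. fst P = c} \<le> m) \<and>
     (\<forall>x\<in>carrier R. \<forall>y\<in>carrier R. (x, y) \<notin> S \<longrightarrow> (\<exists>a\<in>carrier R. \<exists>u\<in>carrier R.
        y = a \<otimes>\<^bsub>R\<^esub> x \<oplus>\<^bsub>R\<^esub> u \<and> card {P \<in> S. snd P = a \<otimes>\<^bsub>R\<^esub> fst P \<oplus>\<^bsub>R\<^esub> u} \<ge> m))"

text \<open>Existence of extensions and existence of arcs form one predicate, so that a single test
  field settles both for all finite fields.\<close>

definition arc_field :: "nat ring \<Rightarrow> bool" where
  "arc_field R \<longleftrightarrow> (\<forall>p a. prime p \<and> order R = p ^ a \<longrightarrow>
     (\<forall>n>0. \<exists>R' :: nat ring. Ring.field R' \<and> order R' = order R ^ n) \<and>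
     (\<forall>f h j d m. p > 3 \<and> f > 0 \<and> order R = ((p ^ f) ^ 2) ^ h \<and> 2 \<le> j \<and> j \<le> p ^ f \<and>
        2 \<le> d \<and> d \<le> 2 + (j - 2) * p ^ f \<and> m = j * p ^ f + d \<and>
        (p ^ f) ^ h > curve_bound p m (((p ^ f) ^ 2) ^ m) \<longrightarrow>
        (\<exists>S. affine_arc R m S \<and> p ^ f * card S = j * order R)))"

text \<open>This supplies a value for \<open>test_field\<close> in case there is no
  counterexample.\<close>

lemma exists_nat_finite_field: "\<exists>R :: nat ring. Ring.field R \<and> finite (carrier R)"
proof -
  define R :: "nat ring" where "R = \<lparr>carrier = {0, 1}, monoid.mult = (\<lambda>x y. x * y), one = 1,
    ring.zero = 0, add = (\<lambda>x y. (x + y) mod 2)\<rparr>"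
  have "cring R"
  proof (rule cringI)
    show "abelian_group R" by (rule abelian_groupI) (auto simp: R_def)
    show "comm_monoid R" by (rule comm_monoidI) (auto simp: R_def)
  qed (auto simp: R_def)
  then have "Ring.field R" by (rule cring.cring_fieldI2) (auto simp: R_def)
  then show ?thesis by (intro exI[of _ R]) (simp add: R_def)
qed

text \<open>A type cannot depend on the field under consideration. So the field underlying the type is
  chosen as a counterexample to the property to be transferred, if there is one.\<close>

definition test_field :: "nat ring" where
  "test_field = (SOME R. Ring.field R \<and> finite (carrier R) \<and>
     (arc_field R \<longrightarrow> (\<forall>R'. Ring.field R' \<and> finite (carrier R') \<longrightarrow> arc_field R')))"

lemma test_field:
  shows field_test_field: "Ring.field test_field" and finite_test_field: "finite (carrier test_field)"
    and test_field_complete: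
      "\<And>R'. arc_field test_field \<Longrightarrow> Ring.field R' \<Longrightarrow> finite (carrier R') \<Longrightarrow> arc_field R'"
proof -
  have "\<exists>R. Ring.field R \<and> finite (carrier R) \<and>
     (arc_field R \<longrightarrow> (\<forall>R'. Ring.field R' \<and> finite (carrier R') \<longrightarrow> arc_field R'))"
    using exists_nat_finite_field by blast
  from someI_ex[OF this] show "Ring.field test_field" "finite (carrier test_field)"
    "\<And>R'. arc_field test_field \<Longrightarrow> Ring.field R' \<Longrightarrow> finite (carrier R') \<Longrightarrow> arc_field R'"
    unfolding test_field_def by blast+
qed

section \<open>The test field as a type\<close>

interpretation TF: cring test_field
  using field_test_field by (rule fieldE(1))

typedef tf = "carrier test_field" by (rule exI[of _ "\<zero>\<^bsub>test_field\<^esub>"]) simp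

instantiation tf :: Fields.field
begin

definition "0 = Abs_tf \<zero>\<^bsub>test_field\<^esub>"
definition "1 = Abs_tf \<one>\<^bsub>test_field\<^esub>"
definition "x + y = Abs_tf (Rep_tf x \<oplus>\<^bsub>test_field\<^esub> Rep_tf y)"
definition "- x = Abs_tf (\<ominus>\<^bsub>test_field\<^esub> Rep_tf x)"
definition "x - y = Abs_tf (Rep_tf x \<ominus>\<^bsub>test_field\<^esub> Rep_tf y)"
definition "x * y = Abs_tf (Rep_tf x \<otimes>\<^bsub>test_field\<^esub> Rep_tf y)"
definition "inverse x = (if x = 0 then 0 else Abs_tf (inv\<^bsub>test_field\<^esub> Rep_tf x))"
definition "x div y = x * inverse y" for x y :: tf

lemma Rep_tf_carrier [simp]: "Rep_tf x \<in> carrier test_field"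
  by (rule Rep_tf)

lemma Rep_tf_0: "Rep_tf 0 = \<zero>\<^bsub>test_field\<^esub>"
  and Rep_tf_1: "Rep_tf 1 = \<one>\<^bsub>test_field\<^esub>"
  and Rep_tf_add: "Rep_tf (x + y) = Rep_tf x \<oplus>\<^bsub>test_field\<^esub> Rep_tf y"
  and Rep_tf_minus: "Rep_tf (- x) = \<ominus>\<^bsub>test_field\<^esub> Rep_tf x"
  and Rep_tf_diff: "Rep_tf (x - y) = Rep_tf x \<ominus>\<^bsub>test_field\<^esub> Rep_tf y"
  and Rep_tf_mult: "Rep_tf (x * y) = Rep_tf x \<otimes>\<^bsub>test_field\<^esub> Rep_tf y"
  unfolding zero_tf_def one_tf_def plus_tf_def uminus_tf_def minus_tf_def times_tf_def
  by (simp_all add: Abs_tf_inverse)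

lemma Rep_tf_inverse': "x \<noteq> 0 \<Longrightarrow> Rep_tf (inverse x) \<otimes>\<^bsub>test_field\<^esub> Rep_tf x = \<one>\<^bsub>test_field\<^esub>"
proof -
  assume x: "x \<noteq> 0"
  then have "Rep_tf x \<noteq> \<zero>\<^bsub>test_field\<^esub>" using Rep_tf_0 Rep_tf_inject by metis
  then have "Rep_tf x \<in> Units test_field" using field.field_Units[OF field_test_field] by simp
  then show ?thesis using x unfolding inverse_tf_def by (simp add: Abs_tf_inverse)
qed

instance
proof
  fix a b c :: tf
  show "a + b + c = a + (b + c)" "a * b * c = a * (b * c)"
    by (simp_all add: Rep_tf_inject[symmetric] Rep_tf_add Rep_tf_mult TF.a_assoc TF.m_assoc)
  show "a + b = b + a" "a * b = b * a"
    by (simp_all add: Rep_tf_inject[symmetric] Rep_tf_add Rep_tf_mult TF.a_comm TF.m_comm)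
  show "(a + b) * c = a * c + b * c"
    by (simp add: Rep_tf_inject[symmetric] Rep_tf_add Rep_tf_mult TF.l_distr)
  show "0 + a = a" "- a + a = 0" "1 * a = a" "(0::tf) \<noteq> 1" "a - b = a + - b"
    by (simp_all add: Rep_tf_inject[symmetric] Rep_tf_add Rep_tf_mult Rep_tf_minus Rep_tf_diff
        Rep_tf_0 Rep_tf_1 TF.l_neg a_minus_def fieldE(2)[OF field_test_field, symmetric])
  show "a \<noteq> 0 \<Longrightarrow> inverse a * a = 1"
    using Rep_tf_inverse'[of a] by (simp add: Rep_tf_inject[symmetric] Rep_tf_mult Rep_tf_1)
  show "inverse (0::tf) = 0" by (simp add: inverse_tf_def)
  show "a div b = a * inverse b" by (simp add: divide_tf_def)
qed

end

lemma range_Rep_tf: "range Rep_tf = carrier test_field"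
  using type_definition.Rep_range[OF type_definition_tf] .

instance tf :: finite_field
proof (rule finite_fieldI)
  have "finite (range Rep_tf)" unfolding range_Rep_tf by (rule finite_test_field)
  then show "finite (UNIV :: tf set)" by (rule finite_imageD) (simp add: inj_on_def Rep_tf_inject)
qed

lemma order_test_field: "order test_field = CARD(tf)"
  unfolding Coset.order_def range_Rep_tf[symmetric] by (rule card_image) (simp add: inj_on_def Rep_tf_inject)

lemma Rep_tf_surj: "x \<in> carrier test_field \<Longrightarrow> \<exists>y. x = Rep_tf y"
  unfolding range_Rep_tf[symmetric] by auto

lemma arc_field_test_field: "arc_field test_field"
  unfolding arc_field_def
proof (intro allI impI conjI)
  fix p a assume pa: "prime p \<and> order test_field = p ^ a"
  then have pa': "prime p" "CARD(tf) = p ^ a" by (simp_all add: order_test_field)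
  show "\<exists>R' :: nat ring. Ring.field R' \<and> order R' = order test_field ^ n" if "n > 0" for n
    using exists_nat_field_order[OF pa' that] by (simp add: order_test_field)
  fix f h j d m
  assume A: "p > 3 \<and> f > 0 \<and> order test_field = ((p ^ f) ^ 2) ^ h \<and> 2 \<le> j \<and> j \<le> p ^ f \<and>
        2 \<le> d \<and> d \<le> 2 + (j - 2) * p ^ f \<and> m = j * p ^ f + d \<and>
        (p ^ f) ^ h > curve_bound p m (((p ^ f) ^ 2) ^ m)"
  interpret trace_tower "TYPE(tf)" p "p ^ f" f h
    by unfold_locales (use A pa' CHAR_eq_prime[OF pa'] in \<open>auto simp: order_test_field\<close>)
  obtain S :: "(tf \<times> tf) set" where S: "p ^ f * card S = j * CARD(tf)"
    "\<And>\<alpha> u. card {P \<in> S. snd P = \<alpha> * fst P + u} \<le> m" "\<And>c. card {P \<in> S. fst P = c} \<le> m"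
    "\<And>a b. (a, b) \<notin> S \<Longrightarrow> \<exists>\<alpha>. card {P \<in> S. snd P = \<alpha> * (fst P - a) + b} \<ge> m"
    using exists_affine_arc[of j d m] A by blast
  define g where "g = map_prod Rep_tf Rep_tf"
  have inj: "inj g" unfolding g_def by (rule prod.inj_map) (simp_all add: inj_on_def Rep_tf_inject)
  have line: "card {P \<in> g ` S. snd P = Rep_tf \<alpha> \<otimes>\<^bsub>test_field\<^esub> fst P \<oplus>\<^bsub>test_field\<^esub> Rep_tf u}
      = card {P \<in> S. snd P = \<alpha> * fst P + u}" for \<alpha> u
  proof -
    have "{P \<in> g ` S. snd P = Rep_tf \<alpha> \<otimes>\<^bsub>test_field\<^esub> fst P \<oplus>\<^bsub>test_field\<^esub> Rep_tf u}
        = g ` {P \<in> S. snd P = \<alpha> * fst P + u}"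
      unfolding g_def by (auto simp: Rep_tf_mult[symmetric] Rep_tf_add[symmetric] Rep_tf_inject)
    then show ?thesis using card_image[OF inj_on_subset[OF inj]] by simp
  qed
  have vert: "card {P \<in> g ` S. fst P = Rep_tf c} = card {P \<in> S. fst P = c}" for c
  proof -
    have "{P \<in> g ` S. fst P = Rep_tf c} = g ` {P \<in> S. fst P = c}"
      unfolding g_def by (auto simp: Rep_tf_inject)
    then show ?thesis using card_image[OF inj_on_subset[OF inj]] by simp
  qed
  have "affine_arc test_field m (g ` S)"
    unfolding affine_arc_def
  proof (intro conjI ballI impI)
    show "g ` S \<subseteq> carrier test_field \<times> carrier test_field" unfolding g_def by auto
    show "card {P \<in> g ` S. snd P = a \<otimes>\<^bsub>test_field\<^esub> fst P \<oplus>\<^bsub>test_field\<^esub> u} \<le> m"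
      if "a \<in> carrier test_field" "u \<in> carrier test_field" for a u
      using Rep_tf_surj[OF that(1)] Rep_tf_surj[OF that(2)] line S(2) by auto
    show "card {P \<in> g ` S. fst P = c} \<le> m" if "c \<in> carrier test_field" for c
      using Rep_tf_surj[OF that] vert S(3) by auto
    fix x y assume xy: "x \<in> carrier test_field" "y \<in> carrier test_field" "(x, y) \<notin> g ` S"
    obtain x' y' where x'y': "x = Rep_tf x'" "y = Rep_tf y'" using Rep_tf_surj xy by blast
    have "(x', y') \<notin> S" using xy(3) unfolding x'y' g_def by force
    then obtain \<alpha> where \<alpha>: "card {P \<in> S. snd P = \<alpha> * (fst P - x') + y'} \<ge> m" using S(4) by blast
    have "{P \<in> S. snd P = \<alpha> * (fst P - x') + y'} = {P \<in> S. snd P = \<alpha> * fst P + (y' - \<alpha> * x')}"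
      by (simp add: algebra_simps)
    then have "card {P \<in> g ` S. snd P = Rep_tf \<alpha> \<otimes>\<^bsub>test_field\<^esub> fst P \<oplus>\<^bsub>test_field\<^esub> Rep_tf (y' - \<alpha> * x')} \<ge> m"
      unfolding line using \<alpha> by simp
    moreover have "y = Rep_tf \<alpha> \<otimes>\<^bsub>test_field\<^esub> x \<oplus>\<^bsub>test_field\<^esub> Rep_tf (y' - \<alpha> * x')"
      unfolding x'y' by (simp flip: Rep_tf_mult Rep_tf_add)
    ultimately show "\<exists>a\<in>carrier test_field. \<exists>u\<in>carrier test_field. y = a \<otimes>\<^bsub>test_field\<^esub> x \<oplus>\<^bsub>test_field\<^esub> u
        \<and> m \<le> card {P \<in> g ` S. snd P = a \<otimes>\<^bsub>test_field\<^esub> fst P \<oplus>\<^bsub>test_field\<^esub> u}"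
      using Rep_tf by blast
  qed
  moreover have "p ^ f * card (g ` S) = j * order test_field"
    unfolding order_test_field S(1)[symmetric] by (subst card_image[OF inj_on_subset[OF inj]]) simp_all
  ultimately show "\<exists>S. affine_arc test_field m S \<and> p ^ f * card S = j * order test_field" by blast
qed

theorem arc_field_all: "Ring.field R \<Longrightarrow> finite (carrier R) \<Longrightarrow> arc_field R"
  by (rule test_field_complete[OF arc_field_test_field])

lemma field_GF:
  assumes "\<exists>R :: nat ring. Ring.field R \<and> order R = Q"
  shows "Ring.field (GF Q)" "order (GF Q) = Q"
  using someI_ex[OF assms] unfolding GF_def by auto

section \<open>From the affine to the projective plane\<close>

locale finite_field_plane = Ring.field R for R :: "('a, 'b) ring_scheme" (structure) +
  assumes finite_carrier: "finite (carrier R)"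
begin

definition aff :: "'a \<times> 'a \<Rightarrow> ('a \<times> 'a \<times> 'a) set" where
  "aff P = proj_point R (fst P, snd P, \<one>)"

lemma aff_PG2: "P \<in> carrier R \<times> carrier R \<Longrightarrow> aff P \<in> PG2_points R"
  unfolding aff_def PG2_points_def nonzero_triples_def by (rule imageI) auto

lemma aff_mem_line:
  assumes "x \<in> carrier R" "y \<in> carrier R" "a \<in> carrier R" "b \<in> carrier R" "d \<in> carrier R"
  shows "aff (x, y) \<in> proj_line R (a, b, d) \<longleftrightarrow> a \<otimes> x \<oplus> b \<otimes> y \<oplus> d = \<zero>"
proof -
  have e: "a \<otimes> (c \<otimes> x) \<oplus> b \<otimes> (c \<otimes> y) \<oplus> d \<otimes> (c \<otimes> \<one>) = c \<otimes> (a \<otimes> x \<oplus> b \<otimes> y \<oplus> d)"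
    if "c \<in> carrier R" for c
    using assms that by (simp add: r_distr m_lcomm m_comm[of d c])
  have im: "aff (x, y) = (\<lambda>c. (c \<otimes> x, c \<otimes> y, c \<otimes> \<one>)) ` (carrier R - {\<zero>})"
    unfolding aff_def proj_point_def by auto
  have "aff (x, y) \<in> proj_line R (a, b, d) \<longleftrightarrow>
      (\<forall>(x, y, z)\<in>aff (x, y). a \<otimes> x \<oplus> b \<otimes> y \<oplus> d \<otimes> z = \<zero>)"
    using aff_PG2[of "(x, y)"] assms unfolding proj_line_def by simp
  also have "\<dots> \<longleftrightarrow> (\<forall>c\<in>carrier R - {\<zero>}. a \<otimes> (c \<otimes> x) \<oplus> b \<otimes> (c \<otimes> y) \<oplus> d \<otimes> (c \<otimes> \<one>) = \<zero>)"
    unfolding im ball_simps(9) prod.case ..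
  also have "\<dots> \<longleftrightarrow> (\<forall>c\<in>carrier R - {\<zero>}. c \<otimes> (a \<otimes> x \<oplus> b \<otimes> y \<oplus> d) = \<zero>)"
    by (intro ball_cong refl) (simp only: e Diff_iff)
  also have "\<dots> \<longleftrightarrow> a \<otimes> x \<oplus> b \<otimes> y \<oplus> d = \<zero>"
  proof
    assume "\<forall>c\<in>carrier R - {\<zero>}. c \<otimes> (a \<otimes> x \<oplus> b \<otimes> y \<oplus> d) = \<zero>"
    then have "\<one> \<otimes> (a \<otimes> x \<oplus> b \<otimes> y \<oplus> d) = \<zero>" by (rule bspec) simp
    then show "a \<otimes> x \<oplus> b \<otimes> y \<oplus> d = \<zero>" using assms by simp
  qed simp
  finally show ?thesis .
qed

lemma inj_aff: "inj_on aff (carrier R \<times> carrier R)"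
proof (rule inj_onI, clarify)
  fix x y x' y'
  assume C: "x \<in> carrier R" "y \<in> carrier R" "x' \<in> carrier R" "y' \<in> carrier R" and eq: "aff (x, y) = aff (x', y')"
  have "(x, y, \<one>) \<in> aff (x, y)" unfolding aff_def proj_point_def using C by (auto intro!: exI[of _ \<one>])
  then have "(x, y, \<one>) \<in> aff (x', y')" using eq by simp
  then obtain c where c: "c \<in> carrier R" "x = c \<otimes> x'" "y = c \<otimes> y'" "\<one> = c \<otimes> \<one>"
    unfolding aff_def proj_point_def by auto
  have "c = \<one>" using c by simp
  then show "x = x' \<and> y = y'" using C c by simp
qed

lemma proj_point_scale_subset:
  assumes "s \<in> carrier R - {\<zero>}" "x \<in> carrier R" "y \<in> carrier R" "z \<in> carrier R"
  shows "proj_point R (s \<otimes> x, s \<otimes> y, s \<otimes> z) \<subseteq> proj_point R (x, y, z)"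
proof
  fix P assume "P \<in> proj_point R (s \<otimes> x, s \<otimes> y, s \<otimes> z)"
  then obtain c where c: "c \<in> carrier R - {\<zero>}" "P = (c \<otimes> (s \<otimes> x), c \<otimes> (s \<otimes> y), c \<otimes> (s \<otimes> z))"
    unfolding proj_point_def by auto
  then have "P = (c \<otimes> s \<otimes> x, c \<otimes> s \<otimes> y, c \<otimes> s \<otimes> z)" using assms by (simp add: m_assoc)
  moreover have "c \<otimes> s \<in> carrier R - {\<zero>}" using c assms integral_iff by auto
  ultimately show "P \<in> proj_point R (x, y, z)" unfolding proj_point_def by auto
qed

lemma proj_point_scale:
  assumes s: "s \<in> carrier R - {\<zero>}" and C: "x \<in> carrier R" "y \<in> carrier R" "z \<in> carrier R"
  shows "proj_point R (s \<otimes> x, s \<otimes> y, s \<otimes> z) = proj_point R (x, y, z)"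
proof (rule equalityI[OF proj_point_scale_subset[OF assms]])
  have u: "s \<in> Units R" using s field_Units by simp
  then have i: "inv s \<in> Units R" by (rule Units_inv_Units)
  have "inv s \<otimes> (s \<otimes> v) = v" if "v \<in> carrier R" for v
    using that u s by (simp add: Units_l_inv flip: m_assoc)
  then show "proj_point R (x, y, z) \<subseteq> proj_point R (s \<otimes> x, s \<otimes> y, s \<otimes> z)"
    using proj_point_scale_subset[of "inv s" "s \<otimes> x" "s \<otimes> y" "s \<otimes> z"] i field_Units C s by simp
qed

lemma PG2_point_cases:
  assumes "P \<in> PG2_points R"
  obtains x y where "x \<in> carrier R" "y \<in> carrier R" "P = aff (x, y)" | "P \<in> proj_line R (\<zero>, \<zero>, \<one>)"
proof -
  obtain x y z where C: "x \<in> carrier R" "y \<in> carrier R" "z \<in> carrier R" and P: "P = proj_point R (x, y, z)"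
    using assms unfolding PG2_points_def nonzero_triples_def by auto
  show ?thesis
  proof (cases "z = \<zero>")
    case True
    have "P \<in> proj_line R (\<zero>, \<zero>, \<one>)"
      using assms C True unfolding P proj_line_def by (auto simp: proj_point_def)
    then show ?thesis by (rule that(2))
  next
    case False
    then have u: "z \<in> Units R" using C field_Units by simp
    then have i: "inv z \<in> carrier R - {\<zero>}" using field_Units Units_inv_Units by simp
    have "P = proj_point R (inv z \<otimes> x, inv z \<otimes> y, inv z \<otimes> z)"
      unfolding P by (rule proj_point_scale[OF i C, symmetric])
    also have "inv z \<otimes> z = \<one>" using u by (rule Units_l_inv)
    finally show ?thesis using that(1)[of "inv z \<otimes> x" "inv z \<otimes> y"] C i unfolding aff_def by simp
  qed
qed

lemma card_line_inter_le:
  assumes S: "affine_arc R m S" and l: "l \<in> PG2_lines R"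
  shows "card {P \<in> S. aff P \<in> l} \<le> m"
proof -
  have SC: "S \<subseteq> carrier R \<times> carrier R" using S unfolding affine_arc_def by simp
  then have fin: "finite S" using finite_carrier by (meson finite_SigmaI finite_subset)
  have SL: "card {P \<in> S. snd P = a \<otimes> fst P \<oplus> u} \<le> m" if "a \<in> carrier R" "u \<in> carrier R" for a u
    using S that unfolding affine_arc_def by (elim conjE) (drule (1) bspec, drule (1) bspec)
  have SV: "card {P \<in> S. fst P = c} \<le> m" if "c \<in> carrier R" for c
    using S that unfolding affine_arc_def by (elim conjE) (drule (1) bspec[of _ _ c])
  obtain a b d where C: "a \<in> carrier R" "b \<in> carrier R" "d \<in> carrier R" "(a, b, d) \<noteq> (\<zero>, \<zero>, \<zero>)"
    and l': "l = proj_line R (a, b, d)"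
    using l unfolding PG2_lines_def nonzero_triples_def by auto
  have mem: "x \<in> carrier R \<and> y \<in> carrier R \<and> a \<otimes> x \<oplus> b \<otimes> y \<oplus> d = \<zero>" if "(x, y) \<in> S" "aff (x, y) \<in> l" for x y
    using aff_mem_line[of x y a b d] that SC C unfolding l' by auto
  consider "b \<noteq> \<zero>" | "b = \<zero>" "a \<noteq> \<zero>" | "a = \<zero>" "b = \<zero>" "d \<noteq> \<zero>" using C by auto
  then show ?thesis
  proof cases
    case 1
    then have u: "b \<in> Units R" using C field_Units by simp
    define i where "i = inv b"
    have i: "i \<in> carrier R" "i \<otimes> b = \<one>" unfolding i_def using u by (auto intro: Units_l_inv)
    have "{P \<in> S. aff P \<in> l} \<subseteq> {P \<in> S. snd P = \<ominus> (i \<otimes> a) \<otimes> fst P \<oplus> \<ominus> (i \<otimes> d)}"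
    proof clarsimp
      fix x y assume xy: "(x, y) \<in> S" "aff (x, y) \<in> l"
      have m: "x \<in> carrier R" "y \<in> carrier R" "a \<otimes> x \<oplus> b \<otimes> y \<oplus> d = \<zero>" using mem[OF xy] by auto
      have "y = i \<otimes> b \<otimes> y" using i m by simp
      also have "\<dots> = i \<otimes> (a \<otimes> x \<oplus> b \<otimes> y \<oplus> d) \<oplus> (\<ominus> (i \<otimes> a) \<otimes> x \<oplus> \<ominus> (i \<otimes> d))"
        using i(1) m(1,2) C(1-3) by algebra
      also have "\<dots> = \<ominus> (i \<otimes> a) \<otimes> x \<oplus> \<ominus> (i \<otimes> d)" unfolding m(3) using i m(1,2) C by simp
      finally show "y = \<ominus> (i \<otimes> a) \<otimes> x \<oplus> \<ominus> (i \<otimes> d)" .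
    qed
    then have "card {P \<in> S. aff P \<in> l} \<le> card {P \<in> S. snd P = \<ominus> (i \<otimes> a) \<otimes> fst P \<oplus> \<ominus> (i \<otimes> d)}"
      by (intro card_mono) (use fin in auto)
    also have "\<dots> \<le> m" using i(1) C by (intro SL) auto
    finally show ?thesis .
  next
    case 2
    then have u: "a \<in> Units R" using C field_Units by simp
    define i where "i = inv a"
    have i: "i \<in> carrier R" "i \<otimes> a = \<one>" unfolding i_def using u by (auto intro: Units_l_inv)
    have "{P \<in> S. aff P \<in> l} \<subseteq> {P \<in> S. fst P = \<ominus> (i \<otimes> d)}"
    proof clarsimp
      fix x y assume xy: "(x, y) \<in> S" "aff (x, y) \<in> l"
      have m: "x \<in> carrier R" "y \<in> carrier R" "a \<otimes> x \<oplus> b \<otimes> y \<oplus> d = \<zero>" using mem[OF xy] by auto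
      then have m3: "a \<otimes> x \<oplus> d = \<zero>" using 2 C by simp
      have "x = i \<otimes> a \<otimes> x" using i m by simp
      also have "\<dots> = i \<otimes> (a \<otimes> x \<oplus> d) \<oplus> \<ominus> (i \<otimes> d)" using i(1) m(1,2) C(1-3) by algebra
      also have "\<dots> = \<ominus> (i \<otimes> d)" unfolding m3 using i m(1,2) C by simp
      finally show "x = \<ominus> (i \<otimes> d)" .
    qed
    then have "card {P \<in> S. aff P \<in> l} \<le> card {P \<in> S. fst P = \<ominus> (i \<otimes> d)}"
      by (intro card_mono) (use fin in auto)
    also have "\<dots> \<le> m" using i(1) C by (intro SV) auto
    finally show ?thesis .
  next
    \<comment> \<open>This is the line at infinity.\<close>
    case 3
    have "{P \<in> S. aff P \<in> l} = {}"
    proof -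
      have False if xy: "(x, y) \<in> S" "aff (x, y) \<in> l" for x y
      proof -
        have "x \<in> carrier R" "y \<in> carrier R" "a \<otimes> x \<oplus> b \<otimes> y \<oplus> d = \<zero>" using mem[OF xy] by auto
        then show False using 3 C by simp
      qed
      then show ?thesis by auto
    qed
    then show ?thesis by (simp only: card.empty)
  qed
qed

text \<open>In an arc containing \<open>aff ` S\<close> every further point is at infinity, and at most \<open>m\<close> points
  of an arc lie on the line at infinity.\<close>

theorem exists_complete_arc:
  assumes S: "affine_arc R m S" and ne: "S \<noteq> carrier R \<times> carrier R"
  shows "\<exists>T. is_complete_arc R m T \<and> card T \<le> card S + m"
proof -
  have SC: "S \<subseteq> carrier R \<times> carrier R" using S unfolding affine_arc_def by simp
  then have fin: "finite S" using finite_carrier by (meson finite_SigmaI finite_subset)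
  have inj: "inj_on aff S" using inj_aff SC by (rule inj_on_subset)
  have fPG: "finite (PG2_points R)"
    unfolding PG2_points_def nonzero_triples_def using finite_carrier by auto
  have full: "\<exists>l\<in>PG2_lines R. aff (x, y) \<in> l \<and> card {P \<in> S. aff P \<in> l} \<ge> m"
    if xy: "x \<in> carrier R" "y \<in> carrier R" "(x, y) \<notin> S" for x y
  proof -
    obtain a u where au: "a \<in> carrier R" "u \<in> carrier R" "y = a \<otimes> x \<oplus> u"
      "card {P \<in> S. snd P = a \<otimes> fst P \<oplus> u} \<ge> m"
      using S xy unfolding affine_arc_def by blast
    define l where "l = proj_line R (a, \<ominus> \<one>, u)"
    have on: "aff (x', y') \<in> l" if "x' \<in> carrier R" "y' = a \<otimes> x' \<oplus> u" for x' y'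
    proof -
      have "a \<otimes> x' \<oplus> \<ominus> \<one> \<otimes> (a \<otimes> x' \<oplus> u) \<oplus> u = \<zero>" using au(1,2) that(1) by algebra
      then show ?thesis using aff_mem_line[of x' y' a "\<ominus> \<one>" u] au that unfolding l_def by simp
    qed
    have "l \<in> PG2_lines R"
      unfolding l_def PG2_lines_def nonzero_triples_def by (rule imageI) (use au in auto)
    moreover have "card {P \<in> S. snd P = a \<otimes> fst P \<oplus> u} \<le> card {P \<in> S. aff P \<in> l}"
      by (intro card_mono) (use fin on SC in auto)
    ultimately show ?thesis using on[OF xy(1) au(3)] au(4) by auto
  qed
  have arc: "is_arc R (card S) m (aff ` S)"
    unfolding is_arc_def
  proof (intro conjI)
    show "aff ` S \<subseteq> PG2_points R" using SC aff_PG2 by auto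
    show "finite (aff ` S)" using fin by simp
    show "card (aff ` S) = card S" by (rule card_image[OF inj])
    show "\<not> (\<exists>T\<subseteq>aff ` S. card T = m + 1 \<and> PG2_collinear R T)"
    proof
      assume "\<exists>T\<subseteq>aff ` S. card T = m + 1 \<and> PG2_collinear R T"
      then obtain T l where T: "T \<subseteq> aff ` S" "card T = m + 1" "l \<in> PG2_lines R" "T \<subseteq> l"
        unfolding PG2_collinear_def by auto
      have "T \<subseteq> aff ` {P \<in> S. aff P \<in> l}" using T by auto
      then have "card T \<le> card (aff ` {P \<in> S. aff P \<in> l})" by (rule card_mono[rotated]) (use fin in simp)
      also have "\<dots> \<le> card {P \<in> S. aff P \<in> l}" by (rule card_image_le) (use fin in simp)
      finally have "card T \<le> card {P \<in> S. aff P \<in> l}" .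
      then show False using card_line_inter_le[OF S T(3)] T(2) by simp
    qed
    \<comment> \<open>The full line through a point outside \<open>S\<close> supplies the
      \<open>m\<close> collinear points that an arc must contain.\<close>
    obtain x y where "x \<in> carrier R" "y \<in> carrier R" "(x, y) \<notin> S" using ne SC by auto
    then obtain l where l: "l \<in> PG2_lines R" "card {P \<in> S. aff P \<in> l} \<ge> m" using full by blast
    obtain U where U: "U \<subseteq> {P \<in> S. aff P \<in> l}" "card U = m" using obtain_subset_with_card_n[OF l(2)] by metis
    then have "U \<subseteq> S" by blast
    then have "card (aff ` U) = m" using card_image[OF inj_on_subset[OF inj]] U(2) by simp
    moreover have "aff ` U \<subseteq> aff ` S" "aff ` U \<subseteq> l" using U by auto
    ultimately show "\<exists>T\<subseteq>aff ` S. card T = m \<and> PG2_collinear R T"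
      unfolding PG2_collinear_def using l(1) by blast
  qed
  \<comment> \<open>The plane is finite, so some arc containing \<open>aff\<close> followed by the
    set \<open>S\<close> is maximal; it is then maximal among all arcs.\<close>
  define A where "A = {T. (\<exists>k. is_arc R k m T) \<and> aff ` S \<subseteq> T}"
  have A: "finite A" "aff ` S \<in> A"
  proof -
    have "A \<subseteq> Pow (PG2_points R)" unfolding A_def is_arc_def by auto
    then show "finite A" by (rule finite_subset) (use fPG in simp)
    show "aff ` S \<in> A" unfolding A_def using arc by auto
  qed
  obtain T where T: "T \<in> A" "\<And>T'. T' \<in> A \<Longrightarrow> T \<subseteq> T' \<Longrightarrow> T = T'"
    using finite_has_maximal[OF A(1)] A(2) by blast
  have comp: "is_complete_arc R m T"
    unfolding is_complete_arc_def
  proof (intro conjI allI impI)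
    show "\<exists>k. is_arc R k m T" using T(1) unfolding A_def by simp
    fix k' S' assume S': "is_arc R k' m S' \<and> T \<subseteq> S'"
    then have "S' \<in> A" using T(1) unfolding A_def by auto
    then show "S' = T" using T(2)[of S'] S' by auto
  qed
  obtain k where k: "is_arc R k m T" using T(1) unfolding A_def by auto
  have T': "T \<subseteq> PG2_points R" "finite T" "aff ` S \<subseteq> T"
    "\<And>U. U \<subseteq> T \<Longrightarrow> PG2_collinear R U \<Longrightarrow> card U \<noteq> m + 1"
    using k T(1) unfolding A_def is_arc_def by auto
  have inf: "T - aff ` S \<subseteq> proj_line R (\<zero>, \<zero>, \<one>)"
  proof
    fix P assume P: "P \<in> T - aff ` S"
    then have "P \<in> PG2_points R" using T' by auto
    then show "P \<in> proj_line R (\<zero>, \<zero>, \<one>)"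
    proof (cases rule: PG2_point_cases)
      case (1 x y)
      then have "(x, y) \<notin> S" using P by auto
      then obtain l where l: "l \<in> PG2_lines R" "P \<in> l" "card {P \<in> S. aff P \<in> l} \<ge> m" using full 1 by blast
      obtain U where U: "U \<subseteq> {P \<in> S. aff P \<in> l}" "card U = m" using obtain_subset_with_card_n[OF l(3)] by metis
      then have "U \<subseteq> S" by blast
      then have "card (aff ` U) = m" using card_image[OF inj_on_subset[OF inj]] U(2) by simp
      moreover have "P \<notin> aff ` U" "finite (aff ` U)" using P \<open>U \<subseteq> S\<close> fin by (auto intro: finite_subset)
      ultimately have "card (insert P (aff ` U)) = m + 1" by simp
      moreover have "insert P (aff ` U) \<subseteq> T" using P U T'(3) by auto
      moreover have "PG2_collinear R (insert P (aff ` U))"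
        unfolding PG2_collinear_def using l U by (intro bexI[of _ l]) auto
      ultimately show ?thesis using T'(4) by blast
    qed
  qed
  have "card (T - aff ` S) \<le> m"
  proof (rule ccontr)
    assume "\<not> card (T - aff ` S) \<le> m"
    then have "m + 1 \<le> card (T - aff ` S)" by simp
    then obtain U where U: "U \<subseteq> T - aff ` S" "card U = m + 1" by (rule obtain_subset_with_card_n) auto
    have "proj_line R (\<zero>, \<zero>, \<one>) \<in> PG2_lines R"
      unfolding PG2_lines_def nonzero_triples_def by (rule imageI) auto
    moreover have "U \<subseteq> proj_line R (\<zero>, \<zero>, \<one>)" using U(1) inf by (rule subset_trans)
    ultimately have "PG2_collinear R U" unfolding PG2_collinear_def by (rule bexI[rotated])
    moreover have "U \<subseteq> T" using U(1) by blast
    ultimately show False using T'(4) U(2) by blast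
  qed
  moreover have "card T = card (aff ` S) + card (T - aff ` S)"
    using T' card_Un_disjoint[of "aff ` S" "T - aff ` S"] fin by (simp add: Un_absorb1)
  ultimately have "card T \<le> card S + m" using card_image[OF inj] by simp
  then show ?thesis using comp by blast
qed

end

section \<open>Small complete arcs\<close>

text \<open>With \<open>M\<close> the largest power of \<open>p\<close> below \<open>(m - 2) / 4\<close>, the bounds \<open>4 M \<le> m - 2\<close> and
  \<open>m - 2 \<le> 2 M (M - 3)\<close> leave room for \<open>j = \<lceil>(m - 2) / (2 M)\<rceil> + 1\<close>.\<close>

lemma exists_arc_parameters:
  fixes p m :: nat
  assumes p: "p \<ge> 5" and m: "m \<ge> 4 * p ^ 2 + 2"
  shows "\<exists>f j d. f > 0 \<and> 2 \<le> j \<and> j < p ^ f \<and> 2 \<le> d \<and> d \<le> 2 + (j - 2) * p ^ f \<and> m = j * p ^ f + d"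
proof -
  define t where "t = m - 2"
  have t: "m = t + 2" "t \<ge> 4 * p ^ 2" using m unfolding t_def by auto
  have "t div 4 \<ge> p ^ 2" using t by linarith
  then have "t div 4 \<ge> 1" using p by (meson less_le_trans one_le_numeral one_le_power order_trans)
  then obtain f where f: "p ^ f \<le> t div 4" "t div 4 < p ^ (f + 1)"
    using ex_power_ivl1[of p "t div 4"] p by auto
  define M where "M = p ^ f"
  have "p ^ 2 < p ^ (f + 1)" using f \<open>t div 4 \<ge> p ^ 2\<close> by linarith
  then have f2: "f \<ge> 2" using power_less_imp_less_exp[of p 2 "f + 1"] p by simp
  \<comment> \<open>This gives \<open>2 * p \<le> M - 3\<close>, which converts the bound
    \<open>4 * p * M\<close> for \<open>t\<close> into one in terms of \<open>M\<close>
    alone.\<close>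
  have Mp: "M \<ge> 2 * p + 3"
  proof -
    have "p * 5 \<le> p * p" using p by (intro mult_left_mono) auto
    moreover have "p * p \<le> M" unfolding M_def using p f2 power_increasing[of 2 f p] by (simp add: power2_eq_square)
    ultimately show ?thesis using p by linarith
  qed
  have M4: "4 * M \<le> t" using f(1) unfolding M_def by linarith
  have "t div 4 < p * M" using f(2) unfolding M_def by simp
  then have "t < 4 * (p * M)" by linarith
  also have "4 * (p * M) = 2 * M * (2 * p)" by simp
  also have "\<dots> \<le> 2 * M * (M - 3)" using Mp by (intro mult_left_mono) auto
  finally have tM: "t \<le> 2 * M * (M - 3)" by simp
  define c where "c = (t + 2 * M - 1) div (2 * M)"
  have M0: "2 * M > 0" using Mp by simp
  have c1: "c * (2 * M) \<le> t + 2 * M - 1" unfolding c_def by (rule div_times_less_eq_dividend)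
  have c2: "t \<le> c * (2 * M)"
  proof -
    have "t + 2 * M - 1 < (c + 1) * (2 * M)"
      unfolding c_def using M0 by (metis Suc_eq_plus1 dividend_less_div_times mult_Suc add.commute mult.commute)
    then show ?thesis using M0 by (simp add: add_mult_distrib)
  qed
  have cM: "c \<le> M - 3"
  proof -
    have "t + 2 * M - 1 < (M - 3 + 1) * (2 * M)"
      using tM M0 by (simp add: add_mult_distrib mult.commute)
    then have "c < M - 3 + 1" unfolding c_def by (simp add: less_mult_imp_div_less)
    then show ?thesis by simp
  qed
  have "c \<noteq> 0"
  proof
    assume "c = 0"
    then show False using c2 M4 M0 by simp
  qed
  define j where "j = c + 1"
  have jM: "j * M \<le> t"
  proof -
    have "2 * (j * M) = c * (2 * M) + 2 * M" unfolding j_def by (simp add: algebra_simps)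
    then show ?thesis using c1 M4 M0 by linarith
  qed
  \<comment> \<open>Since \<open>j + (j - 2) = 2 * c\<close>, this is the inequality achieved by
    rounding up in \<open>c\<close>.\<close>
  have up: "t \<le> j * M + (j - 2) * M"
  proof -
    have "(j - 2) * M + M = c * M" using \<open>c \<noteq> 0\<close> unfolding j_def by (cases c) auto
    then have "j * M + (j - 2) * M = c * (2 * M)" unfolding j_def by (simp add: algebra_simps)
    then show ?thesis using c2 by simp
  qed
  have "2 \<le> m - j * M" "m - j * M \<le> 2 + (j - 2) * M" "m = j * M + (m - j * M)" using jM up t(1) by auto
  moreover have "f > 0" "2 \<le> j" "j < M" using f2 \<open>c \<noteq> 0\<close> cM Mp unfolding j_def by auto
  ultimately show ?thesis unfolding M_def by blast
qed

text \<open>The summand \<open>p ^ f * m\<close> accounts for the points at infinity added in the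
  completion; multiplying the bound by \<open>p ^ f\<close> avoids a division.\<close>

lemma min_complete_arc_bound:
  fixes K :: "nat ring"
  assumes K: "Ring.field K" "finite (carrier K)" and p: "prime p" "p > 3" "order K = p ^ a" and n: "n > 0"
    and f: "f > 0" "order K ^ n = ((p ^ f) ^ 2) ^ h" and j: "2 \<le> j" "j < p ^ f"
    and d: "2 \<le> d" "d \<le> 2 + (j - 2) * p ^ f" and m: "m = j * p ^ f + d"
    and h: "(p ^ f) ^ h > curve_bound p m (((p ^ f) ^ 2) ^ m)"
  shows "\<exists>c. min_complete_arc (order K ^ n) m \<le> enat c \<and> p ^ f * c \<le> j * order K ^ n + p ^ f * m"
proof -
  define Q where "Q = order K ^ n"
  have "arc_field K" by (rule arc_field_all[OF K])
  then have ex: "\<exists>R :: nat ring. Ring.field R \<and> order R = Q"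
    using p n unfolding arc_field_def Q_def by blast
  define R where "R = GF Q"
  have R: "Ring.field R" "order R = Q" unfolding R_def using field_GF[OF ex] by auto
  have "order K > 0" using K(2) unfolding Coset.order_def
    by (metis K(1) card_gt_0_iff cring.cring_simprules(2) empty_iff fieldE(1))
  then have Q0: "Q > 0" unfolding Q_def by simp
  then have fin: "finite (carrier R)" using R(2) unfolding Coset.order_def by (intro card_ge_0_finite) simp
  have "Q = p ^ (a * n)" unfolding Q_def p(3) by (simp add: power_mult)
  then obtain S where S: "affine_arc R m S" "p ^ f * card S = j * Q"
    using arc_field_all[OF R(1) fin] p f j d m h R(2) unfolding arc_field_def Q_def[symmetric]
    by (metis less_imp_le)
  interpret finite_field_plane R
    using R(1) fin by (intro finite_field_plane.intro finite_field_plane_axioms.intro)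
  have "S \<noteq> carrier R \<times> carrier R"
  proof
    assume "S = carrier R \<times> carrier R"
    then have "card S = Q * Q" using R(2) unfolding Coset.order_def by (simp add: card_cartesian_product)
    then have "(p ^ f * Q) * Q = j * Q" using S(2) by auto
    then have "p ^ f * Q = j" using Q0 by auto
    then have "p ^ f * 1 \<le> j" using Q0 by (metis Suc_leI One_nat_def mult_le_mono2)
    then show False using j by simp
  qed
  from exists_complete_arc[OF S(1) this] obtain T where T: "is_complete_arc R m T" "card T \<le> card S + m" by blast
  have "min_complete_arc Q m \<le> enat (card T)"
    unfolding min_complete_arc_def by (rule INF_lower) (use T(1) in \<open>simp add: R_def\<close>)
  moreover have "p ^ f * card T \<le> p ^ f * (card S + m)" using T(2) by simp
  then have "p ^ f * card T \<le> j * Q + p ^ f * m" using S(2) by (simp add: distrib_left)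
  ultimately show ?thesis unfolding Q_def by blast
qed

theorem theorem5p3:
  shows "\<exists>C :: nat \<Rightarrow> real. (\<forall>m. C m > 0) \<and>
    (\<forall>K :: nat ring. field K \<and> finite (carrier K) \<and> ring_char K > 3 \<longrightarrow>
      (\<exists>E :: nat set. finite E \<and>
        (\<forall>m. m \<ge> 8 \<and> m \<notin> E \<longrightarrow>
          (\<exists>n :: nat \<Rightarrow> nat. (\<forall>k. n k > 0) \<and> filterlim n at_top sequentially \<and>
            limsup (\<lambda>k.
              (ereal (real (order K ^ n k)) - ereal_of_enat (min_complete_arc (order K ^ n k) m))
                / ereal (C m * sqrt (real (order K ^ n k)))) \<ge> 1))))"
proof (intro exI[of _ "\<lambda>_. 1"] conjI allI impI)
  fix K :: "nat ring" assume K: "field K \<and> finite (carrier K) \<and> ring_char K > 3"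
  define p where "p = ring_char K"
  obtain a where a: "prime p" "a > 0" "order K = p ^ a"
    using finite_field_order[of K] K unfolding p_def by auto
  have p5: "p \<ge> 5"
  proof -
    have "p \<noteq> 4"
    proof
      assume "p = 4"
      then have "2 dvd p" by simp
      then show False using a(1) \<open>p = 4\<close> by (metis prime_nat_iff numeral_eq_one_iff semiring_norm(83,85,86) numeral_eq_iff verit_eq_simplify(8))
    qed
    then show ?thesis using K unfolding p_def by simp
  qed
  show "\<exists>E :: nat set. finite E \<and>
        (\<forall>m. m \<ge> 8 \<and> m \<notin> E \<longrightarrow>
          (\<exists>n :: nat \<Rightarrow> nat. (\<forall>k. n k > 0) \<and> filterlim n at_top sequentially \<and>
            limsup (\<lambda>k.
              (ereal (real (order K ^ n k)) - ereal_of_enat (min_complete_arc (order K ^ n k) m))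
                / ereal (1 * sqrt (real (order K ^ n k)))) \<ge> 1))"
  \<comment> \<open>The excluded \<open>m\<close> are those for which the power of \<open>p\<close>
    below \<open>(m - 2) / 4\<close> may be too small to leave room for \<open>j\<close> and
    \<open>d\<close>.\<close>
  proof (intro exI[of _ "{..<4 * p ^ 2 + 2}"] conjI allI impI)
    fix m assume m: "m \<ge> 8 \<and> m \<notin> {..<4 * p ^ 2 + 2}"
    then obtain f j d where f: "f > 0" and j: "2 \<le> j" "j < p ^ f"
      and d: "2 \<le> d" "d \<le> 2 + (j - 2) * p ^ f" "m = j * p ^ f + d"
      using exists_arc_parameters[OF p5, of m] by auto
    define M where "M = p ^ f"
    \<comment> \<open>With this offset, \<open>h k < M ^ h k\<close> already puts
      \<open>M ^ h k\<close> above \<open>curve_bound\<close>; the summand \<open>m + 2\<close> is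
      for the final comparison.\<close>
    define k0 where "k0 = curve_bound p m ((M ^ 2) ^ m) + m + 2"
    \<comment> \<open>The factor \<open>2 * f\<close> makes the order of the extension a power of
      \<open>M ^ 2\<close>, whatever \<open>a\<close> is.\<close>
    define n where "n k = 2 * f * (k + k0)" for k
    define h where "h k = a * (k + k0)" for k
    have M2: "M \<ge> 2" using j unfolding M_def by simp
    have hk: "h k \<ge> k + k0" for k unfolding h_def using a(2) by simp
    have Q: "order K ^ n k = (M ^ 2) ^ h k" for k
      unfolding a(3) n_def h_def M_def by (simp add: mult_ac flip: power_mult)
    \<comment> \<open>The inequality holds for every \<open>k\<close>, so no limit has to be
      computed.\<close>
    have large: "1 \<le> (ereal (real (order K ^ n k)) - ereal_of_enat (min_complete_arc (order K ^ n k) m))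
        / ereal (1 * sqrt (real (order K ^ n k)))" for k
    proof -
      define r where "r = M ^ h k"
      have Qr: "order K ^ n k = r ^ 2" unfolding Q r_def by (simp add: mult.commute flip: power_mult)
      have "h k < 2 ^ h k" by (rule less_exp)
      also have "(2::nat) ^ h k \<le> r" unfolding r_def using M2 by (rule power_mono) simp
      finally have hr: "h k < r" .
      then have big: "(p ^ f) ^ h k > curve_bound p m (((p ^ f) ^ 2) ^ m)"
        using hk[of k] unfolding r_def k0_def M_def by simp
      have "n k > 0" unfolding n_def k0_def using f by simp
      have "\<exists>c. min_complete_arc (order K ^ n k) m \<le> enat c \<and> p ^ f * c \<le> j * order K ^ n k + p ^ f * m"
        by (rule min_complete_arc_bound[OF _ _ a(1) _ a(3) \<open>n k > 0\<close> f _ j d big])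
          (use K Q[of k] in \<open>simp_all add: M_def p_def\<close>)
      then obtain c where c: "min_complete_arc (order K ^ n k) m \<le> enat c" "M * c \<le> j * r ^ 2 + M * m"
        unfolding M_def[symmetric] unfolding Qr by blast
      \<comment> \<open>Splitting one factor \<open>M\<close> off \<open>r\<close> gives
        \<open>M * (m + r) \<le> r ^ 2\<close>; together with \<open>j + 1 \<le> M\<close> this
        leaves a gap of at least \<open>r\<close>.\<close>
      define g where "g = M ^ (h k - 1)"
      have rg: "r = M * g" unfolding r_def g_def using hk[of k] by (simp add: k0_def flip: power_Suc)
      have gm: "g \<ge> m + 1"
      proof -
        have "h k - 1 < 2 ^ (h k - 1)" by (rule less_exp)
        also have "(2::nat) ^ (h k - 1) \<le> g" unfolding g_def using M2 by (rule power_mono) simp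
        finally show ?thesis using hk[of k] unfolding k0_def by simp
      qed
      have "M * (c + r) \<le> M * r ^ 2"
      proof -
        have "M * m + M * r \<le> r ^ 2"
        proof -
          have "M * m + M * r = M * (m + r)" by (simp add: distrib_left)
          also have "\<dots> \<le> M * (g * r)"
          proof (rule mult_left_mono)
            have "m \<le> m * r" using hr by simp
            then have "m + r \<le> (m + 1) * r" by (simp add: add_mult_distrib)
            also have "\<dots> \<le> g * r" using gm by (rule mult_right_mono) simp
            finally show "m + r \<le> g * r" .
          qed simp
          also have "\<dots> = r ^ 2" using rg by (simp add: power2_eq_square)
          finally show ?thesis .
        qed
        moreover have "j * r ^ 2 + r ^ 2 \<le> M * r ^ 2"
        proof -
          have "j + 1 \<le> M" using j unfolding M_def by simp
          then have "(j + 1) * r ^ 2 \<le> M * r ^ 2" by (rule mult_right_mono) simp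
          then show ?thesis by (simp add: add_mult_distrib)
        qed
        ultimately show ?thesis using c(2) unfolding distrib_left by linarith
      qed
      then have cr: "c + r \<le> r ^ 2" using M2 by simp
      obtain A where A: "min_complete_arc (order K ^ n k) m = enat A" "A \<le> c"
        using c(1) by (cases "min_complete_arc (order K ^ n k) m") auto
      have "real r \<le> real (r ^ 2) - real A"
      proof -
        have "real (c + r) \<le> real (r ^ 2)" using cr by (rule of_nat_mono)
        then show ?thesis using A(2) by simp
      qed
      moreover have "r > 0" using hr by simp
      ultimately have "1 \<le> (real (r ^ 2) - real A) / real r" by simp
      moreover have "sqrt (real (r ^ 2)) = real r" by simp
      ultimately show ?thesis using \<open>r > 0\<close> unfolding A(1)[unfolded Qr] Qr by simp
    qed
    show "\<exists>n :: nat \<Rightarrow> nat. (\<forall>k. n k > 0) \<and> filterlim n at_top sequentially \<and>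
            limsup (\<lambda>k.
              (ereal (real (order K ^ n k)) - ereal_of_enat (min_complete_arc (order K ^ n k) m))
                / ereal (1 * sqrt (real (order K ^ n k)))) \<ge> 1"
    proof (intro exI[of _ n] conjI allI)
      show "n k > 0" for k unfolding n_def k0_def using f by simp
      show "filterlim n at_top sequentially"
      proof (rule filterlim_at_top_mono[OF filterlim_ident])
        show "eventually (\<lambda>k. k \<le> n k) sequentially"
        proof (rule always_eventually, rule allI)
          fix k
          have "1 * k \<le> 2 * f * (k + k0)" using f by (intro mult_mono) auto
          then show "k \<le> n k" unfolding n_def by simp
        qed
      qed
      show "1 \<le> limsup (\<lambda>k. (ereal (real (order K ^ n k)) - ereal_of_enat (min_complete_arc (order K ^ n k) m))
          / ereal (1 * sqrt (real (order K ^ n k))))"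
        by (rule le_Limsup) (use large in simp_all)
    qed
  qed simp
qed simp

end
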